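(* Let $n\ge 4$, and put $L(4)=7$ and $L(n)=n+2$ for $n\ge 5$. Let $K\subset\mathbb R^n$ be a convex body with boundary $\partial K$ of class $C^3$. Suppose that for every point $p\in\partial K$ there are at least $L(n)$ point light sources on the tangent hyperplane $T_p\partial K$, in a general linear position with respect to $p$, each of which creates a flat shadow boundary on $K$. Then $K$ is an ellipsoid.
   Context: A convex body in $\mathbb R^n$ is a compact convex set with non-empty interior. $T_p\partial K$ denotes the affine hyperplane tangent to $\partial K$ at $p$. A point light source is a point $q\in\mathbb R^n\setminus K$. The shadow boundary it creates on $K$ is the set of points $x\in\partial K$ such that the line through $q$ and $x$ supports $K$ (does not meet the interior of $K$); since $\partial K$ is $C^1$, this is the set $\{x\in\partial K: q\in T_x\partial K\}$. The shadow boundary is flat if it is contained in an affine hyperplane of $\mathbb R^n$. A set containing at least $d$ points in a $d$-dimensional affine space is in a general linear position with respect to a point $p$ if no $d$ of its points lie in a hyperplane (of that $d$-dimensional space) passing through $p$. Here this is applied in the $(n-1)$-dimensional affine space $T_p\partial K$, so $d=n-1$; equivalently, for any $n-1$ distinct light sources $u_1,\dots,u_{n-1}$ of the set, the vectors $u_1-p,\dots,u_{n-1}-p$ are linearly independent. An ellipsoid is the image of the closed unit Euclidean ball under an invertible affine map. *)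

theory Defs
  imports "HOL-Analysis.Analysis"
begin

definition convex_body :: "'a::euclidean_space set \<Rightarrow> bool" where
  "convex_body K \<longleftrightarrow> compact K \<and> convex K \<and> interior K \<noteq> {}"

(* Meant for open U: f is k times continuously differentiable on U, by recursion on the
   directional derivatives of f. *)
primrec Ck_on :: "nat \<Rightarrow> 'a::euclidean_space set \<Rightarrow> ('a \<Rightarrow> real) \<Rightarrow> bool" where
  "Ck_on 0 U f \<longleftrightarrow> continuous_on U f"
| "Ck_on (Suc k) U f \<longleftrightarrow>
     (\<forall>x\<in>U. f differentiable (at x)) \<and>
     (\<forall>v. Ck_on k U (\<lambda>x. frechet_derivative f (at x) v))"

(* Embedded hypersurface of class C^k: locally a regular level set of a C^k function. *)
definition Ck_hypersurface :: "nat \<Rightarrow> 'a::euclidean_space set \<Rightarrow> bool" where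
  "Ck_hypersurface k S \<longleftrightarrow>
     (\<forall>p\<in>S. \<exists>U f. open U \<and> p \<in> U \<and> Ck_on k U f \<and>
        S \<inter> U = {x \<in> U. f x = 0} \<and>
        (\<forall>x\<in>S \<inter> U. frechet_derivative f (at x) \<noteq> (\<lambda>v. 0)))"

(* The affine tangent space (translated to pass through p), by velocities of curves in S. *)
definition tangent_hyperplane :: "'a::euclidean_space set \<Rightarrow> 'a \<Rightarrow> 'a set" where
  "tangent_hyperplane S p =
     {p + v | v. \<exists>\<gamma> e. e > 0 \<and> \<gamma> 0 = p \<and> (\<forall>t\<in>{-e<..<e}. \<gamma> t \<in> S) \<and>
        (\<gamma> has_vector_derivative v) (at (0::real))}"

definition shadow_boundary :: "'a::euclidean_space set \<Rightarrow> 'a \<Rightarrow> 'a set" where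
  "shadow_boundary K q = {x \<in> frontier K. affine hull {q, x} \<inter> interior K = {}}"

definition flat :: "'a::euclidean_space set \<Rightarrow> bool" where
  "flat S \<longleftrightarrow> (\<exists>a b. a \<noteq> 0 \<and> S \<subseteq> {x. a \<bullet> x = b})"

(* For an affine space T containing p, with d = aff_dim T: no d distinct points of X lie in a
   hyperplane of T passing through p. *)
definition general_linear_position ::
    "'a::euclidean_space set \<Rightarrow> 'a \<Rightarrow> 'a set \<Rightarrow> bool" where
  "general_linear_position T p X \<longleftrightarrow>
     X \<subseteq> T \<and>
     (\<forall>Y. Y \<subseteq> X \<and> finite Y \<and> int (card Y) = aff_dim T \<longrightarrow>
        \<not> (\<exists>H. affine H \<and> H \<subseteq> T \<and> aff_dim H = aff_dim T - 1 \<and> p \<in> H \<and> Y \<subseteq> H))"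

definition ellipsoid :: "'a::euclidean_space set \<Rightarrow> bool" where
  "ellipsoid K \<longleftrightarrow> (\<exists>(f :: 'a \<Rightarrow> 'a) c. linear f \<and> bij f \<and> K = (\<lambda>x. c + f x) ` cball 0 1)"

definition num_lights :: "nat \<Rightarrow> nat" where
  "num_lights n = (if n = 4 then 7 else n + 2)"

end

theory Submission
  imports Defs
begin

text \<open>Centre the body at an interior point and let \<open>\<rho>\<close> be its gauge, so that every derivative of \<open>\<rho>\<close>
  lives on one vector space and no charts are needed. At a boundary point with nondegenerate second
  derivative \<open>Q = D\<^sup>2\<rho>\<close>, a second order expansion shows that a flat shadow boundary of a light \<open>q\<close>
  forces \<open>D\<^sup>3\<rho>(q,v,v) = \<mu> Q(v,v)\<close> on the \<open>Q\<close>-orthogonal complement of \<open>q\<close>; for enough lights in general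
  position linear algebra upgrades this to \<open>D\<^sup>3\<rho> = 3 \<ell> Q\<close> with a linear form \<open>\<ell>\<close>. A Pick--Berwald argument
  then gives a quadric locally: there is a positive \<open>h\<close> with \<open>dh = -h \<ell>\<close>, and since \<open>h\<^sup>3 Q(v,v)\<close> is constant
  along lines of direction \<open>v\<close>, the function \<open>h\<close> turns out to be a linear form plus a multiple of \<open>\<rho>\<close>.
  A quadric with a nondegenerate point has no degenerate ones, so the local quadric propagates to the
  whole boundary.\<close>

section \<open>Derivatives of a positively homogeneous function\<close>

text \<open>\<open>D3\<close> is the last derivative at hand, so the form \<open>l\<close> cannot be
  differentiated; integrability steps that would do so are replaced by identities between values at
  the ends of segments. Strict convexity is not assumed: the Hessian may degenerate at boundary
  points, the cubic identity is available only where it does not, and the global step has to rule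
  out that degeneracy enters in the limit. A first nondegenerate point is a point of the body
  farthest from the centre. Homogeneity puts \<open>x\<close> into the kernel of
  \<open>D2 x\<close>, so definiteness, independence and spanning are meant modulo the radial
  direction. The counts 7 and n + 2 come from the inequality \<open>r * (d - 2) > d - 1\<close> with
  d = n - 1, where r is the number of lights beyond n: a set of lights that gains r members in each
  of d - 2 steps, and has to avoid a disjoint set all the time, runs out of room. The quadric
  appears as \<open>B(x,x) = 2 (be \<bullet> x) rho(x) + ga rho(x)^2\<close>, which on
  \<open>rho x = 1\<close> is an inhomogeneous quadratic equation.\<close>

lemma linear_functional_inner:
  fixes f :: "'a::euclidean_space \<Rightarrow> real"
  assumes "linear f"
  shows "(\<Sum>b\<in>Basis. f b *\<^sub>R b) \<bullet> w = f w"
proof -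
  have "f w = f (\<Sum>b\<in>Basis. (w \<bullet> b) *\<^sub>R b)" by (simp add: euclidean_representation)
  also have "\<dots> = (\<Sum>b\<in>Basis. (w \<bullet> b) * f b)"
    by (simp add: linear_sum[OF assms] linear_cmul[OF assms])
  also have "\<dots> = (\<Sum>b\<in>Basis. f b *\<^sub>R b) \<bullet> w"
    unfolding inner_sum_left by (intro sum.cong) (simp_all add: inner_commute[of w])
  finally show ?thesis by simp
qed

lemma in_span_scale_iff:
  fixes w :: "'a::real_vector"
  shows "s \<noteq> 0 \<Longrightarrow> s *\<^sub>R w \<in> span S \<longleftrightarrow> w \<in> span S"
  using span_mul[of w S s] span_mul[of "s *\<^sub>R w" S "inverse s"] by auto

lemma span_singleton_shift:
  fixes w :: "'a::real_vector"
  shows "x + w \<in> span {x} \<longleftrightarrow> w \<in> span {x}" "w - x \<in> span {x} \<longleftrightarrow> w \<in> span {x}"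
proof -
  have x: "x \<in> span {x}" by (simp add: span_base)
  show "x + w \<in> span {x} \<longleftrightarrow> w \<in> span {x}" by (rule span_add_eq[OF x])
  show "w - x \<in> span {x} \<longleftrightarrow> w \<in> span {x}" using span_add_eq[OF x, of "w - x"] by simp
qed

section \<open>Symmetry of second derivatives from differentiability at a point\<close>

lemma has_derivative_along_line:
  fixes f :: "'a::real_normed_vector \<Rightarrow> real"
  assumes "(f has_derivative f') (at (x + t *\<^sub>R v))"
  shows "((\<lambda>s. f (x + s *\<^sub>R v)) has_real_derivative f' v) (at t)"
proof -
  have "((\<lambda>s. x + s *\<^sub>R v) has_derivative (\<lambda>s. s *\<^sub>R v)) (at t)"
    by (auto intro!: derivative_eq_intros)
  from diff_chain_at[OF this assms]
  have "((\<lambda>s. f (x + s *\<^sub>R v)) has_derivative (\<lambda>s. f' (s *\<^sub>R v))) (at t)" by (simp add: o_def)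
  moreover have "f' (s *\<^sub>R v) = s * f' v" for s
    using linear_cmul[OF has_derivative_linear[OF assms]] by simp
  ultimately show ?thesis by (simp add: has_field_derivative_def mult_commute_abs)
qed

text \<open>The mean value theorem in direction \<open>v\<close>, applied to the increment in
  direction \<open>w\<close>, reduces the second difference to two values of \<open>D1 _ v\<close>,
  which are expanded to first order at \<open>x\<close>. The second difference is symmetric in
  \<open>v\<close> and \<open>w\<close>, which yields the symmetry of the limit.\<close>

lemma second_difference_estimate:
  fixes f :: "'a::real_normed_vector \<Rightarrow> real"
  assumes "open S" "x \<in> S" and d1: "\<And>y. y \<in> S \<Longrightarrow> (f has_derivative D1 y) (at y)"
    and d2: "((\<lambda>y. D1 y v) has_derivative D2) (at x)" and "e > 0"
  shows "\<exists>d>0. \<forall>t. 0 < t \<and> t < d \<longrightarrow>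
    \<bar>f (x + t *\<^sub>R v + t *\<^sub>R w) - f (x + t *\<^sub>R v) - f (x + t *\<^sub>R w) + f x - t\<^sup>2 * D2 w\<bar> \<le> e * t\<^sup>2"
proof -
  \<comment> \<open>\<open>t * N\<close> bounds the sum of the distances from \<open>x\<close> of
    the two points where \<open>D1 _ v\<close> is expanded; the summand 1 keeps \<open>N\<close>
    positive.\<close>
  define N where "N = 2 * norm v + norm w + 1"
  have N: "N > 0" by (simp add: N_def add_nonneg_pos)
  have "e / N > 0" using N \<open>e > 0\<close> by simp
  then obtain d1 where d1': "d1 > 0"
    "\<And>y. norm (y - x) < d1 \<Longrightarrow> \<bar>D1 y v - D1 x v - D2 (y - x)\<bar> \<le> e / N * norm (y - x)"
    using d2 unfolding has_derivative_at_alt by (metis real_norm_def)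
  obtain r where r: "r > 0" "ball x r \<subseteq> S" using assms(1,2) open_contains_ball by blast
  define d where "d = min d1 r / N"
  have lin: "linear D2" using d2 by (rule has_derivative_linear)
  have "\<bar>f (x + t *\<^sub>R v + t *\<^sub>R w) - f (x + t *\<^sub>R v) - f (x + t *\<^sub>R w) + f x - t\<^sup>2 * D2 w\<bar> \<le> e * t\<^sup>2"
    if t: "0 < t" "t < d" for t
  proof -
    have tN: "t * N < d1" "t * N < r" using t N by (auto simp: d_def pos_less_divide_eq)
    have small: "norm (s *\<^sub>R v + c *\<^sub>R w) < min d1 r" if "0 \<le> s" "s \<le> t" "0 \<le> c" "c \<le> t" for s c
    proof -
      have "norm (s *\<^sub>R v + c *\<^sub>R w) \<le> s * norm v + c * norm w"
        using norm_triangle_ineq[of "s *\<^sub>R v" "c *\<^sub>R w"] that by simp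
      also have "\<dots> \<le> t * norm v + t * norm w" using that by (intro add_mono mult_right_mono) auto
      also have "\<dots> \<le> t * N" unfolding N_def using t by (simp add: distrib_left)
      finally show ?thesis using tN by simp
    qed
    have inS: "x + t' *\<^sub>R w + s *\<^sub>R v \<in> S" if "0 \<le> s" "s \<le> t" "t' = 0 \<or> t' = t" for s t'
    proof -
      have "dist x (x + t' *\<^sub>R w + s *\<^sub>R v) < r"
        using small[of s t'] that t by (auto simp: dist_norm algebra_simps norm_minus_commute)
      then show ?thesis using r by auto
    qed
    define g where "g s = f (x + t *\<^sub>R w + s *\<^sub>R v) - f (x + s *\<^sub>R v)" for s
    have g: "(g has_real_derivative D1 (x + t *\<^sub>R w + s *\<^sub>R v) v - D1 (x + s *\<^sub>R v) v) (at s)"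
      if "0 \<le> s" "s \<le> t" for s
      unfolding g_def using inS[OF that, of 0] inS[OF that, of t]
      by (intro DERIV_diff has_derivative_along_line d1) auto
    obtain z where z: "0 < z" "z < t"
      "g t - g 0 = (t - 0) * (D1 (x + t *\<^sub>R w + z *\<^sub>R v) v - D1 (x + z *\<^sub>R v) v)"
      using MVT2[of 0 t g, OF t(1) g] by blast
    have "\<bar>D1 (x + t *\<^sub>R w + z *\<^sub>R v) v - D1 x v - D2 (z *\<^sub>R v + t *\<^sub>R w)\<bar> \<le> e / N * norm (z *\<^sub>R v + t *\<^sub>R w)"
      using d1'(2)[of "x + t *\<^sub>R w + z *\<^sub>R v"] small[of z t] z by (simp add: algebra_simps)
    moreover have "\<bar>D1 (x + z *\<^sub>R v) v - D1 x v - D2 (z *\<^sub>R v)\<bar> \<le> e / N * norm (z *\<^sub>R v)"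
      using d1'(2)[of "x + z *\<^sub>R v"] small[of z 0] z by simp
    moreover have "D2 (z *\<^sub>R v + t *\<^sub>R w) = D2 (z *\<^sub>R v) + t * D2 w"
      by (simp add: linear_add[OF lin] linear_cmul[OF lin])
    ultimately have "\<bar>D1 (x + t *\<^sub>R w + z *\<^sub>R v) v - D1 (x + z *\<^sub>R v) v - t * D2 w\<bar>
        \<le> e / N * norm (z *\<^sub>R v + t *\<^sub>R w) + e / N * norm (z *\<^sub>R v)" by linarith
    also have "\<dots> = e / N * (norm (z *\<^sub>R v + t *\<^sub>R w) + norm (z *\<^sub>R v))" by (simp add: algebra_simps)
    also have "\<dots> \<le> e / N * (t * N)"
    proof (rule mult_left_mono)
      have "norm (z *\<^sub>R v + t *\<^sub>R w) + norm (z *\<^sub>R v) \<le> 2 * (z * norm v) + t * norm w"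
        using norm_triangle_ineq[of "z *\<^sub>R v" "t *\<^sub>R w"] z t by simp
      also have "\<dots> \<le> 2 * (t * norm v) + t * norm w" using z by (simp add: mult_right_mono)
      also have "\<dots> \<le> t * N" using t by (simp add: N_def algebra_simps)
      finally show "norm (z *\<^sub>R v + t *\<^sub>R w) + norm (z *\<^sub>R v) \<le> t * N" .
    qed (use \<open>e / N > 0\<close> in simp)
    also have "\<dots> = e * t" using N by simp
    finally have "\<bar>t * (D1 (x + t *\<^sub>R w + z *\<^sub>R v) v - D1 (x + z *\<^sub>R v) v - t * D2 w)\<bar> \<le> t * (e * t)"
      using t by (simp add: abs_mult)
    moreover have "f (x + t *\<^sub>R v + t *\<^sub>R w) - f (x + t *\<^sub>R v) - f (x + t *\<^sub>R w) + f x = g t - g 0"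
      by (simp add: g_def algebra_simps)
    ultimately show ?thesis using z(3) by (simp add: power2_eq_square algebra_simps)
  qed
  moreover have "d > 0" using d1'(1) r(1) N by (simp add: d_def)
  ultimately show ?thesis by blast
qed

lemma second_derivative_symmetric:
  fixes f :: "'a::real_normed_vector \<Rightarrow> real"
  assumes S: "open S" "x \<in> S" and d1: "\<And>y. y \<in> S \<Longrightarrow> (f has_derivative D1 y) (at y)"
    and v: "((\<lambda>y. D1 y v) has_derivative Dv) (at x)" and w: "((\<lambda>y. D1 y w) has_derivative Dw) (at x)"
  shows "Dv w = Dw v"
proof (rule ccontr)
  assume ne: "Dv w \<noteq> Dw v"
  define e where "e = \<bar>Dv w - Dw v\<bar> / 3"
  have e: "e > 0" using ne by (simp add: e_def)
  obtain a where a: "a > 0" "\<And>t. 0 < t \<Longrightarrow> t < a \<Longrightarrow>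
    \<bar>f (x + t *\<^sub>R v + t *\<^sub>R w) - f (x + t *\<^sub>R v) - f (x + t *\<^sub>R w) + f x - t\<^sup>2 * Dv w\<bar> \<le> e * t\<^sup>2"
    using second_difference_estimate[OF S d1 v e, of w] by blast
  obtain b where b: "b > 0" "\<And>t. 0 < t \<Longrightarrow> t < b \<Longrightarrow>
    \<bar>f (x + t *\<^sub>R w + t *\<^sub>R v) - f (x + t *\<^sub>R w) - f (x + t *\<^sub>R v) + f x - t\<^sup>2 * Dw v\<bar> \<le> e * t\<^sup>2"
    using second_difference_estimate[OF S d1 w e, of v] by blast
  define t where "t = min a b / 2"
  have t: "0 < t" "t < a" "t < b" using a b by (auto simp: t_def)
  have "\<bar>t\<^sup>2 * Dv w - t\<^sup>2 * Dw v\<bar> \<le> 2 * e * t\<^sup>2"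
    using a(2)[OF t(1,2)] b(2)[OF t(1,3)] by (simp add: add.assoc add.commute[of "t *\<^sub>R w"])
  then have "t\<^sup>2 * \<bar>Dv w - Dw v\<bar> \<le> t\<^sup>2 * (2 * e)"
    by (simp add: abs_mult flip: right_diff_distrib) (simp add: mult_ac)
  then have "\<bar>Dv w - Dw v\<bar> \<le> 2 * e" using t by simp
  then show False using ne by (simp add: e_def)
qed

text \<open>The derivatives are explicit functions of the base point, each assumed only as a
  derivative of the previous one in a fixed direction; their symmetry is derived. \<open>D3\<close>
  merely exists at every point.\<close>

locale gauge3 =
  fixes rho :: "'a::euclidean_space \<Rightarrow> real" and D1 D2 D3
  assumes rho_scale: "c > 0 \<Longrightarrow> rho (c *\<^sub>R x) = c * rho x"
    and rho_pos: "x \<noteq> 0 \<Longrightarrow> rho x > 0"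
    and rho_add: "rho (x + y) \<le> rho x + rho y"
    and D1: "x \<noteq> 0 \<Longrightarrow> (rho has_derivative D1 x) (at x)"
    and D2: "x \<noteq> 0 \<Longrightarrow> ((\<lambda>y. D1 y v) has_derivative D2 x v) (at x)"
    and D3: "x \<noteq> 0 \<Longrightarrow> ((\<lambda>y. D2 y v w) has_derivative D3 x v w) (at x)"
begin

lemma line:
  assumes "x + t *\<^sub>R v \<noteq> 0"
  shows "((\<lambda>s. rho (x + s *\<^sub>R v)) has_real_derivative D1 (x + t *\<^sub>R v) v) (at t)"
    and "((\<lambda>s. D1 (x + s *\<^sub>R v) w) has_real_derivative D2 (x + t *\<^sub>R v) w v) (at t)"
    and "((\<lambda>s. D2 (x + s *\<^sub>R v) w u) has_real_derivative D3 (x + t *\<^sub>R v) w u v) (at t)"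
  by (rule has_derivative_along_line[OF D1[OF assms]] has_derivative_along_line[OF D2[OF assms]]
      has_derivative_along_line[OF D3[OF assms]])+

lemma linear_D:
  assumes "x \<noteq> 0" shows "linear (D1 x)" "linear (D2 x v)" "linear (D3 x v w)"
  using D1[OF assms] D2[OF assms] D3[OF assms] has_derivative_linear by blast+

lemma D2_sym: assumes "x \<noteq> 0" shows "D2 x v w = D2 x w v"
  by (rule second_derivative_symmetric[of "- {0}" x rho D1]) (use assms D1 D2 in auto)

lemma D2_bilinear: assumes "x \<noteq> 0" shows "bilinear (D2 x)"
proof -
  have "(\<lambda>v. D2 x v w) = D2 x w" for w using D2_sym[OF assms] by blast
  then show ?thesis using linear_D(2)[OF assms] by (simp add: bilinear_def)
qed

lemma D3_sym: assumes "x \<noteq> 0" shows "D3 x v w u = D3 x w v u" "D3 x v w u = D3 x v u w"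
proof -
  have "((\<lambda>y. D2 y v w) has_derivative D3 x w v) (at x)"
    by (rule has_derivative_transform_within_open[OF D3[OF assms], of "- {0}"]) (use assms D2_sym in auto)
  then have "D3 x w v = D3 x v w" using D3[OF assms] has_derivative_unique by blast
  then show "D3 x v w u = D3 x w v u" by simp
  show "D3 x v w u = D3 x v u w"
    by (rule second_derivative_symmetric[of "- {0}" x "\<lambda>y. D1 y v" "\<lambda>y. D2 y v"]) (use assms D2 D3 in auto)
qed

lemma D3_bilinear: assumes "x \<noteq> 0" shows "bilinear (D3 x u)"
proof -
  have "(\<lambda>v. D3 x u v w) = D3 x u w" for w using D3_sym(2)[OF assms] by blast
  then show ?thesis using linear_D(3)[OF assms] by (simp add: bilinear_def)
qed

section \<open>Homogeneity and Euler relations\<close>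

lemma D1_scale: assumes "x \<noteq> 0" "c > 0" shows "D1 (c *\<^sub>R x) v = D1 x v"
proof -
  have "((\<lambda>y. c *\<^sub>R y) has_derivative (\<lambda>y. c *\<^sub>R y)) (at x)" by (auto intro!: derivative_eq_intros)
  from diff_chain_at[OF this D1] assms
  have 1: "((\<lambda>y. rho (c *\<^sub>R y)) has_derivative (\<lambda>v. D1 (c *\<^sub>R x) (c *\<^sub>R v))) (at x)" by (simp add: o_def)
  have 2: "((\<lambda>y. rho (c *\<^sub>R y)) has_derivative (\<lambda>v. c * D1 x v)) (at x)"
    using has_derivative_mult_right[OF D1[OF assms(1)], of c] rho_scale[OF assms(2)] by simp
  from has_derivative_unique[OF 1 2] have "D1 (c *\<^sub>R x) (c *\<^sub>R v) = c * D1 x v" by metis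
  moreover have "D1 (c *\<^sub>R x) (c *\<^sub>R v) = c * D1 (c *\<^sub>R x) v"
    using linear_cmul[OF linear_D(1)[of "c *\<^sub>R x"]] assms by simp
  ultimately show ?thesis using assms by simp
qed

lemma D2_scale: assumes "x \<noteq> 0" "c > 0" shows "c * D2 (c *\<^sub>R x) v w = D2 x v w"
proof -
  have "((\<lambda>y. c *\<^sub>R y) has_derivative (\<lambda>y. c *\<^sub>R y)) (at x)" by (auto intro!: derivative_eq_intros)
  from diff_chain_at[OF this D2] assms
  have 1: "((\<lambda>y. D1 (c *\<^sub>R y) v) has_derivative (\<lambda>w. D2 (c *\<^sub>R x) v (c *\<^sub>R w))) (at x)" by (simp add: o_def)
  have 2: "((\<lambda>y. D1 (c *\<^sub>R y) v) has_derivative D2 x v) (at x)"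
    by (rule has_derivative_transform_within_open[OF D2[OF assms(1)], of "- {0}"])
      (use assms D1_scale in auto)
  from has_derivative_unique[OF 1 2] have "D2 (c *\<^sub>R x) v (c *\<^sub>R w) = D2 x v w" by metis
  then show ?thesis
    using linear_cmul[OF linear_D(2)[of "c *\<^sub>R x"]] assms by simp
qed

lemma D1_self: assumes "x \<noteq> 0" shows "D1 x x = rho x"
proof -
  have "((\<lambda>s. rho (0 + s *\<^sub>R x)) has_real_derivative D1 (0 + 1 *\<^sub>R x) x) (at 1)"
    by (rule line) (use assms in auto)
  moreover have "((\<lambda>s. rho (0 + s *\<^sub>R x)) has_real_derivative rho x) (at 1)"
    by (rule has_field_derivative_transform_within_open[of "\<lambda>s. s * rho x" _ _ "{0<..}"])
      (auto simp: rho_scale intro!: derivative_eq_intros)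
  ultimately show ?thesis using DERIV_unique by fastforce
qed

lemma D2_self: assumes "x \<noteq> 0" shows "D2 x v x = 0" "D2 x x v = 0"
proof -
  have "((\<lambda>s. D1 (0 + s *\<^sub>R x) v) has_real_derivative D2 (0 + 1 *\<^sub>R x) v x) (at 1)"
    by (rule line) (use assms in auto)
  moreover have "((\<lambda>s. D1 (0 + s *\<^sub>R x) v) has_real_derivative 0) (at 1)"
    by (rule has_field_derivative_transform_within_open[of "\<lambda>s. D1 x v" _ _ "{0<..}"])
      (auto simp: D1_scale assms intro!: derivative_eq_intros)
  ultimately show "D2 x v x = 0" using DERIV_unique by fastforce
  then show "D2 x x v = 0" using D2_sym[OF assms] by simp
qed

lemma D3_self: assumes "x \<noteq> 0" shows "D3 x v w x = - D2 x v w"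
proof -
  have "((\<lambda>s. D2 (0 + s *\<^sub>R x) v w) has_real_derivative D3 (0 + 1 *\<^sub>R x) v w x) (at 1)"
    by (rule line) (use assms in auto)
  moreover have "((\<lambda>s. D2 (0 + s *\<^sub>R x) v w) has_real_derivative - D2 x v w) (at 1)"
  proof (rule has_field_derivative_transform_within_open[of "\<lambda>s. D2 x v w / s" _ _ "{0<..}"])
    fix s :: real assume "s \<in> {0<..}"
    then show "D2 x v w / s = D2 (0 + s *\<^sub>R x) v w"
      using D2_scale[OF assms, of s v w] by (auto simp: field_simps)
  qed (auto intro!: derivative_eq_intros)
  ultimately show ?thesis using DERIV_unique by fastforce
qed

section \<open>Support inequality and semidefinite Hessian\<close>

lemma rho_continuous: "x \<noteq> 0 \<Longrightarrow> isCont rho x"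
  using D1 has_derivative_continuous by blast

text \<open>Subadditivity bounds the right difference quotients by \<open>rho y\<close>.
  Geometrically, the tangent hyperplane supports the body.\<close>

lemma D1_le: assumes "x \<noteq> 0" shows "D1 x y \<le> rho y"
proof -
  have lim: "((\<lambda>s. (rho (x + s *\<^sub>R y) - rho x) / s) \<longlongrightarrow> D1 x y) (at_right 0)"
    using line(1)[of x 0 y] assms
    by (auto simp: has_field_derivative_iff intro: tendsto_mono[OF at_le])
  show ?thesis
  proof (rule tendsto_upperbound[OF lim])
    show "\<forall>\<^sub>F s in at_right 0. (rho (x + s *\<^sub>R y) - rho x) / s \<le> rho y"
      unfolding eventually_at_right_field
    proof (intro exI[of _ 1] conjI allI impI)
      fix s :: real assume "0 < s" "s < 1"
      then show "(rho (x + s *\<^sub>R y) - rho x) / s \<le> rho y"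
        using rho_add[of x "s *\<^sub>R y"] by (simp add: rho_scale divide_le_eq mult.commute)
    qed simp
  qed simp
qed

text \<open>The support inequalities at \<open>x\<close> and at \<open>x + s v\<close>, each tested
  at the other point, show that \<open>D1 _ v\<close> does not decrease in direction
  \<open>v\<close>; a negative second derivative would make it decrease.\<close>

lemma D2_nonneg: assumes "x \<noteq> 0" shows "D2 x v v \<ge> 0"
proof (rule ccontr)
  assume neg: "\<not> ?thesis"
  have der: "((\<lambda>s. D1 (x + s *\<^sub>R v) v) has_real_derivative D2 x v v) (at 0)"
    using line(2)[of x 0 v v] assms by simp
  obtain e where e: "e > 0" "\<And>s. 0 < s \<Longrightarrow> s < e \<Longrightarrow> D1 (x + s *\<^sub>R v) v < D1 x v"
    using DERIV_neg_dec_right[OF der] neg by auto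
  obtain e' where e': "e' > 0" "\<And>s. \<bar>s\<bar> < e' \<Longrightarrow> x + s *\<^sub>R v \<noteq> 0"
  proof (cases "v = 0")
    case True then show ?thesis using that[of 1] assms by auto
  next
    case False
    show ?thesis
    proof (rule that[of "norm x / norm v"])
      fix s assume "\<bar>s\<bar> < norm x / norm v"
      then have "norm (s *\<^sub>R v) < norm x" using False by (simp add: pos_less_divide_eq)
      then show "x + s *\<^sub>R v \<noteq> 0" by (metis add_eq_0_iff less_irrefl norm_minus_cancel)
    qed (use assms False in auto)
  qed
  define s where "s = min e e' / 2"
  have s: "0 < s" "s < e" "s < e'" using e e' by (auto simp: s_def)
  let ?y = "x + s *\<^sub>R v"
  have y: "?y \<noteq> 0" using e'(2)[of s] s by auto
  have "D1 x ?y \<le> rho ?y" "D1 ?y x \<le> rho x" using D1_le assms y by auto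
  moreover have "D1 x ?y = rho x + s * D1 x v"
    using linear_add[OF linear_D(1)[OF assms]] linear_cmul[OF linear_D(1)[OF assms]] D1_self[OF assms] by simp
  moreover have "D1 ?y x = rho ?y - s * D1 ?y v"
    using linear_add[OF linear_D(1)[OF y], of x "s *\<^sub>R v"] linear_cmul[OF linear_D(1)[OF y]] D1_self[OF y] by simp
  ultimately have "s * D1 x v \<le> s * D1 ?y v" by simp
  then show False using e(2)[OF s(1,2)] s(1) by simp
qed

end

section \<open>Cubic forms and light directions\<close>

locale semidefinite_form =
  fixes Q :: "'a::euclidean_space \<Rightarrow> 'a \<Rightarrow> real" and p :: 'a
  assumes Q_bilinear: "bilinear Q"
    and Q_sym: "Q u v = Q v u"
    and Q_kernel: "Q p v = 0"
    and Q_pos: "v \<notin> span {p} \<Longrightarrow> Q v v > 0"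
    and p_nonzero: "p \<noteq> 0"
begin

lemmas Q_simps = bilinear_ladd[OF Q_bilinear] bilinear_radd[OF Q_bilinear]
  bilinear_lsub[OF Q_bilinear] bilinear_rsub[OF Q_bilinear]
  bilinear_lmul[OF Q_bilinear] bilinear_rmul[OF Q_bilinear]
  bilinear_lzero[OF Q_bilinear] bilinear_rzero[OF Q_bilinear]

text \<open>The Gram operator of \<open>Q\<close>. Its kernel is the line of \<open>p\<close>, so it
  turns vectors modulo \<open>p\<close> into vectors of the hyperplane orthogonal to
  \<open>p\<close>, where independence of lights can be counted.\<close>

definition M :: "'a \<Rightarrow> 'a" where "M u = (\<Sum>b\<in>Basis. Q u b *\<^sub>R b)"

lemma linear_Q_right: "linear (Q u)"
  using Q_bilinear by (auto simp: bilinear_def)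

lemma M_inner: "M u \<bullet> w = Q u w"
  unfolding M_def by (rule linear_functional_inner[OF linear_Q_right])

lemma linear_M: "linear M"
  by (rule linearI; rule vector_eq_rdot[THEN iffD1]) (simp_all add: M_inner inner_simps Q_simps)

lemma M_eq_0_iff: "M v = 0 \<longleftrightarrow> v \<in> span {p}"
proof
  assume "M v = 0"
  then have "Q v v = 0" by (metis M_inner inner_zero_left)
  then show "v \<in> span {p}" using Q_pos[of v] by force
next
  assume "v \<in> span {p}"
  then obtain c where "v = c *\<^sub>R p" by (auto simp: span_singleton)
  moreover have "M p = 0" by (rule vector_eq_rdot[THEN iffD1]) (simp add: M_inner Q_kernel)
  ultimately show "M v = 0" by (simp add: linear_cmul[OF linear_M])
qed

lemma M_eq_0_if_Q: "Q v v = 0 \<Longrightarrow> M v = 0"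
  using Q_pos M_eq_0_iff by force

lemma M_orthogonal_p: "M v \<bullet> p = 0"
  by (simp add: M_inner Q_sym[of v p] Q_kernel)

end

text \<open>The family is indexed by \<open>Y\<close> and may repeat values: two indices with the
  same value carry the relation with coefficients 1 and -1.\<close>

lemma nontrivial_relation:
  fixes f :: "'b \<Rightarrow> 'a::euclidean_space"
  assumes "finite Y" "card Y > dim S" "f ` Y \<subseteq> S"
  obtains l where "(\<Sum>y\<in>Y. l y *\<^sub>R f y) = 0" "\<exists>y\<in>Y. l y \<noteq> (0::real)"
proof (cases "inj_on f Y")
  case True
  have "card (f ` Y) > dim S" by (simp add: True card_image assms)
  then have "dependent (f ` Y)"
    using assms independent_card_le_dim by (metis not_le)
  then obtain u v where u: "(\<Sum>v\<in>f ` Y. u v *\<^sub>R v) = 0" "v \<in> f ` Y" "u v \<noteq> 0"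
    using dependent_finite[of "f ` Y"] assms(1) by auto
  show ?thesis
    by (rule that[of "\<lambda>y. u (f y)"]) (use u True in \<open>auto simp: sum.reindex\<close>)
next
  case False
  then obtain x y where xy: "x \<in> Y" "y \<in> Y" "x \<noteq> y" "f x = f y" by (auto simp: inj_on_def)
  let ?l = "\<lambda>z. if z = x then 1 else if z = y then -1 else (0::real)"
  have "(\<Sum>z\<in>Y. ?l z *\<^sub>R f z) = (\<Sum>z\<in>{x,y}. ?l z *\<^sub>R f z)"
    by (rule sum.mono_neutral_right) (use assms xy in auto)
  also have "\<dots> = 0" using xy by simp
  finally show ?thesis by (rule that) (use xy(1) in auto)
qed

lemma span_image_sum:
  assumes "finite P" "x \<in> span (f ` P)"
  obtains u where "x = (\<Sum>y\<in>P. (u y :: real) *\<^sub>R f y)"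
  using assms
proof (induction P arbitrary: x thesis)
  case empty then show ?case by auto
next
  case (insert a P)
  obtain k where "x - k *\<^sub>R f a \<in> span (f ` P)"
    using insert.prems(2) by (auto simp: span_breakdown_eq)
  then obtain u where u: "x - k *\<^sub>R f a = (\<Sum>y\<in>P. u y *\<^sub>R f y)" using insert.IH by blast
  have "(\<Sum>y\<in>insert a P. (u(a := k)) y *\<^sub>R f y) = k *\<^sub>R f a + (\<Sum>y\<in>P. u y *\<^sub>R f y)"
    using insert.hyps by (simp add: sum.insert) (rule sum.cong, auto)
  then show ?case using insert.prems(1)[of "u(a := k)"] u by (simp add: algebra_simps)
qed

lemma dim_orthogonal_complement:
  fixes p :: "'a::euclidean_space"
  assumes "p \<noteq> 0" shows "dim {x. x \<bullet> p = 0} = DIM('a) - 1"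
  using dim_hyperplane[OF assms] by (simp add: inner_commute)

text \<open>With \<open>n = d + 1\<close>, the numerical assumptions on \<open>r\<close> cover seven lights for \<open>n = 4\<close> (\<open>r = 3\<close>) and
  \<open>n + 2\<close> lights for \<open>n \<ge> 5\<close> (\<open>r = 2\<close>).\<close>

locale lights = semidefinite_form Q p for Q :: "'a::euclidean_space \<Rightarrow> 'a \<Rightarrow> real" and p :: 'a +
  fixes C :: "'a \<Rightarrow> 'a \<Rightarrow> 'a \<Rightarrow> real" and X :: "'a set" and d r :: nat
  assumes C_bilinear: "bilinear (C u)"
    and C_sym: "C u v w = C v u w"
    and C_sym': "C u v w = C u w v"
    and C_p: "C p v w = - Q v w"
    and d_def: "Suc d = DIM('a)" and d3: "d \<ge> 3"
    and finX: "finite X" and cardX: "card X = d + 1 + r"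
    and r2: "r \<ge> 2" and r_large: "r * (d - 2) > d - 1"
    and light: "q \<in> X \<Longrightarrow> \<exists>m. \<forall>v. Q q v = 0 \<longrightarrow> C q v v = m * Q v v"
    and general: "Y \<subseteq> X \<Longrightarrow> card Y \<le> d \<Longrightarrow> (\<Sum>q\<in>Y. l q *\<^sub>R M q) = 0 \<Longrightarrow> q \<in> Y \<Longrightarrow> l q = 0"
begin

lemmas C_simps = bilinear_ladd[OF C_bilinear] bilinear_radd[OF C_bilinear]
  bilinear_lsub[OF C_bilinear] bilinear_rsub[OF C_bilinear]
  bilinear_lmul[OF C_bilinear] bilinear_rmul[OF C_bilinear]

lemma M_ne: assumes "q \<in> X" shows "M q \<noteq> 0"
  using general[of "{q}" "\<lambda>_. 1" q] assms d3 by auto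

lemma Q_self_pos: assumes "q \<in> X" shows "Q q q > 0"
  using M_ne[OF assms] Q_pos M_eq_0_iff by blast

lemma general2:
  assumes "i \<in> X" "j \<in> X" "i \<noteq> j" "a *\<^sub>R M i + b *\<^sub>R M j = 0"
  shows "a = 0" "b = 0"
  using general[of "{i,j}" "\<lambda>x. if x = i then a else b" i]
        general[of "{i,j}" "\<lambda>x. if x = i then a else b" j] assms d3 by auto

text \<open>The form \<open>C q - m Q\<close> vanishes on the \<open>Q\<close>-orthogonal complement
  of \<open>q\<close>, hence is a symmetric product of \<open>Q q\<close> with another linear form.
  The proof splits both arguments into a multiple of \<open>q\<close> and a part in the
  complement.\<close>

lemma light_form:
  assumes "q \<in> X"
  shows "\<exists>m b. \<forall>v w. C q v w = m * Q v w + Q q v * (b \<bullet> w) + Q q w * (b \<bullet> v)"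
proof -
  obtain m where m: "\<And>v. Q q v = 0 \<Longrightarrow> C q v v = m * Q v v" using light[OF assms] by blast
  define N where "N = Q q q"
  have N: "N > 0" using Q_self_pos[OF assms] by (simp add: N_def)
  define g where "g = (\<Sum>b\<in>Basis. C q q b *\<^sub>R b)"
  have g: "g \<bullet> w = C q q w" for w
    unfolding g_def by (rule linear_functional_inner) (use C_bilinear in \<open>auto simp: bilinear_def\<close>)
  \<comment> \<open>The multiple of \<open>M q\<close> is fixed by the case where both arguments are
    \<open>q\<close>, in which the product term is counted twice.\<close>
  define b where "b = (1/N) *\<^sub>R g - ((m * N + C q q q) / (2 * N^2)) *\<^sub>R M q"
  have polar: "C q v w = m * Q v w" if "Q q v = 0" "Q q w = 0" for v w
  proof -
    have "C q (v + w) (v + w) = m * Q (v + w) (v + w)" using that by (intro m) (simp add: Q_simps)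
    then show ?thesis using m[OF that(1)] m[OF that(2)]
      by (simp add: Q_simps C_simps C_sym'[of q w v] Q_sym[of w v] algebra_simps)
  qed
  have "C q v w = m * Q v w + Q q v * (b \<bullet> w) + Q q w * (b \<bullet> v)" for v w
  proof -
    define s t where "s = Q q v / N" and "t = Q q w / N"
    have st: "Q q v = s * N" "Q q w = t * N" using N by (auto simp: s_def t_def)
    have "C q (v - s *\<^sub>R q) (w - t *\<^sub>R q) = m * Q (v - s *\<^sub>R q) (w - t *\<^sub>R q)"
      by (rule polar) (use st in \<open>auto simp: Q_simps N_def\<close>)
    then have e: "C q v w - t * C q q v - s * C q q w + s * t * C q q q
       = m * (Q v w - s * t * N)"
      using st by (simp add: C_simps Q_simps C_sym'[of q v q] Q_sym[of v q] N_def algebra_simps)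
    have "Q q v * (b \<bullet> w) = s * C q q w - s * t * (m * N + C q q q) / 2"
      "Q q w * (b \<bullet> v) = t * C q q v - s * t * (m * N + C q q q) / 2"
      using N by (simp_all add: b_def inner_simps g M_inner st power2_eq_square field_simps)
    moreover have "m * (Q v w - s * t * N) = m * Q v w - s * t * (m * N)" by (simp add: algebra_simps)
    moreover have "s * t * (m * N + C q q q) = s * t * (m * N) + s * t * C q q q" by (simp add: algebra_simps)
    ultimately show ?thesis using e by linarith
  qed
  then show ?thesis by blast
qed

section \<open>Comparing two lights\<close>

definition m :: "'a \<Rightarrow> real" where
  "m q = (SOME m. \<exists>b. \<forall>v w. C q v w = m * Q v w + Q q v * (b \<bullet> w) + Q q w * (b \<bullet> v))"
definition b :: "'a \<Rightarrow> 'a" where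
  "b q = (SOME b. \<forall>v w. C q v w = m q * Q v w + Q q v * (b \<bullet> w) + Q q w * (b \<bullet> v))"

lemma C_light:
  assumes "q \<in> X"
  shows "C q v w = m q * Q v w + Q q v * (b q \<bullet> w) + Q q w * (b q \<bullet> v)"
proof -
  have "\<exists>b. \<forall>v w. C q v w = m q * Q v w + Q q v * (b \<bullet> w) + Q q w * (b \<bullet> v)"
    unfolding m_def by (rule someI_ex[OF light_form[OF assms]])
  from someI_ex[OF this] show ?thesis unfolding b_def by blast
qed

text \<open>The obstruction to divisibility: it vanishes when \<open>b j = l\<close> and
  \<open>m i = l \<bullet> i\<close> for one vector \<open>l\<close>, which is the situation to be
  proved.\<close>

definition al :: "'a \<Rightarrow> 'a \<Rightarrow> real" where "al i j = b j \<bullet> i - m i"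

text \<open>\<open>C i j w\<close> can be computed with the formula of light \<open>i\<close> or
  with that of light \<open>j\<close>; the relation is the difference of the two results.\<close>

lemma pair_relation:
  assumes "i \<in> X" "j \<in> X"
  shows "Q i j *\<^sub>R (b i - b j) = al i j *\<^sub>R M j - al j i *\<^sub>R M i"
proof (rule vector_eq_rdot[THEN iffD1], intro allI)
  fix w
  show "Q i j *\<^sub>R (b i - b j) \<bullet> w = (al i j *\<^sub>R M j - al j i *\<^sub>R M i) \<bullet> w"
    using C_light[OF assms(1), of j w] C_light[OF assms(2), of i w] C_sym[of i j w] Q_sym[of j i]
    by (simp add: inner_simps M_inner al_def algebra_simps)
qed

text \<open>Otherwise there are d + 1 vectors \<open>M y\<close> in a space of dimension d and a
  relation between them. Its part over \<open>A\<close> is \<open>Q\<close>-orthogonal to its part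
  over \<open>B\<close> and also its negative, hence has square zero and vanishes. Both parts are
  then relations short enough for general position.\<close>

lemma orthogonal_card:
  assumes AB: "A \<subseteq> X" "B \<subseteq> X" "A \<noteq> {}" "B \<noteq> {}"
    and orth: "\<And>i j. i \<in> A \<Longrightarrow> j \<in> B \<Longrightarrow> Q i j = 0"
  shows "card A + card B \<le> d"
proof (rule ccontr)
  assume "\<not> ?thesis"
  then have big: "card A + card B \<ge> Suc d" by simp
  have fin: "finite A" "finite B" using AB finX finite_subset by auto
  have pos: "card A \<ge> 1" "card B \<ge> 1" using AB fin by (simp_all add: Suc_leI card_gt_0_iff)
  \<comment> \<open>The split into \<open>a\<close> and \<open>Suc d - a\<close> elements gives d +
    1 vectors in total but at most d on either side, because 1 \<le> a \<le> d.\<close>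
  define a where "a = min (card A) d"
  have a: "1 \<le> a" "a \<le> card A" "a \<le> d" "Suc d - a \<le> card B"
    using pos d3 big by (auto simp: a_def)
  obtain A' where A': "A' \<subseteq> A" "card A' = a" using obtain_subset_with_card_n[OF a(2)] by metis
  obtain B' where B': "B' \<subseteq> B" "card B' = Suc d - a" using obtain_subset_with_card_n[OF a(4)] by metis
  have fin': "finite A'" "finite B'" using A' B' fin finite_subset by auto
  have disj: "A' \<inter> B' = {}"
  proof (rule ccontr)
    assume "A' \<inter> B' \<noteq> {}"
    then obtain x where "x \<in> A" "x \<in> B" using A' B' by auto
    then have "Q x x = 0" "x \<in> X" using orth AB by auto
    then show False using Q_self_pos by force
  qed
  have cU: "card (A' \<union> B') = Suc d" using A' B' a fin' disj by (simp add: card_Un_disjoint)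
  have "card (A' \<union> B') > dim {x. x \<bullet> p = 0}"
    using cU d_def dim_orthogonal_complement[OF p_nonzero] by simp
  moreover have "M ` (A' \<union> B') \<subseteq> {x. x \<bullet> p = 0}" by (auto simp: M_orthogonal_p)
  ultimately obtain l where l: "(\<Sum>y\<in>A' \<union> B'. l y *\<^sub>R M y) = 0" "\<exists>y\<in>A' \<union> B'. l y \<noteq> (0::real)"
    using nontrivial_relation[of "A' \<union> B'"] fin' by (metis finite_UnI)
  define x where "x = (\<Sum>y\<in>A'. l y *\<^sub>R y)"
  have Mx: "M x = (\<Sum>y\<in>A'. l y *\<^sub>R M y)"
    by (simp add: x_def linear_sum[OF linear_M] linear_cmul[OF linear_M])
  have sum0: "M x + (\<Sum>y\<in>B'. l y *\<^sub>R M y) = 0"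
    using l(1) fin' disj by (simp add: Mx sum.union_disjoint)
  have "(\<Sum>y\<in>B'. l y *\<^sub>R M y) \<bullet> x = 0"
  proof -
    have "M y \<bullet> x = 0" if "y \<in> B'" for y
    proof -
      have "M y \<bullet> x = (\<Sum>z\<in>A'. l z * Q y z)" by (simp add: x_def inner_sum_right M_inner)
      also have "\<dots> = 0" 
      proof (rule sum.neutral, intro ballI)
        fix z assume "z \<in> A'"
        then have "Q z y = 0" using A'(1) B'(1) that orth by blast
        then show "l z * Q y z = 0" using Q_sym[of y z] by simp
      qed
      finally show ?thesis .
    qed
    then show ?thesis by (simp add: inner_sum_left)
  qed
  then have "Q x x = 0" using sum0 M_inner[of x x] by (metis add.right_neutral inner_add_left inner_zero_left)
  then have Mx0: "M x = 0" by (rule M_eq_0_if_Q)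
  have "l y = 0" if "y \<in> A'" for y
  proof (rule general[OF _ _ _ that])
    show "A' \<subseteq> X" using A'(1) AB(1) by (rule subset_trans)
    show "card A' \<le> d" using A' a by simp
    show "(\<Sum>q\<in>A'. l q *\<^sub>R M q) = 0" using Mx Mx0 by simp
  qed
  moreover have "l y = 0" if "y \<in> B'" for y
  proof (rule general[OF _ _ _ that])
    show "B' \<subseteq> X" using B'(1) AB(2) by (rule subset_trans)
    show "card B' \<le> d" using B' a by simp
    show "(\<Sum>q\<in>B'. l q *\<^sub>R M q) = 0" using sum0 Mx0 by simp
  qed
  ultimately show False using l(2) by auto
qed

section \<open>The graph of non-orthogonal lights\<close>

definition Nb :: "'a \<Rightarrow> 'a set" where "Nb i = {j \<in> X - {i}. Q i j \<noteq> 0}"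

text \<open>By \<open>orthogonal_card\<close> with \<open>{i}\<close> on one side, at most d - 1 of
  the other d + r lights are orthogonal to \<open>i\<close>.\<close>

lemma card_Nb: assumes i: "i \<in> X" shows "card (Nb i) \<ge> r + 1"
proof -
  let ?N = "X - {i} - Nb i"
  have fin: "finite (X - {i})" and c: "card (X - {i}) = d + r" using finX cardX i by auto
  have sub: "Nb i \<subseteq> X - {i}" by (auto simp: Nb_def)
  have cN: "card ?N + card (Nb i) = d + r"
    using c card_Diff_subset[OF finite_subset[OF sub fin] sub] card_mono[OF fin sub] by simp
  show ?thesis
  proof (cases "?N = {}")
    case True then have "card (Nb i) = d + r" using cN by (metis add_0 card.empty)
    then show ?thesis using d3 by simp
  next
    case False
    have "card {i} + card ?N \<le> d" by (rule orthogonal_card) (use i False in \<open>auto simp: Nb_def\<close>)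
    then show ?thesis using cN by simp
  qed
qed

text \<open>In the graph of non-orthogonal pairs, the set of vertices reachable from the neighbours of \<open>i\<close> with the
  same slope as \<open>j\<close> gains at least \<open>r\<close> vertices per step, so a path with at most \<open>d - 1\<close> vertices leads to a
  neighbour with another slope. Summing the pair relations along that path gives a linear
  relation among at most \<open>d\<close> of the vectors \<open>M q\<close>.\<close>

lemma slope_eq:
  assumes i: "i \<in> X" and jk: "j \<in> Nb i" "k \<in> Nb i"
  shows "al j i / Q i j = al k i / Q i k"
proof (rule ccontr)
  assume ne: "\<not> ?thesis"
  define f where "f x = al x i / Q i x" for x
  define A where "A = {x \<in> Nb i. f x = f j}"
  define B where "B = Nb i - A"
  define V where "V = X - {i}"
  have finV: "finite V" and cV: "card V = d + r" using finX cardX i by (auto simp: V_def)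
  have sub: "A \<subseteq> V" "B \<subseteq> V" by (auto simp: A_def B_def Nb_def V_def)
  have nonempty: "j \<in> A" "k \<in> B" using jk ne by (auto simp: A_def B_def f_def)
  have finAB: "finite A" "finite B" using sub finV finite_subset by auto
  have cAB: "card A + card B \<ge> r + 1"
  proof -
    have "card A + card B = card (A \<union> B)" by (subst card_Un_disjoint) (use finAB in \<open>auto simp: B_def\<close>)
    also have "A \<union> B = Nb i" by (auto simp: A_def B_def)
    finally show ?thesis using card_Nb[OF i] by simp
  qed
  \<comment> \<open>\<open>E t\<close> consists of the vertices at distance at most \<open>t\<close>
    from \<open>A\<close> in the graph with \<open>i\<close> removed.\<close>
  define E where "E = rec_nat A (\<lambda>_ S. S \<union> {y \<in> V. \<exists>x\<in>S. Q x y \<noteq> 0})"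
  have E0: "E 0 = A" and ES: "\<And>t. E (Suc t) = E t \<union> {y \<in> V. \<exists>x\<in>E t. Q x y \<noteq> 0}"
    by (auto simp: E_def)
  have EV: "E t \<subseteq> V" for t by (induction t) (use sub in \<open>auto simp: E0 ES\<close>)
  have Ene: "E t \<noteq> {}" for t by (induction t) (use nonempty in \<open>auto simp: E0 ES\<close>)
  \<comment> \<open>\<open>P\<close> is the vertex set of a path from \<open>a\<close> to
    \<open>x\<close>; the differences of \<open>b\<close> along its edges telescope and stay in the
    span of \<open>M\<close> on \<open>P\<close>.\<close>
  have path: "\<exists>a P. a \<in> A \<and> P \<subseteq> V \<and> a \<in> P \<and> x \<in> P \<and> card P \<le> Suc t \<and> b x - b a \<in> span (M ` P)"
    if "x \<in> E t" for x t
    using that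
  proof (induction t arbitrary: x)
    case 0
    then show ?case using sub by (intro exI[of _ x] exI[of _ "{x}"]) (auto simp: E0 span_zero)
  next
    case (Suc t)
    show ?case
    proof (cases "x \<in> E t")
      case True then show ?thesis using Suc.IH[OF True] le_SucI by blast
    next
      case False
      then obtain y where y: "y \<in> E t" "Q y x \<noteq> 0" "x \<in> V" using Suc.prems by (auto simp: ES)
      obtain a P where P: "a \<in> A" "P \<subseteq> V" "a \<in> P" "y \<in> P" "card P \<le> Suc t" "b y - b a \<in> span (M ` P)"
        using Suc.IH[OF y(1)] by (elim exE conjE) (rule that)
      have X2: "x \<in> X" "y \<in> X" using y P by (auto simp: V_def)
      let ?P = "insert x P"
      have "Q x y *\<^sub>R (b x - b y) \<in> span (M ` ?P)"
        unfolding pair_relation[OF X2]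
        by (intro span_diff span_mul span_base) (use P in auto)
      moreover have "Q x y \<noteq> 0" using y Q_sym by metis
      ultimately have "b x - b y \<in> span (M ` ?P)"
        using span_mul[of "Q x y *\<^sub>R (b x - b y)" "M ` ?P" "inverse (Q x y)"] by simp
      moreover have "b y - b a \<in> span (M ` ?P)" using P(6) span_mono[of "M ` P" "M ` ?P"] by auto
      ultimately have "(b x - b y) + (b y - b a) \<in> span (M ` ?P)" by (rule span_add)
      then have "b x - b a \<in> span (M ` ?P)" by simp
      moreover have "card ?P \<le> Suc (Suc t)"
        using P(5) finite_subset[OF P(2) finV] by (simp add: card_insert_if)
      ultimately show ?thesis using P y by (intro exI[of _ a] exI[of _ ?P]) auto
    qed
  qed
  \<comment> \<open>The pair relation divided by \<open>Q i x\<close>: modulo \<open>M x\<close>,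
    the slope \<open>f x\<close> is the coefficient of \<open>M i\<close>.\<close>
  have step: "b i - b x + f x *\<^sub>R M i \<in> span {M x}" if "x \<in> Nb i" for x
  proof -
    have x: "x \<in> X" "Q i x \<noteq> 0" using that by (auto simp: Nb_def)
    have "Q i x *\<^sub>R (b i - b x + f x *\<^sub>R M i) = al i x *\<^sub>R M x"
      using pair_relation[OF i x(1)] x(2) by (simp add: scaleR_right_distrib f_def)
    then have "Q i x *\<^sub>R (b i - b x + f x *\<^sub>R M i) \<in> span {M x}" by (simp add: span_mul span_base)
    from span_mul[OF this, of "inverse (Q i x)"] show ?thesis using x(2) by simp
  qed
  \<comment> \<open>A shorter path together with \<open>i\<close> has at most d vertices and carries
    a relation whose coefficient at \<open>M i\<close> is \<open>f a - f x\<close>. General position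
    makes it zero, although slopes in \<open>A\<close> and \<open>B\<close> differ.\<close>
  have late: "d \<le> Suc t" if xB: "x \<in> B" and xE: "x \<in> E t" for x t
  proof (rule ccontr)
    assume "\<not> d \<le> Suc t"
    obtain a P where P: "a \<in> A" "P \<subseteq> V" "a \<in> P" "x \<in> P" "card P \<le> Suc t" "b x - b a \<in> span (M ` P)"
      using path[OF xE] by (elim exE conjE) (rule that)
    have finP: "finite P" using P(2) finV finite_subset by blast
    have "b i - b x + f x *\<^sub>R M i \<in> span (M ` P)"
      using step[of x] xB P(4) span_mono[of "{M x}" "M ` P"] by (auto simp: B_def)
    moreover have "b i - b a + f a *\<^sub>R M i \<in> span (M ` P)"
      using step[of a] P span_mono[of "{M a}" "M ` P"] by (auto simp: A_def)
    ultimately have "(b i - b x + f x *\<^sub>R M i) - (b i - b a + f a *\<^sub>R M i) + (b x - b a) \<in> span (M ` P)"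
      by (rule span_add[OF span_diff P(6)])
    then have "(f x - f a) *\<^sub>R M i \<in> span (M ` P)" by (simp add: algebra_simps)
    then obtain u where u: "(f x - f a) *\<^sub>R M i = (\<Sum>y\<in>P. u y *\<^sub>R M y)"
      using span_image_sum[OF finP] by blast
    have iP: "i \<notin> P" using P(2) by (auto simp: V_def)
    let ?l = "\<lambda>y. if y = i then f a - f x else u y"
    have "(\<Sum>y\<in>insert i P. ?l y *\<^sub>R M y) = (f a - f x) *\<^sub>R M i + (\<Sum>y\<in>P. u y *\<^sub>R M y)"
      using iP finP by (simp add: sum.insert) (rule sum.cong, auto)
    also have "\<dots> = 0" by (simp add: u[symmetric] algebra_simps)
    finally have "?l i = 0"
      by (rule general[rotated 2]) (use P iP finP i \<open>\<not> d \<le> Suc t\<close> in \<open>auto simp: V_def\<close>)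
    then show False using xB P(1) by (auto simp: A_def B_def)
  qed
  have noB: "E t \<inter> B = {}" if "t \<le> d - 2" for t using late[of _ t] that d3 by fastforce
  \<comment> \<open>\<open>E t\<close> and the complement of \<open>E (Suc t)\<close> in
    \<open>V\<close> are mutually orthogonal, and the complement contains \<open>k\<close>;
    \<open>orthogonal_card\<close> then says that the step added at least \<open>r\<close>
    vertices.\<close>
  have grow: "card (E t) \<ge> card A + r * t" if "t \<le> d - 2" for t
    using that
  proof (induction t)
    case (Suc t)
    let ?W = "V - E (Suc t)"
    have "k \<in> ?W" using noB[OF Suc.prems] nonempty sub by auto
    then have "card (E t) + card ?W \<le> d"
      by (intro orthogonal_card) (use EV Ene in \<open>auto simp: ES V_def\<close>)
    moreover have "card ?W = d + r - card (E (Suc t))"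
      using cV card_Diff_subset[OF finite_subset[OF EV finV] EV] by metis
    moreover have "card (E (Suc t)) \<le> d + r" using card_mono[OF finV EV] cV by metis
    ultimately show ?case using Suc by simp
  qed (simp add: E0)
  \<comment> \<open>With \<open>cAB\<close> the count reads r + 1 + r (d - 2) \<le> d + r, contrary
    to \<open>r_large\<close>.\<close>
  have "card (E (d - 2)) + card B \<le> card V"
    using card_mono[OF finV, of "E (d - 2) \<union> B"] EV sub noB[of "d - 2"] finAB finite_subset[OF EV finV]
    by (simp add: card_Un_disjoint)
  then show False using grow[of "d - 2"] cAB cV r_large d3 by simp
qed

definition sg :: "'a \<Rightarrow> real" where
  "sg i = (let j = (SOME j. j \<in> Nb i) in al j i / Q i j)"

lemma al_eq:
  assumes "i \<in> X" "j \<in> X" "i \<noteq> j"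
  shows "al j i = sg i * Q i j"
proof (cases "Q i j = 0")
  case True
  have "al i j *\<^sub>R M j + (- al j i) *\<^sub>R M i = 0"
    using pair_relation[OF assms(1,2)] True by simp
  from general2(2)[OF assms(2,1) not_sym[OF assms(3)] this] True show ?thesis by simp
next
  case False
  then have j: "j \<in> Nb i" using assms by (auto simp: Nb_def)
  have "(SOME j. j \<in> Nb i) \<in> Nb i" using j by (rule someI)
  then have "sg i = al j i / Q i j"
    unfolding sg_def Let_def by (rule slope_eq[OF assms(1) _ j])
  then show ?thesis using False by simp
qed

lemma pair_relation':
  assumes "i \<in> X" "j \<in> X" "Q i j \<noteq> 0"
  shows "b i + sg i *\<^sub>R M i = b j + sg j *\<^sub>R M j"
proof (cases "i = j")
  case False
  have "Q i j *\<^sub>R (b i - b j) = Q i j *\<^sub>R (sg j *\<^sub>R M j - sg i *\<^sub>R M i)"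
    using pair_relation[OF assms(1,2)] al_eq[OF assms(1,2) False] al_eq[OF assms(2,1) not_sym[OF False]]
    by (simp add: Q_sym[of j i] scaleR_right_diff_distrib mult.commute)
  then have "b i - b j = sg j *\<^sub>R M j - sg i *\<^sub>R M i" using assms(3) by simp
  then show ?thesis by (simp add: algebra_simps)
qed simp

text \<open>The vector is constant along edges by \<open>pair_relation'\<close>, and the graph is
  connected: a splitting without edges between its parts would violate
  \<open>orthogonal_card\<close>.\<close>

lemma common_functional: "\<exists>l. \<forall>i\<in>X. b i + sg i *\<^sub>R M i = l"
proof -
  have "X \<noteq> {}" using cardX by auto
  then obtain i0 where i0: "i0 \<in> X" by blast
  define l where "l = b i0 + sg i0 *\<^sub>R M i0"
  define S where "S = {i \<in> X. b i + sg i *\<^sub>R M i = l}"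
  have "X - S = {}"
  proof (rule ccontr)
    assume "X - S \<noteq> {}"
    have "card S + card (X - S) \<le> d"
    proof (rule orthogonal_card)
      show "S \<noteq> {}" using i0 by (auto simp: S_def l_def)
      fix i j assume "i \<in> S" "j \<in> X - S"
      then show "Q i j = 0" using pair_relation'[of i j] by (cases "Q i j = 0") (auto simp: S_def)
    qed (use \<open>X - S \<noteq> {}\<close> in \<open>auto simp: S_def\<close>)
    moreover have "S \<subseteq> X" by (auto simp: S_def)
    ultimately show False
      using card_Diff_subset[of S X] card_mono[OF finX, of S] finite_subset[of S X] finX cardX by simp
  qed
  then show ?thesis unfolding S_def by blast
qed

text \<open>If no \<open>sg i\<close> vanished, the vectors \<open>sg i *\<^sub>R i\<close> would have equal pairwise products \<open>ta\<close>. A linear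
  relation avoiding one of them then has coefficient sum zero, so two of the vectors have square \<open>ta\<close>
  as well and coincide modulo \<open>p\<close>.\<close>

lemma sg_zero:
  assumes l: "\<And>i. i \<in> X \<Longrightarrow> b i + sg i *\<^sub>R M i = l" and i: "i \<in> X"
  shows "sg i = 0" "m i = l \<bullet> i"
proof -
  define mu where "mu i = m i - l \<bullet> i" for i
  \<comment> \<open>Substituting \<open>b j\<close> in the slope formula gives this; the left side
    does not depend on \<open>j\<close>, which is what drives the argument.\<close>
  have mu: "mu i = - 2 * sg j * Q i j" if "i \<in> X" "j \<in> X" "i \<noteq> j" for i j
  proof -
    have "al i j = sg j * Q j i" by (rule al_eq) (use that in auto)
    moreover have "b j = l - sg j *\<^sub>R M j" using l[OF that(2)] by (simp add: algebra_simps)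
    ultimately show ?thesis
      by (simp add: al_def mu_def inner_simps M_inner Q_sym[of j i] algebra_simps)
  qed
  have nb: "\<exists>j\<in>X. j \<noteq> i \<and> j \<noteq> k \<and> Q i j \<noteq> 0" if "i \<in> X" for i k
  proof (rule ccontr)
    assume "\<not> ?thesis"
    then have "Nb i \<subseteq> {k}" by (auto simp: Nb_def)
    then have "card (Nb i) \<le> card {k}" by (intro card_mono) auto
    then show False using card_Nb[OF that] r2 by simp
  qed
  have all0: "\<forall>k\<in>X. sg k = 0"
  proof (cases "\<exists>j\<in>X. sg j = 0")
    \<comment> \<open>One vanishing slope \<open>sg j\<close> makes \<open>mu i\<close> zero for all
      \<open>i\<close> other than \<open>j\<close>; every \<open>k\<close> has such an
      \<open>i\<close> as a neighbour, so \<open>sg k\<close> vanishes too.\<close>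
    case True
    then obtain j where j: "j \<in> X" "sg j = 0" by blast
    show ?thesis
    proof
      fix k assume k: "k \<in> X"
      obtain i where i: "i \<in> X" "i \<noteq> k" "i \<noteq> j" "Q k i \<noteq> 0" using nb[OF k] by blast
      then show "sg k = 0" using mu[OF i(1) j(1) i(3)] mu[OF i(1) k i(2)] j Q_sym[of k i] by simp
    qed
  next
    case False
    then have nz: "\<And>j. j \<in> X \<Longrightarrow> sg j \<noteq> 0" by blast
    have "X \<noteq> {}" using cardX by auto
    then obtain j where j: "j \<in> X" by blast
    define ta where "ta = - mu j * sg j / 2"
    have ta: "sg i * sg k * Q i k = ta" if "i \<in> X" "k \<in> X" "i \<noteq> k" for i k
    proof (cases "i = j")
      case True
      then show ?thesis using mu[OF j that(2)] that by (simp add: ta_def mult_ac)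
    next
      case False
      have "mu i * sg i = mu j * sg j"
        using mu[OF that(1) j False] mu[OF j that(1) not_sym[OF False]] by (simp add: Q_sym[of i j])
      moreover have "mu i * sg i = - 2 * (sg i * sg k * Q i k)" using mu[OF that] by simp
      ultimately show ?thesis by (simp add: ta_def)
    qed
    have ta0: "ta \<noteq> 0"
    proof -
      obtain k where "k \<in> X" "k \<noteq> j" "Q j k \<noteq> 0" using nb[OF j, of j] by blast
      then show ?thesis using ta[of j k] nz j by auto
    qed
    have cXj: "card (X - {j}) = d + r" using j finX cardX by simp
    \<comment> \<open>One more vector than the dimension, with \<open>j\<close> left out so that
      pairing the relation with \<open>j\<close> involves only the common product
      \<open>ta\<close>.\<close>
    obtain Y where Y: "Y \<subseteq> X - {j}" "card Y = Suc d"
      using obtain_subset_with_card_n[of "Suc d" "X - {j}"] cXj r2 by auto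
    have finY: "finite Y" using Y finX finite_subset by blast
    have "card Y > dim {x. x \<bullet> p = 0}"
      using Y d_def dim_orthogonal_complement[OF p_nonzero] by simp
    moreover have "M ` Y \<subseteq> {x. x \<bullet> p = 0}" by (auto simp: M_orthogonal_p)
    ultimately obtain w where w: "(\<Sum>y\<in>Y. w y *\<^sub>R M y) = 0" "\<exists>y\<in>Y. w y \<noteq> (0::real)"
      using nontrivial_relation[of Y] finY by metis
    define u where "u y = w y / sg y" for y
    have wu: "w y = u y * sg y" if "y \<in> Y" for y using nz[of y] that Y by (auto simp: u_def)
    have pairing: "(\<Sum>y\<in>Y. u y * (sg y * sg k * Q y k)) = 0" for k
    proof -
      have "0 = sg k * ((\<Sum>y\<in>Y. w y *\<^sub>R M y) \<bullet> k)" using w(1) by simp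
      also have "\<dots> = (\<Sum>y\<in>Y. u y * (sg y * sg k * Q y k))"
        unfolding inner_sum_left sum_distrib_left
        by (intro sum.cong) (simp_all add: M_inner wu)
      finally show ?thesis by simp
    qed
    have "(\<Sum>y\<in>Y. u y * (sg y * sg j * Q y j)) = (\<Sum>y\<in>Y. u y * ta)"
      by (intro sum.cong refl) (use ta j Y in auto)
    then have su: "(\<Sum>y\<in>Y. u y) = 0" using pairing[of j] ta0 by (simp flip: sum_distrib_right)
    \<comment> \<open>Pairing with a member \<open>k\<close> of the relation involves
      \<open>ta\<close> for all other members; the coefficient sum being zero isolates the square of
      \<open>k\<close>.\<close>
    have diag: "sg k * sg k * Q k k = ta" if k: "k \<in> Y" "w k \<noteq> 0" for k
    proof -
      have "(\<Sum>y\<in>Y. u y * (sg y * sg k * Q y k))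
          = u k * (sg k * sg k * Q k k) + (\<Sum>y\<in>Y - {k}. u y * (sg y * sg k * Q y k))"
        by (rule sum.remove) (use finY k in auto)
      also have "(\<Sum>y\<in>Y - {k}. u y * (sg y * sg k * Q y k)) = (\<Sum>y\<in>Y - {k}. u y * ta)"
        by (intro sum.cong refl) (use ta k Y in auto)
      also have "\<dots> = (\<Sum>y\<in>Y - {k}. u y) * ta" by (simp add: sum_distrib_right)
      also have "(\<Sum>y\<in>Y - {k}. u y) = - u k" using su sum.remove[OF finY k(1), of u] by simp
      finally have "u k * (sg k * sg k * Q k k - ta) = 0" using pairing[of k] by (simp add: right_diff_distrib)
      moreover have "u k \<noteq> 0" using wu k by auto
      ultimately show ?thesis by simp
    qed
    obtain k where k: "k \<in> Y" "w k \<noteq> 0" using w by blast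
    have "\<exists>i\<in>Y. i \<noteq> k \<and> w i \<noteq> 0"
    proof (rule ccontr)
      assume "\<not> ?thesis"
      then have "(\<Sum>y\<in>Y - {k}. w y *\<^sub>R M y) = 0" by (intro sum.neutral) auto
      then have "w k *\<^sub>R M k = 0" using w(1) sum.remove[OF finY k(1), of "\<lambda>y. w y *\<^sub>R M y"] by simp
      then show False using k M_ne[of k] Y by auto
    qed
    then obtain i where i: "i \<in> Y" "i \<noteq> k" "w i \<noteq> 0" by blast
    have X2: "i \<in> X" "k \<in> X" using i k Y by auto
    have "Q (sg i *\<^sub>R i - sg k *\<^sub>R k) (sg i *\<^sub>R i - sg k *\<^sub>R k)
        = sg i * sg i * Q i i - 2 * (sg i * sg k * Q i k) + sg k * sg k * Q k k"
      by (simp add: Q_simps Q_sym[of k i] algebra_simps)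
    also have "\<dots> = 0" using diag[OF i(1,3)] diag[OF k] ta[OF X2 i(2)] by simp
    finally have "M (sg i *\<^sub>R i - sg k *\<^sub>R k) = 0" by (rule M_eq_0_if_Q)
    then have "sg i *\<^sub>R M i + (- sg k) *\<^sub>R M k = 0"
      by (simp add: linear_diff[OF linear_M] linear_cmul[OF linear_M])
    from general2(1)[OF X2 i(2) this] nz[OF X2(1)] show ?thesis by simp
  qed
  then show "sg i = 0" using i by blast
  obtain j where "j \<in> X" "j \<noteq> i" using nb[OF i] by blast
  then have "mu i = 0" using mu[OF i] all0 by auto
  then show "m i = l \<bullet> i" by (simp add: mu_def)
qed

text \<open>The difference \<open>T\<close> of both sides vanishes as soon as its first argument is
  a light, by \<open>C_light\<close> with common \<open>l\<close>, or is \<open>p\<close>. Any d of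
  the lights together with \<open>p\<close> span the space.\<close>

theorem cubic_form_divisible:
  "\<exists>l. \<forall>u v w. C u v w = (l \<bullet> u) * Q v w + (l \<bullet> v) * Q u w + (l \<bullet> w) * Q u v"
proof -
  obtain l where l: "\<And>i. i \<in> X \<Longrightarrow> b i + sg i *\<^sub>R M i = l" using common_functional by blast
  define T where "T u v w = C u v w - ((l \<bullet> u) * Q v w + (l \<bullet> v) * Q u w + (l \<bullet> w) * Q u v)" for u v w
  have lX: "b i = l" "m i = l \<bullet> i" if "i \<in> X" for i
    using l[OF that] sg_zero[OF l that] by auto
  have TX: "T i v w = 0" if "i \<in> X" for i v w
    using C_light[OF that, of v w] lX[OF that] by (simp add: T_def mult.commute)
  obtain Y where Y: "Y \<subseteq> X" "card Y = d" using obtain_subset_with_card_n[of d X] cardX by auto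
  have finY: "finite Y" using Y finX finite_subset by blast
  then have "Y \<noteq> {}" using Y d3 by auto
  then obtain y where y: "y \<in> Y" by blast
  then have yX: "y \<in> X" using Y by blast
  \<comment> \<open>The value \<open>l \<bullet> p = -1\<close> is forced by \<open>C_p\<close>,
    read through the formula of one light; it is what makes \<open>T p\<close> vanish.\<close>
  have "Q y y * (l \<bullet> p) = - Q y y"
    using C_light[OF yX, of p y] C_sym[of y p y] C_p[of y y] lX[OF yX] Q_kernel[of y] Q_sym[of y p] by simp
  then have "Q y y * (l \<bullet> p + 1) = 0" by (simp add: algebra_simps)
  then have lp: "l \<bullet> p = -1" using Q_self_pos[OF yX] by simp
  have Tp: "T p v w = 0" for v w by (simp add: T_def C_p lp Q_kernel)
  have linT: "linear (\<lambda>u. T u v w)" for v w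
  proof -
    have "C u v w = C v u w" for u by (rule C_sym)
    then show ?thesis
      by (intro linearI) (simp_all add: T_def C_simps inner_simps Q_simps algebra_simps)
  qed
  have inj: "inj_on M Y"
  proof (rule inj_onI, rule ccontr)
    fix i j assume "i \<in> Y" "j \<in> Y" "M i = M j" "i \<noteq> j"
    then show False using general2(1)[of i j 1 "-1"] Y by auto
  qed
  have indep: "independent (M ` Y)"
  proof
    assume "dependent (M ` Y)"
    then obtain u v where "(\<Sum>v\<in>M ` Y. u v *\<^sub>R v) = 0" "v \<in> M ` Y" "u v \<noteq> 0"
      using dependent_finite[of "M ` Y"] finY by auto
    then show False using general[of Y "\<lambda>y. u (M y)"] Y by (auto simp: sum.reindex[OF inj])
  qed
  have span: "span (M ` Y) = {x. x \<bullet> p = 0}"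
  proof (rule subspace_dim_equal)
    show "subspace {x. x \<bullet> p = 0}" by (rule subspaceI) (auto simp: inner_simps)
    have "span (M ` Y) \<subseteq> {x. x \<bullet> p = 0}"
      by (rule span_minimal) (auto simp: M_orthogonal_p inner_simps intro: subspaceI)
    then show "span (M ` Y) \<subseteq> {x. x \<bullet> p = 0}" .
    show "dim {x. x \<bullet> p = 0} \<le> dim (span (M ` Y))"
      using dim_orthogonal_complement[OF p_nonzero] d_def Y
      by (simp only: dim_span dim_eq_card_independent[OF indep] card_image[OF inj])
  qed (rule subspace_span)
  have "T z v w = 0" for z v w
  proof -
    have "M z \<in> span (M ` Y)" by (simp add: span M_orthogonal_p)
    then obtain u where u: "M z = (\<Sum>y\<in>Y. u y *\<^sub>R M y)" using span_image_sum[OF finY] by blast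
    have "M (z - (\<Sum>y\<in>Y. u y *\<^sub>R y)) = 0"
      by (simp add: linear_diff[OF linear_M] linear_sum[OF linear_M] linear_cmul[OF linear_M] u)
    then have "z - (\<Sum>y\<in>Y. u y *\<^sub>R y) \<in> span {p}" by (simp add: M_eq_0_iff)
    then obtain c where "z - (\<Sum>y\<in>Y. u y *\<^sub>R y) = c *\<^sub>R p" by (auto simp: span_singleton)
    then have "z = (\<Sum>y\<in>Y. u y *\<^sub>R y) + c *\<^sub>R p" by (simp add: algebra_simps)
    then show ?thesis
      using Y TX by (auto simp: linear_add[OF linT] linear_sum[OF linT] linear_cmul[OF linT] Tp intro!: sum.neutral)
  qed
  then show ?thesis by (auto simp: T_def)
qed

end

section \<open>A Pick--Berwald theorem for gauges\<close>

text \<open>Independence as a family: unlike the set of the three vectors, it excludes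
  repetitions.\<close>

definition ind3 :: "'a::real_vector \<Rightarrow> 'a \<Rightarrow> 'a \<Rightarrow> bool" where
  "ind3 x y z \<longleftrightarrow> (\<forall>a b c. a *\<^sub>R x + b *\<^sub>R y + c *\<^sub>R z = 0 \<longrightarrow> a = 0 \<and> b = 0 \<and> c = 0)"

lemma ind3D: "ind3 x y z \<Longrightarrow> a *\<^sub>R x + b *\<^sub>R y + c *\<^sub>R z = 0 \<Longrightarrow> a = 0 \<and> b = 0 \<and> c = 0"
  unfolding ind3_def by blast

lemma ind3I:
  assumes "x \<noteq> 0" "y \<notin> span {x}" "z \<notin> span {x, y}"
  shows "ind3 x y z"
  unfolding ind3_def
proof (intro allI impI)
  fix a b c :: real assume e: "a *\<^sub>R x + b *\<^sub>R y + c *\<^sub>R z = 0"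
  have c: "c = 0"
  proof (rule ccontr)
    assume "c \<noteq> 0"
    have "c *\<^sub>R z = (- a) *\<^sub>R x + (- b) *\<^sub>R y" using e by (simp add: eq_neg_iff_add_eq_0 algebra_simps)
    also have "\<dots> \<in> span {x, y}" by (intro span_add span_mul span_base) auto
    finally show False using assms(3) \<open>c \<noteq> 0\<close> span_mul[of "c *\<^sub>R z" "{x,y}" "inverse c"] by simp
  qed
  have b: "b = 0"
  proof (rule ccontr)
    assume "b \<noteq> 0"
    have "b *\<^sub>R y = (- a) *\<^sub>R x" using e c by (simp add: eq_neg_iff_add_eq_0 algebra_simps)
    also have "\<dots> \<in> span {x}" by (intro span_mul span_base) auto
    finally show False using assms(2) \<open>b \<noteq> 0\<close> span_mul[of "b *\<^sub>R y" "{x}" "inverse b"] by simp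
  qed
  show "a = 0 \<and> b = 0 \<and> c = 0" using e b c assms(1) by simp
qed

lemma ind3_not_in_span: "ind3 x y z \<Longrightarrow> y \<notin> span {x}" "ind3 x y z \<Longrightarrow> x \<notin> span {y}"
proof -
  assume i: "ind3 x y z"
  show "y \<notin> span {x}"
  proof
    assume "y \<in> span {x}"
    then obtain k where "y = k *\<^sub>R x" by (auto simp: span_singleton)
    then show False using ind3D[OF i, of k "-1" 0] by simp
  qed
  show "x \<notin> span {y}"
  proof
    assume "x \<in> span {y}"
    then obtain k where "x = k *\<^sub>R y" by (auto simp: span_singleton)
    then show False using ind3D[OF i, of "-1" k 0] by simp
  qed
qed

lemma zero_derivative_const:
  fixes f :: "real \<Rightarrow> real"
  assumes "convex I" "\<And>s. s \<in> I \<Longrightarrow> (f has_real_derivative 0) (at s)" "s \<in> I" "t \<in> I"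
  shows "f s = f t"
proof -
  obtain c where "\<And>s. s \<in> I \<Longrightarrow> f s = c"
    using has_field_derivative_zero_constant[OF assms(1), of f] assms(2)
      has_field_derivative_at_within by blast
  then show ?thesis using assms by simp
qed

context gauge3
begin

definition good :: "'a \<Rightarrow> bool" where
  "good x \<longleftrightarrow> x \<noteq> 0 \<and> (\<forall>v. v \<notin> span {x} \<longrightarrow> D2 x v v > 0)"

text \<open>The Gram determinant of \<open>v\<close> and \<open>w\<close> in the Hessian at
  \<open>x\<close>; radial parts of \<open>v\<close> and \<open>w\<close> do not affect it.\<close>

definition det2 :: "'a \<Rightarrow> 'a \<Rightarrow> 'a \<Rightarrow> real" where
  "det2 x v w = D2 x v v * D2 x w w - (D2 x v w)\<^sup>2"

lemma D2_simps: assumes "x \<noteq> 0"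
  shows "D2 x (u + v) w = D2 x u w + D2 x v w" "D2 x u (v + w) = D2 x u v + D2 x u w"
    "D2 x (u - v) w = D2 x u w - D2 x v w" "D2 x u (v - w) = D2 x u v - D2 x u w"
    "D2 x (c *\<^sub>R u) w = c * D2 x u w" "D2 x u (c *\<^sub>R w) = c * D2 x u w"
    "D2 x x w = 0" "D2 x w x = 0"
  using bilinear_ladd[OF D2_bilinear[OF assms]] bilinear_radd[OF D2_bilinear[OF assms]]
    bilinear_lsub[OF D2_bilinear[OF assms]] bilinear_rsub[OF D2_bilinear[OF assms]]
    bilinear_lmul[OF D2_bilinear[OF assms]] bilinear_rmul[OF D2_bilinear[OF assms]]
    D2_self[OF assms] by auto

lemma D2_shift: assumes "y \<noteq> 0" shows "D2 y (y - z) (y - z) = D2 y z z"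
  by (simp add: D2_simps[OF assms])

lemma det2_pos:
  assumes "good x" "ind3 x v w" shows "det2 x v w > 0"
proof -
  have x: "x \<noteq> 0" using assms(1) by (simp add: good_def)
  have pos: "D2 x v v > 0" using assms(1) ind3_not_in_span[OF assms(2)] by (auto simp: good_def)
  define z where "z = D2 x v v *\<^sub>R w - D2 x v w *\<^sub>R v"
  have "z \<notin> span {x}"
  proof
    assume "z \<in> span {x}"
    then obtain k where "z = k *\<^sub>R x" by (auto simp: span_singleton)
    then have "(- k) *\<^sub>R x + (- D2 x v w) *\<^sub>R v + D2 x v v *\<^sub>R w = 0" by (simp add: z_def algebra_simps)
    from ind3D[OF assms(2) this] pos show False by simp
  qed
  then have "D2 x z z > 0" using assms(1) by (simp add: good_def)
  also have "D2 x z z = D2 x v v * det2 x v w"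
    by (simp add: z_def D2_simps[OF x] det2_def D2_sym[OF x, of w v] power2_eq_square algebra_simps)
  finally show ?thesis using pos by (simp add: zero_less_mult_iff)
qed

text \<open>The first equation is the second derivative of \<open>B(x,x) = 2 (be \<bullet> x) rho(x) + ga rho(x)\<^sup>2\<close>, divided
  by two. The second one says that \<open>h = be \<bullet> x + ga rho(x)\<close> satisfies \<open>dh = - h l\<close> when \<open>D3 = 3 l D2\<close>.\<close>

definition conic_at :: "('a \<Rightarrow> 'a \<Rightarrow> real) \<Rightarrow> 'a \<Rightarrow> real \<Rightarrow> 'a \<Rightarrow> bool" where
  "conic_at B be ga x \<longleftrightarrow> good x \<and> 0 < be \<bullet> x + ga * rho x \<and>
    (\<forall>v w. B v w = (be \<bullet> v) * D1 x w + (be \<bullet> w) * D1 x v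
        + (be \<bullet> x + ga * rho x) * D2 x v w + ga * D1 x v * D1 x w) \<and>
    (\<forall>v. (be \<bullet> x + ga * rho x) * D3 x v v v = - 3 * (be \<bullet> v + ga * D1 x v) * D2 x v v)"

end

text \<open>\<open>p\<close> is the base point at which a potential of \<open>l\<close> is
  normalised. \<open>U\<close> avoids its line so that \<open>p\<close> is never radial at a point
  of \<open>U\<close>, nor a point of \<open>U\<close> radial at \<open>p\<close>; convexity of
  \<open>W\<close> keeps all segments between \<open>p\<close> and \<open>U\<close>
  nondegenerate.\<close>

locale pick_berwald = gauge3 +
  fixes W U :: "'a set" and l :: "'a \<Rightarrow> 'a" and p :: 'a
  assumes dim4: "DIM('a) \<ge> 4"
    and W: "open W" "convex W" and good: "x \<in> W \<Longrightarrow> good x"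
    and sym: "x \<in> W \<Longrightarrow> D3 x u v w = (l x \<bullet> u) * D2 x v w + (l x \<bullet> v) * D2 x u w + (l x \<bullet> w) * D2 x u v"
    and pW: "p \<in> W" and U: "open U" "convex U" "U \<subseteq> W" "U \<inter> span {p} = {}"
begin

lemma W_ne: "x \<in> W \<Longrightarrow> x \<noteq> 0" using good by (auto simp: good_def)
lemma U_ne: "x \<in> U \<Longrightarrow> x \<noteq> 0" using W_ne U by auto

lemma segment_in:
  assumes "convex S" "x \<in> S" "x + v \<in> S" "0 \<le> s" "s \<le> (1::real)" shows "x + s *\<^sub>R v \<in> S"
proof -
  have "x + s *\<^sub>R v = (1 - s) *\<^sub>R x + s *\<^sub>R (x + v)" by (simp add: algebra_simps)
  then show ?thesis using convexD_alt[OF assms] by simp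
qed

text \<open>Along a line of direction \<open>v\<close> the logarithmic derivatives of \<open>D2 x v v\<close> and \<open>det2 x v w\<close> are
  \<open>3 l(v)\<close> and \<open>4 l(v)\<close>. Chaining this around a triangle shows that \<open>l\<close> is exact, without
  differentiating it.\<close>

lemma ratio:
  assumes x: "x \<in> W" "x + v \<in> W" and i: "ind3 x v w"
  shows "(D2 x v v)^4 * (det2 (x + v) v w)^3 = (D2 (x + v) v v)^4 * (det2 x v w)^3"
proof -
  define a where "a s = D2 (x + s *\<^sub>R v) v v" for s
  define D where "D s = det2 (x + s *\<^sub>R v) v w" for s
  have in_W: "x + s *\<^sub>R v \<in> W" if "s \<in> {0..1}" for s using segment_in[OF W(2) x] that by simp
  have pos: "D s > 0" if "s \<in> {0..1}" for s
    unfolding D_def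
  proof (rule det2_pos[OF good[OF in_W[OF that]]], unfold ind3_def, intro allI impI)
    fix a b c assume "a *\<^sub>R (x + s *\<^sub>R v) + b *\<^sub>R v + c *\<^sub>R w = 0"
    then have "a *\<^sub>R x + (a * s + b) *\<^sub>R v + c *\<^sub>R w = 0" by (simp add: algebra_simps)
    from ind3D[OF i this] show "a = 0 \<and> b = 0 \<and> c = 0" by auto
  qed
  have "((\<lambda>s. (a s)^4 / (D s)^3) has_real_derivative 0) (at s)" if s: "s \<in> {0..1}" for s
  proof -
    let ?y = "x + s *\<^sub>R v"
    define la where "la = l ?y \<bullet> v"
    have y: "?y \<in> W" "?y \<noteq> 0" using in_W[OF s] W_ne by auto
    have a': "(a has_real_derivative 3 * la * a s) (at s)"
      unfolding a_def by (rule DERIV_cong[OF line(3)[OF y(2)]]) (simp add: sym[OF y(1)] la_def)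
    have ww: "((\<lambda>s. D2 (x + s *\<^sub>R v) w w) has_real_derivative
        2 * (l ?y \<bullet> w) * D2 ?y v w + la * D2 ?y w w) (at s)"
      by (rule DERIV_cong[OF line(3)[OF y(2)]]) (simp add: sym[OF y(1)] la_def D2_sym[OF y(2), of w v])
    have vw: "((\<lambda>s. D2 (x + s *\<^sub>R v) v w) has_real_derivative
        2 * la * D2 ?y v w + (l ?y \<bullet> w) * D2 ?y v v) (at s)"
      by (rule DERIV_cong[OF line(3)[OF y(2)]]) (simp add: sym[OF y(1)] la_def D2_sym[OF y(2), of w v])
    have D': "(D has_real_derivative 4 * la * D s) (at s)"
      unfolding D_def det2_def power2_eq_square
      by (rule DERIV_cong[OF DERIV_diff[OF DERIV_mult[OF a'[unfolded a_def] ww] DERIV_mult[OF vw vw]]])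
        (simp add: algebra_simps)
    show ?thesis
      by (rule DERIV_cong[OF DERIV_divide[OF DERIV_power[OF a', of 4] DERIV_power[OF D', of 3]]])
        (use pos[OF s] in \<open>simp_all add: power_numeral_reduce\<close>)
  qed
  from zero_derivative_const[OF _ this, of "{0..1}" 0 1] 
  have "(a 0)^4 / (D 0)^3 = (a 1)^4 / (D 1)^3" by simp
  then show ?thesis using pos[of 0] pos[of 1] by (simp add: frac_eq_eq) (simp add: a_def D_def)
qed

abbreviation e :: "'a \<Rightarrow> 'a \<Rightarrow> real" where "e x y \<equiv> D2 x y y"

lemma e_pos: "x \<in> W \<Longrightarrow> y \<notin> span {x} \<Longrightarrow> e x y > 0"
  using good by (auto simp: good_def)

text \<open>Multiply \<open>ratio\<close> over the three sides: all determinants cancel, and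
  nonnegativity permits the fourth root. Since radial parts drop out, \<open>D2 p\<close> at
  \<open>x - p\<close> is \<open>e p x\<close>. In logarithms, \<open>l\<close> integrates to zero
  around the triangle.\<close>

lemma cocycle:
  assumes W3: "p \<in> W" "x \<in> W" "y \<in> W" and i: "ind3 p x y"
  shows "e p x * e x y * e y p = e x p * e y x * e p y"
proof -
  note ne = W_ne[OF W3(1)] W_ne[OF W3(2)] W_ne[OF W3(3)]
  define v w where "v = x - p" and "w = y - p"
  have i1: "ind3 p v w" and i2: "ind3 p w v" and i3: "ind3 x (w - v) v"
    unfolding ind3_def
  proof (safe)
    fix a b c assume "a *\<^sub>R p + b *\<^sub>R v + c *\<^sub>R w = 0"
    then have "(a - b - c) *\<^sub>R p + b *\<^sub>R x + c *\<^sub>R y = 0" by (simp add: v_def w_def algebra_simps)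
    from ind3D[OF i this] show "a = 0" "b = 0" "c = 0" by auto
  next
    fix a b c assume "a *\<^sub>R p + b *\<^sub>R w + c *\<^sub>R v = 0"
    then have "(a - b - c) *\<^sub>R p + c *\<^sub>R x + b *\<^sub>R y = 0" by (simp add: v_def w_def algebra_simps)
    from ind3D[OF i this] show "a = 0" "b = 0" "c = 0" by auto
  next
    fix a b c assume "a *\<^sub>R x + b *\<^sub>R (w - v) + c *\<^sub>R v = 0"
    then have "(- c) *\<^sub>R p + (a - b + c) *\<^sub>R x + b *\<^sub>R y = 0" by (simp add: v_def w_def algebra_simps)
    from ind3D[OF i this] show "a = 0" "b = 0" "c = 0" by auto
  qed
  have s: "p + v = x" "p + w = y" "x + (w - v) = y" by (auto simp: v_def w_def)
  have det: "det2 z w v = det2 z v w" "det2 z (w - v) v = det2 z v w" if "z \<noteq> 0" for z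
    by (simp_all add: det2_def D2_simps[OF that] D2_sym[OF that, of w v] power2_eq_square algebra_simps)
  have ev: "D2 p v v = e p x" "D2 x v v = e x p" "D2 p w w = e p y" "D2 y w w = e y p"
    "D2 x (w - v) (w - v) = e x y" "D2 y (w - v) (w - v) = e y x"
    unfolding v_def w_def by (simp_all add: D2_simps ne)
  have 1: "(e p x)^4 * (det2 x v w)^3 = (e x p)^4 * (det2 p v w)^3"
    using ratio[of p v w] W3 i1 by (simp add: s ev)
  have 2: "(e p y)^4 * (det2 y v w)^3 = (e y p)^4 * (det2 p v w)^3"
    using ratio[of p w v] W3 i2 by (simp add: s ev det ne)
  have 3: "(e x y)^4 * (det2 y v w)^3 = (e y x)^4 * (det2 x v w)^3"
    using ratio[of x "w - v" v] W3 i3 by (simp add: s ev det ne)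
  have pos: "det2 p v w > 0" by (rule det2_pos[OF good[OF W3(1)] i1])
  have pos2: "det2 x v w > 0" using det2_pos[OF good[OF W3(2)] i3] by (simp add: det ne)
  have pos3: "det2 y v w > 0"
  proof -
    have "ind3 y w v"
      unfolding ind3_def
    proof (intro allI impI)
      fix a b c assume "a *\<^sub>R y + b *\<^sub>R w + c *\<^sub>R v = 0"
      then have "(- b - c) *\<^sub>R p + c *\<^sub>R x + (a + b) *\<^sub>R y = 0" by (simp add: v_def w_def algebra_simps)
      from ind3D[OF i this] show "a = 0 \<and> b = 0 \<and> c = 0" by auto
    qed
    then show ?thesis using det2_pos[OF good[OF W3(3)]] det ne by metis
  qed
  let ?P = "(det2 p v w)^3 * (det2 x v w)^3 * (det2 y v w)^3"
  have "(e p x * e x y * e y p)^4 * ?P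
      = ((e p x)^4 * (det2 x v w)^3) * ((e x y)^4 * (det2 y v w)^3) * ((e y p)^4 * (det2 p v w)^3)"
    by (simp add: power_mult_distrib mult_ac)
  also have "\<dots> = ((e x p)^4 * (det2 p v w)^3) * ((e y x)^4 * (det2 x v w)^3) * ((e p y)^4 * (det2 y v w)^3)"
    using 1 2 3 by simp
  also have "\<dots> = (e x p * e y x * e p y)^4 * ?P" by (simp add: power_mult_distrib mult_ac)
  finally have "(e p x * e x y * e y p)^4 = (e x p * e y x * e p y)^4" using pos pos2 pos3 by simp
  moreover have "e p x * e x y * e y p \<ge> 0" "e x p * e y x * e p y \<ge> 0"
    using D2_nonneg ne by auto
  ultimately show ?thesis by (simp add: power_eq_iff_eq_base)
qed

section \<open>A potential for the linear form\<close>

lemma U_W: "x \<in> U \<Longrightarrow> x \<in> W" using U by blast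

lemma U_span: "x \<in> U \<Longrightarrow> x \<notin> span {p}" using U by blast

lemma p_span: assumes "x \<in> U" shows "p \<notin> span {x}"
proof
  assume "p \<in> span {x}"
  then obtain k where k: "p = k *\<^sub>R x" by (auto simp: span_singleton)
  then have "k \<noteq> 0" using W_ne[OF pW] by auto
  then have "x = (1 / k) *\<^sub>R p" using k by simp
  then show False using U_span[OF assms] by (metis span_base span_mul singletonI)
qed

lemma ind3_U: assumes "x \<in> U" "u \<notin> span {p, x}" shows "ind3 p x u"
  using ind3I[of p x u] assms U_span W_ne[OF pW] by blast

text \<open>Along the segment from \<open>p\<close> to \<open>x\<close> the value of
  \<open>D2\<close> on \<open>x - p\<close> grows from \<open>e p x\<close> to \<open>e x p\<close>,
  formally by the exponential of three times the integral of \<open>l\<close>. So \<open>H3\<close>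
  is the cube of the wanted \<open>h\<close>, written as a quotient that is differentiable without
  integrating \<open>l\<close>.\<close>

definition H3 :: "'a \<Rightarrow> real" where "H3 x = e p x / e x p"
definition h :: "'a \<Rightarrow> real" where "h x = root 3 (H3 x)"
definition A :: "'a \<Rightarrow> 'a \<Rightarrow> 'a \<Rightarrow> real" where "A x v w = H3 x * D2 x v w"

lemma H3_pos: "x \<in> U \<Longrightarrow> H3 x > 0"
  unfolding H3_def using e_pos[OF pW U_span] e_pos[OF U_W p_span] by simp

lemma h_pos: "x \<in> U \<Longrightarrow> h x > 0" and h_cube: "x \<in> U \<Longrightarrow> (h x)^3 = H3 x"
  unfolding h_def using H3_pos by (auto simp: real_root_pow_pos)

lemma A_sym:
  assumes "x \<in> U" "y \<in> U" "ind3 p x y"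
  shows "A x y y = A y x x"
  using cocycle[OF pW U_W[OF assms(1)] U_W[OF assms(2)] assms(3)]
    e_pos[OF U_W p_span, OF assms(1) assms(1)] e_pos[OF U_W p_span, OF assms(2) assms(2)]
  by (simp add: A_def H3_def field_simps)

lemma near_in_U:
  assumes "x \<in> U" obtains d where "d > 0" "\<And>t. \<bar>t\<bar> < d \<Longrightarrow> x + t *\<^sub>R v \<in> U"
proof -
  obtain r where r: "r > 0" "ball x r \<subseteq> U" using U(1) assms open_contains_ball by blast
  show ?thesis
  proof (rule that[of "r / (norm v + 1)"])
    show "r / (norm v + 1) > 0" using r by (simp add: add_nonneg_pos)
    fix t assume "\<bar>t\<bar> < r / (norm v + 1)"
    then have "\<bar>t\<bar> * (norm v + 1) < r" by (simp add: pos_less_divide_eq add_nonneg_pos)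
    then have "norm (t *\<^sub>R v) < r" using abs_ge_zero[of t] by (simp add: distrib_left del: abs_ge_zero)
    then show "x + t *\<^sub>R v \<in> U" using r(2) by (auto simp: dist_norm)
  qed
qed

text \<open>Existence of a derivative \<open>L\<close> is clear from the quotient. For
  \<open>u\<close> outside \<open>span {p, x}\<close>, \<open>A_sym\<close> for \<open>x\<close> and
  \<open>x + t u\<close> has a factor \<open>t^2\<close> on both sides once radial parts are
  dropped, so \<open>A\<close> on \<open>(u, u)\<close> is constant along the line; the product rule
  then determines \<open>L u\<close>.\<close>

lemma H3_has_derivative:
  assumes x: "x \<in> U" shows "(H3 has_derivative (\<lambda>u. - 3 * (l x \<bullet> u) * H3 x)) (at x)"
proof -
  note xne = U_ne[OF x] and xW = U_W[OF x]
  have num: "((\<lambda>y. e p y) has_derivative (\<lambda>u. D2 p x u + D2 p u x)) (at x)"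
    using bounded_bilinear.FDERIV[OF bilinear_conv_bounded_bilinear[THEN iffD1, OF D2_bilinear[OF W_ne[OF pW]]]
        has_derivative_ident has_derivative_ident] .
  have "e x p \<noteq> 0" using e_pos[OF xW p_span[OF x]] by simp
  from has_derivative_divide[OF num D3[OF xne, of p p] this]
  obtain L where L: "(H3 has_derivative L) (at x)" unfolding H3_def by blast
  have lin: "linear L" using L by (rule has_derivative_linear)
  have outside: "L u = - 3 * (l x \<bullet> u) * H3 x" if u: "u \<notin> span {p, x}" for u
  proof -
    have i: "ind3 p x u" by (rule ind3_U[OF x u])
    have uspan: "u \<notin> span {x}" using u span_mono[of "{x}" "{p,x}"] by blast
    obtain d where d: "d > 0" "\<And>t. \<bar>t\<bar> < d \<Longrightarrow> x + t *\<^sub>R u \<in> U" using near_in_U[OF x] by blast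
    define f where "f t = A (x + t *\<^sub>R u) u u" for t
    have const: "f t = A x u u" if t: "\<bar>t\<bar> < d" for t
    proof (cases "t = 0")
      case False
      let ?y = "x + t *\<^sub>R u"
      have yU: "?y \<in> U" using d t by blast
      note yne = U_ne[OF yU]
      have "ind3 p x ?y"
        unfolding ind3_def
      proof (intro allI impI)
        fix a b c assume "a *\<^sub>R p + b *\<^sub>R x + c *\<^sub>R ?y = 0"
        then have "a *\<^sub>R p + (b + c) *\<^sub>R x + (c * t) *\<^sub>R u = 0" by (simp add: algebra_simps)
        from ind3D[OF i this] False show "a = 0 \<and> b = 0 \<and> c = 0" by auto
      qed
      then have "A x ?y ?y = A ?y x x" by (rule A_sym[OF x yU])
      moreover have "D2 x ?y ?y = t\<^sup>2 * D2 x u u"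
        by (simp add: D2_simps[OF xne] power2_eq_square)
      moreover have "D2 ?y x x = t\<^sup>2 * D2 ?y u u"
      proof -
        have "D2 ?y x x = D2 ?y (t *\<^sub>R u) (t *\<^sub>R u)" using D2_shift[OF yne, of "t *\<^sub>R u"] by simp
        then show ?thesis by (simp add: D2_simps(5,6)[OF yne] power2_eq_square)
      qed
      ultimately show ?thesis using False by (simp add: A_def f_def)
    qed (simp add: f_def)
    have "(f has_real_derivative 0) (at 0)"
      by (rule has_field_derivative_transform_within_open[of "\<lambda>_. A x u u" _ _ "{-d<..<d}"])
        (use d const in auto)
    moreover have "(f has_real_derivative L u * D2 x u u + D3 x u u u * H3 x) (at 0)"
      unfolding f_def A_def
      using DERIV_mult[OF has_derivative_along_line[of H3 L x 0 u] line(3)[of x 0 u u u]] L xne by simp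
    ultimately have "L u * D2 x u u + D3 x u u u * H3 x = 0" using DERIV_unique by blast
    moreover have "D3 x u u u = 3 * (l x \<bullet> u) * D2 x u u" by (simp add: sym[OF xW])
    ultimately have "(L u + 3 * (l x \<bullet> u) * H3 x) * D2 x u u = 0" by (simp add: algebra_simps)
    moreover have "D2 x u u > 0" by (rule e_pos[OF xW uspan])
    ultimately show ?thesis by simp
  qed
  \<comment> \<open>\<open>L\<close> is known off a proper subspace; writing \<open>u\<close> as
    \<open>(u + u0) - u0\<close> reaches the rest.\<close>
  have "dim {p, x} < DIM('a)" using dim_le_card'[of "{p,x}"] dim4 card_insert_le_m1[of 2 "{x}" p] by simp
  then have "span {p, x} \<noteq> UNIV" by (metis dim_UNIV dim_span less_irrefl)
  then obtain u0 where u0: "u0 \<notin> span {p, x}" by blast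
  have "L u = - 3 * (l x \<bullet> u) * H3 x" for u
  proof (cases "u \<in> span {p, x}")
    case True
    then have "u + u0 \<notin> span {p, x}" using u0 by (simp add: span_add_eq)
    from outside[OF this] outside[OF u0] show ?thesis
      by (simp add: linear_add[OF lin] inner_simps algebra_simps)
  qed (rule outside)
  then have "L = (\<lambda>u. - 3 * (l x \<bullet> u) * H3 x)" by blast
  then show ?thesis using L by simp
qed

lemma h_has_derivative:
  assumes x: "x \<in> U" shows "(h has_derivative (\<lambda>u. - (l x \<bullet> u) * h x)) (at x)"
proof -
  have "(root 3 has_derivative (*) (inverse (3 * (h x)^2))) (at (H3 x))"
    using DERIV_real_root[of 3 "H3 x"] H3_pos[OF x]
    by (simp add: has_field_derivative_def h_def numeral_eq_Suc)
  from diff_chain_at[OF H3_has_derivative[OF x] this]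
  have "(h has_derivative (\<lambda>u. inverse (3 * (h x)^2) * (- 3 * (l x \<bullet> u) * H3 x))) (at x)"
    by (simp add: o_def h_def[abs_def])
  moreover have "(\<lambda>u. inverse (3 * (h x)^2) * (- 3 * (l x \<bullet> u) * H3 x)) = (\<lambda>u. - (l x \<bullet> u) * h x)"
    using h_pos[OF x] h_cube[OF x, symmetric] by (intro ext) (simp add: power2_eq_square power3_eq_cube field_simps)
  ultimately show ?thesis by (simp only:)
qed

section \<open>The potential along lines\<close>

lemma h_line:
  assumes "x + s *\<^sub>R v \<in> U"
  shows "((\<lambda>s. h (x + s *\<^sub>R v)) has_real_derivative - (l (x + s *\<^sub>R v) \<bullet> v) * h (x + s *\<^sub>R v)) (at s)"
    and "((\<lambda>s. H3 (x + s *\<^sub>R v)) has_real_derivative - 3 * (l (x + s *\<^sub>R v) \<bullet> v) * H3 (x + s *\<^sub>R v)) (at s)"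
  using has_derivative_along_line[OF h_has_derivative[OF assms]]
    has_derivative_along_line[OF H3_has_derivative[OF assms]] by simp_all

lemma A_line:
  assumes "x + s *\<^sub>R u \<in> U"
  shows "((\<lambda>s. A (x + s *\<^sub>R u) v w) has_real_derivative H3 (x + s *\<^sub>R u) *
     ((l (x + s *\<^sub>R u) \<bullet> v) * D2 (x + s *\<^sub>R u) u w + (l (x + s *\<^sub>R u) \<bullet> w) * D2 (x + s *\<^sub>R u) u v
       - 2 * (l (x + s *\<^sub>R u) \<bullet> u) * D2 (x + s *\<^sub>R u) v w)) (at s)"
  unfolding A_def
  by (rule DERIV_cong[OF DERIV_mult[OF h_line(2)[OF assms] line(3)[OF U_ne[OF assms]]]])
    (simp add: sym[OF U_W[OF assms]] D2_sym[OF U_ne[OF assms], of _ u] algebra_simps)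

text \<open>With all three directions equal to \<open>v\<close>, the terms of \<open>A_line\<close>
  have weights 1, 1 and -2 and cancel.\<close>

lemma A_const:
  assumes "x \<in> U" "x + s *\<^sub>R v \<in> U" shows "A (x + s *\<^sub>R v) v v = A x v v"
proof -
  have "A (x + 1 *\<^sub>R (s *\<^sub>R v)) v v = A (x + 0 *\<^sub>R (s *\<^sub>R v)) v v"
  proof (rule zero_derivative_const[of "{0..1}" "\<lambda>t. A (x + t *\<^sub>R (s *\<^sub>R v)) v v"])
    fix t :: real assume "t \<in> {0..1}"
    then have in_U: "x + t *\<^sub>R (s *\<^sub>R v) \<in> U" using segment_in[OF U(2) assms] by simp
    show "((\<lambda>t. A (x + t *\<^sub>R (s *\<^sub>R v)) v v) has_real_derivative 0) (at t)"
      by (rule DERIV_cong[OF A_line[OF in_U]])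
        (use D2_simps(5,6)[OF U_ne[OF in_U]] in simp)
  qed auto
  then show ?thesis by simp
qed

text \<open>The derivative of \<open>h\<close> at \<open>x\<close> in direction \<open>w\<close>, by
  \<open>h_has_derivative\<close>.\<close>

definition G :: "'a \<Rightarrow> 'a \<Rightarrow> real" where "G x w = - (l x \<bullet> w) * h x"

text \<open>The assumption on the dimension enters here: three vectors span a subspace with empty
  interior, which cannot contain the open set \<open>U\<close>.\<close>

lemma generic_direction:
  assumes "x \<in> U" obtains w where "w \<in> U" "w \<notin> span {p, x, v}"
proof -
  have "card {p, x, v} \<le> 3" by (simp add: card_insert_if)
  then have "dim {p, x, v} < DIM('a)" using dim_le_card'[of "{p,x,v}"] dim4 by simp
  then have "interior (span {p, x, v}) = {}" by (intro empty_interior_lowdim) (simp add: dim_span)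
  then have "\<not> U \<subseteq> span {p, x, v}" using assms U(1) interior_maximal by blast
  then show ?thesis using that by blast
qed

text \<open>On a line of direction \<open>v\<close>, \<open>A v v\<close> is constant, \<open>A v w\<close> is affine and \<open>A w w\<close> is quadratic in the
  parameter, the latter by the symmetry \<open>A_sym\<close>. Hence \<open>h\<^sup>2\<close>, a multiple of their Gram determinant, is
  quadratic. This makes \<open>h\<close> smooth along the line, with \<open>h''\<close> proportional to the second
  derivative of \<open>rho\<close>.\<close>

lemma G_difference:
  assumes x: "x \<in> U" "x + v \<in> U" and v: "v \<notin> span {x}"
  shows "\<exists>g. \<forall>w. G (x + v) w - G x w = g * (D1 (x + v) w - D1 x w)"
proof -
  define I where "I = {s. x + s *\<^sub>R v \<in> U}"
  have I01: "0 \<in> I" "1 \<in> I" using x by (auto simp: I_def)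
  have "open ((\<lambda>s. x + s *\<^sub>R v) -` U)"
    by (rule open_vimage[OF U(1)]) (intro continuous_intros)
  then have openI: "open I" by (simp add: I_def vimage_def)
  have convI: "convex I"
  proof (rule convexI)
    fix s t a b :: real assume st: "s \<in> I" "t \<in> I" "0 \<le> a" "0 \<le> b" "a + b = 1"
    have "a *\<^sub>R (x + s *\<^sub>R v) + b *\<^sub>R (x + t *\<^sub>R v) \<in> U"
      using st by (intro convexD[OF U(2)]) (auto simp: I_def)
    also have "a *\<^sub>R (x + s *\<^sub>R v) + b *\<^sub>R (x + t *\<^sub>R v) = (a + b) *\<^sub>R x + (a * s + b * t) *\<^sub>R v"
      by (simp add: algebra_simps)
    finally show "a *\<^sub>R s + b *\<^sub>R t \<in> I" using st by (simp add: I_def)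
  qed
  define z where "z s = x + s *\<^sub>R v" for s
  have zU: "z s \<in> U" if "s \<in> I" for s using that by (simp add: I_def z_def)
  have zne: "z s \<noteq> 0" if "s \<in> I" for s using U_ne[OF zU[OF that]] .
  define a where "a = A x v v"
  have a_pos: "a > 0" unfolding a_def A_def using H3_pos[OF x(1)] e_pos[OF U_W[OF x(1)] v] by simp
  have Avv: "A (z s) v v = a" if "s \<in> I" for s
    using A_const[OF x(1), of s v] zU[OF that] by (simp add: z_def a_def)
  define la where "la s = l (z s) \<bullet> v" for s
  \<comment> \<open>\<open>K w\<close> is the derivative of \<open>A\<close> on
    \<open>(v, v)\<close> transversally in direction \<open>w\<close>. As \<open>A\<close> on
    \<open>(v, v)\<close> is constant along all lines parallel to \<open>v\<close>, so is this
    derivative.\<close>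
  define K where "K w = H3 x * (2 * (l x \<bullet> v) * D2 x v w - 2 * (l x \<bullet> w) * D2 x v v)" for w
  have K: "H3 (z s) * (2 * la s * D2 (z s) v w - 2 * (l (z s) \<bullet> w) * D2 (z s) v v) = K w" if s: "s \<in> I" for s w
  proof -
    obtain d1 where d1: "d1 > 0" "\<And>t. \<bar>t\<bar> < d1 \<Longrightarrow> x + t *\<^sub>R w \<in> U" using near_in_U[OF x(1)] by blast
    obtain d2 where d2: "d2 > 0" "\<And>t. \<bar>t\<bar> < d2 \<Longrightarrow> z s + t *\<^sub>R w \<in> U" using near_in_U[OF zU[OF s]] by blast
    define d where "d = min d1 d2"
    have 1: "((\<lambda>t. A (x + t *\<^sub>R w) v v) has_real_derivative K w) (at 0)"
      by (rule DERIV_cong[OF A_line]) (use x in \<open>simp_all add: K_def D2_sym[OF U_ne[OF x(1)], of w v]\<close>)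
    have 2: "((\<lambda>t. A (z s + t *\<^sub>R w) v v) has_real_derivative
       H3 (z s) * (2 * la s * D2 (z s) v w - 2 * (l (z s) \<bullet> w) * D2 (z s) v v)) (at 0)"
      by (rule DERIV_cong[OF A_line]) (use zU[OF s] in \<open>simp_all add: la_def D2_sym[OF zne[OF s], of w v]\<close>)
    have d: "d > 0" using d1 d2 by (simp add: d_def)
    have "A (x + t *\<^sub>R w) v v = A (z s + t *\<^sub>R w) v v" if "t \<in> {-d<..<d}" for t
    proof -
      have e: "z s + t *\<^sub>R w = (x + t *\<^sub>R w) + s *\<^sub>R v" by (simp add: z_def)
      have "z s + t *\<^sub>R w \<in> U" "x + t *\<^sub>R w \<in> U" using d1(2)[of t] d2(2)[of t] that by (auto simp: d_def)
      then show ?thesis unfolding e by (intro A_const[symmetric])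
    qed
    then have "((\<lambda>t. A (z s + t *\<^sub>R w) v v) has_real_derivative K w) (at 0)"
      by (intro has_field_derivative_transform_within_open[OF 1, of "{-d<..<d}"])
        (use d in auto)
    then show ?thesis using 2 DERIV_unique by blast
  qed
  \<comment> \<open>In \<open>A_line\<close> the derivative of \<open>A\<close> on
    \<open>(v, w)\<close> along \<open>v\<close> is minus half of the expression in
    \<open>K\<close>; being constant, it makes \<open>A\<close> on \<open>(v, w)\<close>
    affine.\<close>
  have Avw': "((\<lambda>s. A (z s) v w) has_real_derivative - K w / 2) (at s)" if "s \<in> I" for s w
    unfolding z_def
    by (rule DERIV_cong[OF A_line])
      (use zU[OF that] K[OF that, of w] in \<open>simp_all add: z_def la_def algebra_simps\<close>)
  have Avw: "A (z s) v w = A x v w - K w / 2 * s" if "s \<in> I" for s w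
  proof -
    have "A (z s) v w + K w / 2 * s = A (z 0) v w + K w / 2 * 0"
      by (rule zero_derivative_const[OF convI _ that I01(1)], rule DERIV_cong[OF DERIV_add[OF Avw' DERIV_cmult[OF DERIV_ident]]])
        auto
    then show ?thesis by (simp add: z_def)
  qed
  define et where "et s = - la s * h (z s)" for s
  have h': "((\<lambda>s. h (z s)) has_real_derivative et s) (at s)" if "s \<in> I" for s
    unfolding z_def et_def la_def by (rule DERIV_cong[OF h_line(1)]) (use zU[OF that] in \<open>simp_all add: z_def\<close>)
  note hpos = h_pos[OF zU] and hcube = h_cube[OF zU]
  obtain w0 where w0: "w0 \<in> U" "w0 \<notin> span {p, x, v}" using generic_direction x(1) by blast
  have Aww: "A (z s) w0 w0 = A w0 (z s) (z s)" if s: "s \<in> I" for s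
  proof (rule A_sym[OF zU[OF s] w0(1)], rule ind3_U[OF zU[OF s]], rule notI)
    assume w: "w0 \<in> span {p, z s}"
    have "span {p, z s} \<subseteq> span {p, x, v}"
      by (rule span_minimal[OF _ subspace_span]) (auto simp: z_def intro: span_base span_add span_mul)
    then show False using w w0 by blast
  qed
  define De where "De s = A (z s) v v * A (z s) w0 w0 - (A (z s) v w0)^2" for s
  \<comment> \<open>\<open>c0\<close> is the value of \<open>h^4 * det2\<close>, constant because
    the logarithmic derivatives -4 l(v) and 4 l(v) cancel. The Gram determinant of \<open>A\<close>
    is \<open>h^6 * det2\<close>, that is \<open>c0 * h^2\<close>.\<close>
  define c0 where "c0 = (h x)^4 * det2 x v w0"
  have i0: "ind3 x v w0"
  proof (rule ind3I[OF U_ne[OF x(1)] v])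
    show "w0 \<notin> span {x, v}" using w0(2) span_mono[of "{x,v}" "{p,x,v}"] by blast
  qed
  have det': "((\<lambda>s. (h (z s))^4 * det2 (z s) v w0) has_real_derivative 0) (at s)" if s: "s \<in> I" for s
  proof -
    note y = zU[OF s] zne[OF s] U_W[OF zU[OF s]]
    have vv: "((\<lambda>s. D2 (z s) v v) has_real_derivative 3 * la s * D2 (z s) v v) (at s)"
      unfolding z_def
      by (rule DERIV_cong[OF line(3)]) (use y sym[OF y(3)] in \<open>simp_all add: z_def la_def\<close>)
    have ww: "((\<lambda>s. D2 (z s) w0 w0) has_real_derivative
        2 * (l (z s) \<bullet> w0) * D2 (z s) v w0 + la s * D2 (z s) w0 w0) (at s)"
      unfolding z_def
      by (rule DERIV_cong[OF line(3)]) (use y sym[OF y(3)] D2_sym[OF y(2), of w0 v] in \<open>simp_all add: z_def la_def\<close>)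
    have vw: "((\<lambda>s. D2 (z s) v w0) has_real_derivative
        2 * la s * D2 (z s) v w0 + (l (z s) \<bullet> w0) * D2 (z s) v v) (at s)"
      unfolding z_def
      by (rule DERIV_cong[OF line(3)]) (use y sym[OF y(3)] D2_sym[OF y(2), of w0 v] in \<open>simp_all add: z_def la_def\<close>)
    have D': "((\<lambda>s. det2 (z s) v w0) has_real_derivative 4 * la s * det2 (z s) v w0) (at s)"
      unfolding det2_def power2_eq_square
      by (rule DERIV_cong[OF DERIV_diff[OF DERIV_mult[OF vv ww] DERIV_mult[OF vw vw]]])
        (simp add: algebra_simps)
    show ?thesis
      by (rule DERIV_cong[OF DERIV_mult[OF DERIV_power[OF h'[OF s], of 4] D']])
        (simp add: et_def power_numeral_reduce algebra_simps)
  qed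
  have De_h: "De s = c0 * (h (z s))^2" if s: "s \<in> I" for s
  proof -
    have "(h (z s))^4 * det2 (z s) v w0 = (h (z 0))^4 * det2 (z 0) v w0"
      by (rule zero_derivative_const[OF convI det' s I01(1)])
    then have c: "(h (z s))^4 * det2 (z s) v w0 = c0" by (simp add: c0_def z_def)
    have "De s = (H3 (z s))^2 * det2 (z s) v w0"
      by (simp add: De_def A_def det2_def power2_eq_square algebra_simps)
    also have "(H3 (z s))^2 = (h (z s))^2 * (h (z s))^4"
      unfolding hcube[OF s, symmetric] by (simp flip: power_mult power_add)
    finally have "De s = (h (z s))^2 * ((h (z s))^4 * det2 (z s) v w0)" by (simp only: mult.assoc)
    then show ?thesis unfolding c by (simp only: mult.commute)
  qed
  have c0_pos: "c0 > 0"
    unfolding c0_def using h_pos[OF x(1)] det2_pos[OF good[OF U_W[OF x(1)]] i0] by simp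
  define k0 k1 k2 where "k0 = (a * A w0 x x - (A x v w0)^2) / c0"
    and "k1 = (2 * a * A w0 x v + A x v w0 * K w0) / c0"
    and "k2 = (a * A w0 v v - (K w0)^2 / 4) / c0"
  have hquad: "(h (z s))^2 = k0 + k1 * s + k2 * s^2" if s: "s \<in> I" for s
  proof -
    have "A w0 (z s) (z s) = A w0 x x + 2 * s * A w0 x v + s^2 * A w0 v v"
      by (simp add: A_def z_def D2_simps[OF U_ne[OF w0(1)]] D2_sym[OF U_ne[OF w0(1)], of v x]
          power2_eq_square algebra_simps)
    then have "De s = a * (A w0 x x + 2 * s * A w0 x v + s^2 * A w0 v v) - (A x v w0 - K w0 / 2 * s)^2"
      by (simp only: De_def Avv[OF s] Aww[OF s] Avw[OF s, of w0])
    also have "\<dots> = c0 * k0 + c0 * k1 * s + c0 * k2 * s^2"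
    proof -
      have "c0 * k0 = a * A w0 x x - (A x v w0)^2" "c0 * k1 = 2 * a * A w0 x v + A x v w0 * K w0"
        "c0 * k2 = a * A w0 v v - (K w0)^2 / 4"
        using c0_pos by (simp_all add: k0_def k1_def k2_def)
      then show ?thesis by (simp only:) (simp add: power2_eq_square field_simps)
    qed
    also have "\<dots> = c0 * (k0 + k1 * s + k2 * s^2)" by (simp add: algebra_simps)
    finally have "De s = c0 * (k0 + k1 * s + k2 * s^2)" .
    then show ?thesis using De_h[OF s] c0_pos by simp
  qed
  have et: "et s = (k1 + 2 * k2 * s) / (2 * h (z s))" if s: "s \<in> I" for s
  proof -
    have "((\<lambda>s. (h (z s))^2) has_real_derivative 2 * h (z s) * et s) (at s)"
      by (rule DERIV_cong[OF DERIV_power[OF h'[OF s], of 2]]) simp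
    moreover have "((\<lambda>s. (h (z s))^2) has_real_derivative k1 + 2 * k2 * s) (at s)"
    proof (rule has_field_derivative_transform_within_open[OF _ openI s])
      show "((\<lambda>s. k0 + k1 * s + k2 * s^2) has_real_derivative k1 + 2 * k2 * s) (at s)"
        by (auto intro!: derivative_eq_intros)
    qed (use hquad in simp)
    ultimately have "2 * h (z s) * et s = k1 + 2 * k2 * s" using DERIV_unique by blast
    then show ?thesis using hpos[OF s] by (simp add: field_simps)
  qed
  \<comment> \<open>If \<open>h^2\<close> is the quadratic polynomial with coefficients
    \<open>k0\<close>, \<open>k1\<close>, \<open>k2\<close>, then the second derivative of
    \<open>h\<close> is \<open>de / h^3\<close>.\<close>
  define de where "de = (4 * k0 * k2 - k1^2) / 4"
  have et': "(et has_real_derivative de / H3 (z s)) (at s)" if s: "s \<in> I" for s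
  proof (rule has_field_derivative_transform_within_open[OF _ openI s])
    have "((\<lambda>s. (k1 + 2 * k2 * s) / (2 * h (z s))) has_real_derivative
       (2 * k2 * (2 * h (z s)) - (k1 + 2 * k2 * s) * (2 * et s)) / (2 * h (z s) * (2 * h (z s)))) (at s)"
      using hpos[OF s] by (auto intro!: derivative_eq_intros h'[OF s])
    moreover have "(2 * k2 * (2 * h (z s)) - (k1 + 2 * k2 * s) * (2 * et s)) / (2 * h (z s) * (2 * h (z s)))
       = de / H3 (z s)"
    proof -
      have "(2 * k2 * (2 * h (z s)) - (k1 + 2 * k2 * s) * (2 * et s)) / (2 * h (z s) * (2 * h (z s)))
        = (4 * k2 * (h (z s))^2 - (k1 + 2 * k2 * s)^2) / (4 * (h (z s))^3)"
        unfolding et[OF s] using hpos[OF s] by (simp add: field_simps power2_eq_square power3_eq_cube)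
      also have "4 * k2 * (h (z s))^2 - (k1 + 2 * k2 * s)^2 = 4 * de"
        unfolding hquad[OF s] de_def by (simp add: power2_eq_square algebra_simps)
      finally show ?thesis using hcube[OF s] by simp
    qed
    ultimately show "((\<lambda>s. (k1 + 2 * k2 * s) / (2 * h (z s))) has_real_derivative de / H3 (z s)) (at s)"
      by simp
  qed (use et in simp)
  have G: "G (z s) w = (h (z s) * K w / 2 + et s * A (z s) v w) / a" if s: "s \<in> I" for s w
  proof -
    have "a * G (z s) w = h (z s) * (K w / 2 - la s * A (z s) v w)"
      unfolding K[OF s, of w, symmetric] Avv[OF s, symmetric] G_def A_def by (simp add: algebra_simps)
    then show ?thesis using a_pos by (simp add: et_def field_simps)
  qed
  \<comment> \<open>In the derivative of \<open>G\<close> the two terms with \<open>K w\<close>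
    cancel; what is left is a constant multiple of \<open>D2 (z s) v w\<close>, the derivative of
    \<open>D1 (z s) w\<close>.\<close>
  have "G (z 1) w - de / a * D1 (z 1) w = G (z 0) w - de / a * D1 (z 0) w" for w
  proof (rule zero_derivative_const[OF convI _ I01(2) I01(1)])
    fix s assume s: "s \<in> I"
    have d1: "((\<lambda>s. D1 (z s) w) has_real_derivative D2 (z s) v w) (at s)"
      unfolding z_def
      by (rule DERIV_cong[OF line(2)]) (use zne[OF s] D2_sym[OF zne[OF s]] in \<open>simp_all add: z_def\<close>)
    have "((\<lambda>s. (h (z s) * K w / 2 + et s * A (z s) v w) / a) has_real_derivative
       (et s * K w / 2 + (de / H3 (z s) * A (z s) v w + (- K w / 2) * et s)) / a) (at s)"
      by (intro DERIV_cdivide DERIV_add DERIV_mult h'[OF s] et'[OF s] Avw'[OF s] DERIV_cmult_right)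
    then have "((\<lambda>s. G (z s) w) has_real_derivative
       (et s * K w / 2 + (de / H3 (z s) * A (z s) v w + (- K w / 2) * et s)) / a) (at s)"
      by (rule has_field_derivative_transform_within_open[OF _ openI s]) (use G in simp)
    moreover have "(et s * K w / 2 + (de / H3 (z s) * A (z s) v w + (- K w / 2) * et s)) / a
       = de / a * D2 (z s) v w"
      using H3_pos[OF zU[OF s]] by (simp add: A_def)
    ultimately have "((\<lambda>s. G (z s) w) has_real_derivative de / a * D2 (z s) v w) (at s)" by simp
    then show "((\<lambda>s. G (z s) w - de / a * D1 (z s) w) has_real_derivative 0) (at s)"
      using DERIV_diff[OF _ DERIV_cmult[OF d1, of "de / a"]] by fastforce
  qed
  then have "G (x + v) w - de / a * D1 (x + v) w = G x w - de / a * D1 x w" for w by (simp add: z_def)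
  then have "G (x + v) w - G x w = de / a * (D1 (x + v) w - D1 x w)" for w
  proof -
    have "a1 - b1 = c1 - b2 \<Longrightarrow> a1 - c1 = b1 - b2" for a1 b1 c1 b2 :: real by simp
    from this[OF \<open>\<And>w. G (x + v) w - de / a * D1 (x + v) w = G x w - de / a * D1 x w\<close>[of w]]
    show ?thesis by (simp only: right_diff_distrib)
  qed
  then show ?thesis by blast
qed

lemma G_difference_points:
  assumes "x \<in> U" "y \<in> U" "y \<notin> span {x}"
  shows "\<exists>g. \<forall>w. G y w - G x w = g * (D1 y w - D1 x w)"
proof -
  have "y - x \<notin> span {x}" using assms(3) by (simp add: span_singleton_shift)
  then show ?thesis using G_difference[of x "y - x"] assms by simp
qed

text \<open>Two points of \<open>U\<close> on a line through the origin lie on the same ray, because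
  the convex set \<open>U\<close> omits the origin; \<open>D1\<close> is constant on rays.\<close>

lemma D1_parallel:
  assumes "x \<in> U" "y \<in> U" "y \<in> span {x}" shows "D1 y w = D1 x w"
proof -
  obtain k where k: "y = k *\<^sub>R x" using assms(3) by (auto simp: span_singleton)
  have "k > 0"
  proof (rule ccontr)
    assume "\<not> k > 0"
    define t where "t = 1 / (1 - k)"
    have t: "0 \<le> t" "t \<le> 1" "1 - t + t * k = 0" using \<open>\<not> k > 0\<close> by (auto simp: t_def field_simps)
    have "(1 - t) *\<^sub>R x + t *\<^sub>R y \<in> U" using convexD_alt[OF U(2) assms(1,2)] t by blast
    also have "(1 - t) *\<^sub>R x + t *\<^sub>R y = (1 - t + t * k) *\<^sub>R x" by (simp add: k algebra_simps)
    finally show False using t(3) U_ne by auto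
  qed
  then show ?thesis using D1_scale[OF U_ne[OF assms(1)]] k by simp
qed

lemma D1_increasing:
  assumes "x \<in> U" "x + v \<in> U" "v \<notin> span {x}" shows "D1 (x + v) v > D1 x v"
proof -
  have "D1 (x + 0 *\<^sub>R v) v < D1 (x + 1 *\<^sub>R v) v"
  proof (rule DERIV_pos_imp_increasing[of 0 1 "\<lambda>s. D1 (x + s *\<^sub>R v) v"])
    fix s :: real assume s: "0 \<le> s" "s \<le> 1"
    have y: "x + s *\<^sub>R v \<in> U" by (rule segment_in[OF U(2) assms(1,2) s])
    have "v \<notin> span {x + s *\<^sub>R v}"
    proof
      assume "v \<in> span {x + s *\<^sub>R v}"
      then obtain k where k: "v = k *\<^sub>R (x + s *\<^sub>R v)" by (auto simp: span_singleton)
      then have e: "(1 - k * s) *\<^sub>R v = k *\<^sub>R x" by (simp add: algebra_simps)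
      show False
      proof (cases "1 - k * s = 0")
        case True
        then have "k \<noteq> 0" by auto
        then show False using e True U_ne[OF assms(1)] by simp
      next
        case False
        have "(1 - k * s) *\<^sub>R v \<in> span {x}" unfolding e by (intro span_mul span_base) simp
        then show False using in_span_scale_iff[OF False] assms(3) by blast
      qed
    qed
    then show "\<exists>y. ((\<lambda>s. D1 (x + s *\<^sub>R v) v) has_real_derivative y) (at s) \<and> 0 < y"
      using line(2)[OF U_ne[OF y], of v] e_pos[OF U_W[OF y]] by blast
  qed simp
  then show ?thesis by simp
qed

text \<open>The factor of \<open>G_difference\<close> depends on the segment a priori; comparing the three sides of a
  triangle shows that it does not.\<close>

lemma G_affine:
  assumes x: "x \<in> U"
  shows "\<exists>g. \<forall>y\<in>U. y \<notin> span {x} \<longrightarrow> (\<forall>w. G y w - G x w = g * (D1 y w - D1 x w))"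
proof -
  have small: "\<exists>s. s \<noteq> 0 \<and> x + s *\<^sub>R w \<in> U" for w
  proof -
    obtain d where "d > 0" "\<And>t. \<bar>t\<bar> < d \<Longrightarrow> x + t *\<^sub>R w \<in> U" using near_in_U[OF x] by blast
    then show ?thesis by (intro exI[of _ "d / 2"]) auto
  qed
  have inc: "D1 (x + s *\<^sub>R w) w \<noteq> D1 x w" if "w \<notin> span {x}" "s \<noteq> 0" "x + s *\<^sub>R w \<in> U" for s w
  proof -
    have "s *\<^sub>R w \<notin> span {x}" using that by (simp add: in_span_scale_iff)
    then have "D1 (x + s *\<^sub>R w) (s *\<^sub>R w) \<noteq> D1 x (s *\<^sub>R w)"
      using D1_increasing[OF x that(3)] by simp
    then show ?thesis
      using linear_cmul[OF linear_D(1)[OF U_ne[OF x]]] linear_cmul[OF linear_D(1)[OF U_ne[OF that(3)]]] by simp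
  qed
  \<comment> \<open>Subtract the relations at \<open>x\<close> from the one between \<open>y\<close>
    and \<open>z\<close>. The direction \<open>w\<close> is blind to \<open>y\<close>, which
    identifies \<open>gz\<close> with the third factor \<open>g\<close>; testing on
    \<open>y - x\<close> then identifies \<open>gy\<close> with it.\<close>
  have same: "gy = gz"
    if y: "y \<in> U" "y \<notin> span {x}" "\<And>w. G y w - G x w = gy * (D1 y w - D1 x w)"
      and z: "z \<in> U" "z \<notin> span {x}" "\<And>w. G z w - G x w = gz * (D1 z w - D1 x w)"
      and w: "D1 y w = D1 x w" "D1 z w \<noteq> D1 x w"
    for y z gy gz w
  proof -
    have "z \<notin> span {y}" using D1_parallel[OF y(1) z(1), of w] w by auto
    then obtain g where g: "\<And>w. G z w - G y w = g * (D1 z w - D1 y w)"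
      using G_difference_points[OF y(1) z(1)] by blast
    have "gz * (D1 z w - D1 x w) = g * (D1 z w - D1 x w)"
      using g[of w] z(3)[of w] y(3)[of w] w(1) by simp
    then have gz: "gz = g" using w(2) by simp
    let ?v = "y - x"
    have "?v \<notin> span {x}" using y(2) by (simp add: span_singleton_shift)
    then have ne: "D1 y ?v - D1 x ?v \<noteq> 0" using D1_increasing[of x ?v] x y(1) by simp
    have "gy * (D1 y ?v - D1 x ?v) = g * (D1 y ?v - D1 x ?v)"
      using g[of ?v] z(3)[of ?v] y(3)[of ?v] gz by (simp add: algebra_simps)
    then show ?thesis using ne gz by simp
  qed
  have in_span: "x + s *\<^sub>R w \<notin> span {x}" if "w \<notin> span {x}" "s \<noteq> 0" for s w
    using that by (simp add: span_singleton_shift in_span_scale_iff)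
  obtain w1 where w1: "w1 \<in> U" "w1 \<notin> span {p, x, x}" using generic_direction[OF x] by blast
  have w1': "w1 \<notin> span {x}" using w1(2) span_mono[of "{x}" "{p,x,x}"] by blast
  obtain s1 where s1: "s1 \<noteq> 0" "x + s1 *\<^sub>R w1 \<in> U" using small by blast
  define y1 where "y1 = x + s1 *\<^sub>R w1"
  have y1: "y1 \<in> U" "y1 \<notin> span {x}" using s1 in_span[OF w1'] by (auto simp: y1_def)
  \<comment> \<open>A nonradial \<open>w2\<close> that does not distinguish \<open>y1\<close> from
    \<open>x\<close>. It does distinguish \<open>y2\<close>, chosen in direction \<open>w2\<close>,
    so any further point can be compared by \<open>same\<close> with \<open>y1\<close> or with
    \<open>y2\<close>.\<close>
  obtain w2 where w2: "w2 \<notin> span {x}" "D1 y1 w2 = D1 x w2"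
  proof -
    obtain w where w: "w \<in> U" "w \<notin> span {p, x, w1}" using generic_direction[OF x] by blast
    define f where "f v = D1 y1 v - D1 x v" for v
    have lf: "linear f" unfolding f_def using linear_D(1)[OF U_ne[OF y1(1)]] linear_D(1)[OF U_ne[OF x]]
      by (intro linear_compose_sub)
    have f1: "f w1 \<noteq> 0" using inc[OF w1' s1] by (simp add: f_def y1_def)
    define w2 where "w2 = w - (f w / f w1) *\<^sub>R w1"
    have "f w2 = 0" using f1 by (simp add: w2_def linear_diff[OF lf] linear_cmul[OF lf])
    moreover have "w2 \<notin> span {x}"
    proof
      assume "w2 \<in> span {x}"
      then have "w2 \<in> span {p, x, w1}" using span_mono[of "{x}" "{p,x,w1}"] by blast
      then have "w2 + (f w / f w1) *\<^sub>R w1 \<in> span {p, x, w1}" by (intro span_add span_mul) (auto intro: span_base)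
      then show False using w(2) by (simp add: w2_def)
    qed
    ultimately show ?thesis using that by (simp add: f_def)
  qed
  obtain s2 where s2: "s2 \<noteq> 0" "x + s2 *\<^sub>R w2 \<in> U" using small by blast
  define y2 where "y2 = x + s2 *\<^sub>R w2"
  have y2: "y2 \<in> U" "y2 \<notin> span {x}" using s2 in_span[OF w2(1)] by (auto simp: y2_def)
  have ne2: "D1 y2 w2 \<noteq> D1 x w2" using inc[OF w2(1) s2] by (simp add: y2_def)
  obtain g1 where g1: "\<And>w. G y1 w - G x w = g1 * (D1 y1 w - D1 x w)"
    using G_difference_points[OF x y1] by blast
  obtain g2 where g2: "\<And>w. G y2 w - G x w = g2 * (D1 y2 w - D1 x w)"
    using G_difference_points[OF x y2] by blast
  have g12: "g1 = g2" by (rule same[OF y1 g1 y2 g2 w2(2) ne2])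
  have "G y w - G x w = g1 * (D1 y w - D1 x w)" if y: "y \<in> U" "y \<notin> span {x}" for y w
  proof -
    obtain g where g: "\<And>w. G y w - G x w = g * (D1 y w - D1 x w)"
      using G_difference_points[OF x y] by blast
    have "g = g1"
    proof (cases "D1 y w2 = D1 x w2")
      case True
      show ?thesis using same[OF y g y2 g2 True ne2] g12 by simp
    next
      case False
      show ?thesis using same[OF y1 g1 y g w2(2) False] by simp
    qed
    then show ?thesis using g by simp
  qed
  then show ?thesis by blast
qed

lemma l_self: assumes "x \<in> U" shows "l x \<bullet> x = - 1"
proof -
  note xne = U_ne[OF assms] and xW = U_W[OF assms]
  have pos: "D2 x p p > 0" by (rule e_pos[OF xW p_span[OF assms]])
  have "- D2 x p p = (l x \<bullet> x) * D2 x p p"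
    using D3_self[OF xne, of p p] sym[OF xW, of p p x] D2_self[OF xne] by simp
  then have "(l x \<bullet> x + 1) * D2 x p p = 0" by (simp add: algebra_simps)
  then show ?thesis using pos by simp
qed

text \<open>By the Euler relations \<open>G y y = h y\<close> and \<open>D1 y y = rho y\<close>, so
  putting \<open>w = y\<close> in the affine relation between the gradients integrates it.\<close>

lemma h_affine:
  assumes x: "x \<in> U"
  obtains be ga where "\<And>y. y \<in> U \<Longrightarrow> h y = be \<bullet> y + ga * rho y"
proof -
  obtain g where g: "\<And>y w. y \<in> U \<Longrightarrow> y \<notin> span {x} \<Longrightarrow> G y w - G x w = g * (D1 y w - D1 x w)"
    using G_affine[OF x] by blast
  define be where "be = (\<Sum>b\<in>Basis. (G x b - g * D1 x b) *\<^sub>R b)"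
  have lin: "linear (\<lambda>w. G x w - g * D1 x w)"
    unfolding G_def using linear_D(1)[OF U_ne[OF x]]
    by (intro linearI) (simp_all add: inner_simps linear_add linear_cmul algebra_simps)
  have be: "be \<bullet> w = G x w - g * D1 x w" for w
    unfolding be_def by (rule linear_functional_inner[OF lin])
  have off: "h y = be \<bullet> y + g * rho y" if y: "y \<in> U" "y \<notin> span {x}" for y
    using g[OF y, of y] be[of y] l_self[OF y(1)] D1_self[OF U_ne[OF y(1)]]
    by (simp add: G_def[of y] algebra_simps)
  have "h y = be \<bullet> y + g * rho y" if y: "y \<in> U" for y
  proof (cases "y \<in> span {x}")
    case True
    \<comment> \<open>The line of \<open>x\<close> was excluded so far; its points are approached in
      direction \<open>p\<close>, which leaves that line.\<close>
    define f where "f s = h (y + s *\<^sub>R p) - be \<bullet> (y + s *\<^sub>R p) - g * rho (y + s *\<^sub>R p)" for s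
    obtain d where d: "d > 0" "\<And>t. \<bar>t\<bar> < d \<Longrightarrow> y + t *\<^sub>R p \<in> U" using near_in_U[OF y] by blast
    have "isCont f 0"
    proof -
      have "isCont (\<lambda>s. h (y + s *\<^sub>R p)) 0" "isCont (\<lambda>s. rho (y + s *\<^sub>R p)) 0"
        using DERIV_isCont[OF h_line(1)[of y 0 p]] DERIV_isCont[OF line(1)[of y 0 p]] y U_ne[OF y] by auto
      then show ?thesis unfolding f_def by (intro continuous_intros)
    qed
    then have lim: "(f \<longlongrightarrow> f 0) (at 0)" by (simp add: isCont_def)
    have "f s = 0" if s: "s \<noteq> 0" "\<bar>s\<bar> < d" for s
    proof -
      have "y + s *\<^sub>R p \<notin> span {x}"
      proof
        assume "y + s *\<^sub>R p \<in> span {x}"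
        then have "(y + s *\<^sub>R p) - y \<in> span {x}" using True by (intro span_diff)
        then show False using p_span[OF x] in_span_scale_iff[OF s(1), of p] by simp
      qed
      then show ?thesis using off[OF d(2)[OF s(2)]] by (simp add: f_def)
    qed
    then have "(f \<longlongrightarrow> 0) (at 0)"
      by (intro tendsto_eventually) (auto simp: eventually_at intro!: exI[of _ d] d(1))
    then have "f 0 = 0" using lim LIM_unique by blast
    then show ?thesis by (simp add: f_def)
  qed (rule off[OF y])
  then show ?thesis by (rule that)
qed

text \<open>\<open>Bf\<close> is half the second derivative of
  \<open>2 (be \<bullet> x) rho + ga rho^2\<close>. Its own derivative vanishes identically, because
  \<open>dH = - H l\<close> makes \<open>H D3\<close> cancel the products of first and second
  derivatives. So it is a constant bilinear form.\<close>

theorem local_conic: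
  assumes x: "x \<in> U"
  shows "\<exists>B be ga. \<forall>y\<in>U. conic_at B be ga y"
proof -
  obtain be ga where hy: "\<And>y. y \<in> U \<Longrightarrow> h y = be \<bullet> y + ga * rho y" using h_affine[OF x] by blast
  define H where "H y = be \<bullet> y + ga * rho y" for y
  have H': "(H has_derivative (\<lambda>v. be \<bullet> v + ga * D1 y v)) (at y)" if "y \<noteq> 0" for y
    unfolding H_def by (auto intro!: derivative_eq_intros D1[OF that])
  have Hl: "be \<bullet> v + ga * D1 y v = - (l y \<bullet> v) * H y" if y: "y \<in> U" for y v
  proof -
    have "(h has_derivative (\<lambda>v. be \<bullet> v + ga * D1 y v)) (at y)"
      by (rule has_derivative_transform_within_open[OF H'[OF U_ne[OF y]] U(1) y]) (simp add: H_def hy)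
    from fun_cong[OF has_derivative_unique[OF this h_has_derivative[OF y]], of v]
    show ?thesis by (simp add: H_def hy[OF y])
  qed
  define Bf where "Bf y v w = (be \<bullet> v) * D1 y w + (be \<bullet> w) * D1 y v + H y * D2 y v w + ga * D1 y v * D1 y w" for y v w
  have "Bf y v w = Bf x v w" if y: "y \<in> U" for y v w
  proof -
    have der: "((\<lambda>y. Bf y v w) has_derivative (\<lambda>u. 0)) (at z)" if z: "z \<in> U" for z
    proof -
      note zne = U_ne[OF z] and zW = U_W[OF z]
      have "((\<lambda>y. Bf y v w) has_derivative (\<lambda>u. (be \<bullet> v) * D2 z w u + (be \<bullet> w) * D2 z v u
          + (H z * D3 z v w u + (be \<bullet> u + ga * D1 z u) * D2 z v w)
          + ((ga * D1 z v) * D2 z w u + (ga * D2 z v u) * D1 z w))) (at z)"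
        unfolding Bf_def
        by (intro has_derivative_add has_derivative_mult has_derivative_mult_right H'[OF zne] D2[OF zne] D3[OF zne])
      moreover have "(be \<bullet> v) * D2 z w u + (be \<bullet> w) * D2 z v u
          + (H z * D3 z v w u + (be \<bullet> u + ga * D1 z u) * D2 z v w)
          + ((ga * D1 z v) * D2 z w u + (ga * D2 z v u) * D1 z w) = 0" for u
      proof -
        have "H z * D3 z v w u = - ((be \<bullet> v + ga * D1 z v) * D2 z w u + (be \<bullet> w + ga * D1 z w) * D2 z v u
            + (be \<bullet> u + ga * D1 z u) * D2 z v w)"
          unfolding Hl[OF z] sym[OF zW] by (simp add: algebra_simps)
        then show ?thesis by (simp add: algebra_simps)
      qed
      ultimately show ?thesis by simp
    qed
    have "\<exists>c. \<forall>z\<in>U. Bf z v w = c"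
      by (rule has_derivative_zero_constant[OF U(2)]) (rule has_derivative_at_withinI[OF der])
    then show ?thesis using x y by metis
  qed
  then have "conic_at (Bf x) be ga y" if y: "y \<in> U" for y
    unfolding conic_at_def
  proof (intro conjI allI)
    show "good y" using good U_W[OF y] .
    show "0 < be \<bullet> y + ga * rho y" using h_pos[OF y] hy[OF y] by simp
    show "Bf x v w = (be \<bullet> v) * D1 y w + (be \<bullet> w) * D1 y v
        + (be \<bullet> y + ga * rho y) * D2 y v w + ga * D1 y v * D1 y w" for v w
      using \<open>\<And>y v w. y \<in> U \<Longrightarrow> Bf y v w = Bf x v w\<close>[OF y, of v w] by (simp add: Bf_def H_def)
    show "(be \<bullet> y + ga * rho y) * D3 y v v v = - 3 * (be \<bullet> v + ga * D1 y v) * D2 y v v" for v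
      unfolding Hl[OF y] sym[OF U_W[OF y]] H_def by (simp add: algebra_simps)
  qed
  then show ?thesis by blast
qed

end

section \<open>From local to global quadrics\<close>

lemma orthonormal_family:
  fixes B :: "'a::euclidean_space \<Rightarrow> 'a \<Rightarrow> real"
  assumes B: "bilinear B" and sym: "\<And>v w. B v w = B w v" and pos: "\<And>v. v \<noteq> 0 \<Longrightarrow> B v v > 0"
    and S: "finite S" "card S \<le> DIM('a)"
  shows "\<exists>g. \<forall>b\<in>S. \<forall>b'\<in>S. B (g b) (g b') = (if b = b' then 1 else 0)"
  using S
proof (induction S rule: finite_induct)
  case (insert a S)
  then obtain g where g: "\<And>b b'. b \<in> S \<Longrightarrow> b' \<in> S \<Longrightarrow> B (g b) (g b') = (if b = b' then 1 else 0)" by auto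
  have lin: "linear (\<lambda>v. B v w)" for w using B by (simp add: bilinear_def)
  have "card (g ` S) < DIM('a)" using insert card_image_le[of S g] by simp
  then have "dim (g ` S) < DIM('a)" using dim_le_card'[of "g ` S"] insert by simp
  then have "span (g ` S) \<noteq> UNIV" by (metis dim_UNIV dim_span less_irrefl)
  then obtain z where z: "z \<notin> span (g ` S)" by blast
  define y where "y = z - (\<Sum>b\<in>S. B z (g b) *\<^sub>R g b)"
  have "y \<noteq> 0"
  proof
    assume "y = 0"
    then have "z = (\<Sum>b\<in>S. B z (g b) *\<^sub>R g b)" by (simp add: y_def)
    also have "\<dots> \<in> span (g ` S)" by (intro span_sum span_mul span_base) auto
    finally show False using z by blast
  qed
  have orth: "B y (g b) = 0" if b: "b \<in> S" for b
  proof -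
    have "B y (g b) = B z (g b) - (\<Sum>b'\<in>S. B z (g b') * B (g b') (g b))"
      by (simp add: y_def linear_diff[OF lin] linear_sum[OF lin] linear_cmul[OF lin])
    also have "(\<Sum>b'\<in>S. B z (g b') * B (g b') (g b)) = (\<Sum>b'\<in>S. if b' = b then B z (g b') else 0)"
      by (intro sum.cong) (auto simp: g b)
    finally show ?thesis using b insert by simp
  qed
  define n where "n = sqrt (B y y)"
  have n: "n > 0" "n * n = B y y" using pos[OF \<open>y \<noteq> 0\<close>] by (auto simp: n_def)
  define u where "u = (1 / n) *\<^sub>R y"
  have "B u u = 1"
    using n(1) by (simp add: u_def bilinear_lmul[OF B] bilinear_rmul[OF B] flip: n(2))
  moreover have "B u (g b) = 0" if "b \<in> S" for b using orth[OF that] by (simp add: u_def bilinear_lmul[OF B])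
  ultimately have "\<forall>b\<in>insert a S. \<forall>b'\<in>insert a S. B ((g(a := u)) b) ((g(a := u)) b') = (if b = b' then 1 else 0)"
    using insert.hyps(2) g sym by auto
  then show ?case by blast
qed auto

lemma positive_definite_isometry:
  fixes B :: "'a::euclidean_space \<Rightarrow> 'a \<Rightarrow> real"
  assumes B: "bilinear B" and sym: "\<And>v w. B v w = B w v" and pos: "\<And>v. v \<noteq> 0 \<Longrightarrow> B v v > 0"
  obtains f :: "'a \<Rightarrow> 'a" where "linear f" "bij f" "\<And>x y. B (f x) (f y) = x \<bullet> y"
proof -
  obtain g :: "'a \<Rightarrow> 'a" where g: "\<And>b b'. b \<in> Basis \<Longrightarrow> b' \<in> Basis \<Longrightarrow> B (g b) (g b') = (if b = b' then 1 else 0)"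
    using orthonormal_family[OF B sym pos, of "Basis :: 'a set"] by auto
  define f where "f x = (\<Sum>b\<in>Basis. (x \<bullet> b) *\<^sub>R g b)" for x
  have lin: "linear f" unfolding f_def
    by (intro linearI) (simp_all add: inner_simps scaleR_add_left sum.distrib scaleR_sum_right)
  have iso: "B (f x) (f y) = x \<bullet> y" for x y
  proof -
    have l: "linear (\<lambda>v. B v w)" and r: "linear (B w)" for w using B by (auto simp: bilinear_def)
    have 1: "B (f x) w = (\<Sum>b\<in>Basis. (x \<bullet> b) * B (g b) w)" for w
      by (simp add: f_def linear_sum[OF l] linear_cmul[OF l])
    have 2: "B w (f y) = (\<Sum>b\<in>Basis. (y \<bullet> b) * B w (g b))" for w
      by (simp add: f_def linear_sum[OF r] linear_cmul[OF r])
    have "B (f x) (f y) = (\<Sum>b\<in>Basis. \<Sum>b'\<in>Basis. (x \<bullet> b) * (y \<bullet> b') * B (g b) (g b'))"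
      unfolding 1[of "f y"] by (simp only: 2 sum_distrib_left mult.assoc)
    also have "\<dots> = (\<Sum>b\<in>Basis. \<Sum>b'\<in>Basis. if b' = b then (x \<bullet> b) * (y \<bullet> b') else 0)"
      by (intro sum.cong refl) (auto simp: g)
    also have "\<dots> = x \<bullet> y" by (simp add: euclidean_inner[of x y])
    finally show ?thesis .
  qed
  have "inj f" unfolding linear_injective_0[OF lin]
  proof (intro allI impI)
    fix x assume "f x = 0"
    then have "x \<bullet> x = B 0 0" using iso[of x x] by simp
    then show "x = 0" by (simp add: bilinear_lzero[OF B])
  qed
  then have "bij f" using linear_injective_imp_surjective[OF lin] by (simp add: bij_def)
  then show ?thesis using that lin iso by blast
qed

section \<open>Nondegenerate points\<close>

context gauge3
begin

lemma rho_0: "rho 0 = 0"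
  using rho_scale[of 2 0] by simp

lemma not_in_span:
  fixes x :: 'a
  assumes "DIM('a) \<ge> 2" obtains v where "v \<notin> span {x}"
proof -
  have "dim {x} \<le> 1" using dim_le_card'[of "{x}"] by simp
  then have "dim (span {x}) \<noteq> dim (UNIV :: 'a set)" using assms by (simp add: dim_UNIV)
  then have "span {x} \<noteq> UNIV" by metis
  then show ?thesis using that by blast
qed

lemma D2_eq_0: assumes x: "x \<noteq> 0" and v: "D2 x v v = 0" shows "D2 x v w = 0"
proof (rule ccontr)
  assume ne: "D2 x v w \<noteq> 0"
  \<comment> \<open>Nearly the minimiser of the form on \<open>v + t w\<close>; the 1 in the
    denominator covers the case that \<open>D2 x w w\<close> vanishes.\<close>
  define t where "t = - (D2 x v w) / (D2 x w w + 1)"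
  have p: "D2 x w w \<ge> 0" by (rule D2_nonneg[OF x])
  have "0 \<le> D2 x (v + t *\<^sub>R w) (v + t *\<^sub>R w)" by (rule D2_nonneg[OF x])
  also have "\<dots> = 2 * t * D2 x v w + t\<^sup>2 * D2 x w w"
    by (simp add: D2_simps[OF x] v D2_sym[OF x, of w v] power2_eq_square algebra_simps)
  also have "\<dots> = - t\<^sup>2 * (D2 x w w + 2)"
  proof -
    have eq: "D2 x v w = - t * (D2 x w w + 1)" using p by (simp add: t_def)
    show ?thesis unfolding eq by (simp add: power2_eq_square algebra_simps)
  qed
  finally have "t\<^sup>2 * (D2 x w w + 2) \<le> 0" by simp
  moreover have "t \<noteq> 0" using ne p by (simp add: t_def)
  ultimately show False using p by (simp add: mult_le_0_iff)
qed

text \<open>Reduces joint continuity in the point and the vectors to continuity of the finitely many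
  entries \<open>D2 x i j\<close>.\<close>

lemma D2_expand:
  assumes "x \<noteq> 0" shows "D2 x v w = (\<Sum>i\<in>Basis. \<Sum>j\<in>Basis. (v \<bullet> i) * (w \<bullet> j) * D2 x i j)"
proof -
  have l: "linear (\<lambda>v. D2 x v w)" and r: "linear (D2 x w)" for w
    using D2_bilinear[OF assms] by (auto simp: bilinear_def)
  have 1: "D2 x (\<Sum>i\<in>Basis. (v \<bullet> i) *\<^sub>R i) u = (\<Sum>i\<in>Basis. (v \<bullet> i) * D2 x i u)" for u
    by (simp only: linear_sum[OF l] linear_cmul[OF l] real_scaleR_def)
  have 2: "D2 x u (\<Sum>i\<in>Basis. (w \<bullet> i) *\<^sub>R i) = (\<Sum>i\<in>Basis. (w \<bullet> i) * D2 x u i)" for u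
    by (simp only: linear_sum[OF r] linear_cmul[OF r] real_scaleR_def)
  have "D2 x v w = (\<Sum>i\<in>Basis. (v \<bullet> i) * D2 x i w)"
    using 1[of w] by (simp only: euclidean_representation)
  moreover have "D2 x i w = (\<Sum>j\<in>Basis. (w \<bullet> j) * D2 x i j)" for i
    using 2[of i] by (simp only: euclidean_representation)
  ultimately show ?thesis by (simp only: sum_distrib_left mult.assoc)
qed

text \<open>Adding the square of \<open>x \<bullet> v\<close> repairs the radial kernel, so
  nondegeneracy becomes positivity on the compact unit sphere, without reference to
  \<open>span {x}\<close>.\<close>

lemma good_iff: "good x \<longleftrightarrow> x \<noteq> 0 \<and> (\<forall>v\<in>sphere 0 1. D2 x v v + (x \<bullet> v)\<^sup>2 > 0)"
proof safe
  fix v :: 'a assume g: "good x" and v: "v \<in> sphere 0 1"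
  have x: "x \<noteq> 0" using g by (simp add: good_def)
  show "D2 x v v + (x \<bullet> v)\<^sup>2 > 0"
  proof (cases "v \<in> span {x}")
    case True
    then obtain c where c: "v = c *\<^sub>R x" by (auto simp: span_singleton)
    then have "x \<bullet> v \<noteq> 0" using v x by auto
    then show ?thesis using D2_nonneg[OF x] by (simp add: add_nonneg_pos)
  next
    case False then show ?thesis using g by (simp add: good_def add_pos_nonneg)
  qed
next
  assume "good 0" then show False by (simp add: good_def)
next
  assume x: "x \<noteq> 0" and pos: "\<forall>v\<in>sphere 0 1. D2 x v v + (x \<bullet> v)\<^sup>2 > 0"
  show "good x" unfolding good_def
  proof (intro conjI allI impI x)
    fix v assume v: "v \<notin> span {x}"
    define w where "w = v - (x \<bullet> v / (x \<bullet> x)) *\<^sub>R x"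
    have "w \<noteq> 0" using v by (auto simp: w_def span_singleton)
    have "x \<bullet> w = 0" using x by (simp add: w_def inner_simps)
    have "D2 x v v = D2 x w w" by (simp add: w_def D2_simps[OF x])
    also have "\<dots> = (norm w)\<^sup>2 * D2 x (w /\<^sub>R norm w) (w /\<^sub>R norm w)"
      using \<open>w \<noteq> 0\<close> by (simp add: D2_simps[OF x] power2_eq_square field_simps)
    finally have "D2 x v v = (norm w)\<^sup>2 * D2 x (w /\<^sub>R norm w) (w /\<^sub>R norm w)" .
    moreover have "D2 x (w /\<^sub>R norm w) (w /\<^sub>R norm w) > 0"
      using pos[rule_format, of "w /\<^sub>R norm w"] \<open>w \<noteq> 0\<close> \<open>x \<bullet> w = 0\<close> by simp
    ultimately show "D2 x v v > 0" using \<open>w \<noteq> 0\<close> by simp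
  qed
qed

text \<open>Positivity on the compact set of pairs of a unit vector and \<open>x\<close> extends to
  neighbouring points by the tube lemma.\<close>

lemma open_good: "open (Collect good)"
proof -
  let ?f = "\<lambda>z. (\<Sum>i\<in>Basis. \<Sum>j\<in>Basis. (fst z \<bullet> i) * (fst z \<bullet> j) * D2 (snd z) i j) + (snd z \<bullet> fst z)\<^sup>2"
  let ?S = "sphere (0::'a) 1" and ?T = "- {0 :: 'a}"
  have c: "continuous_on ?T (\<lambda>x. D2 x i j)" for i j
    by (intro continuous_at_imp_continuous_on) (auto intro: has_derivative_continuous[OF D3])
  have "continuous_on (?S \<times> ?T) (\<lambda>z. D2 (snd z) i j)" for i j
    by (rule continuous_on_compose2[OF c]) (auto intro!: continuous_intros)
  then have "continuous_on (?S \<times> ?T) ?f" by (intro continuous_intros)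
  then have oW: "openin (top_of_set (?S \<times> ?T)) ((?S \<times> ?T) \<inter> ?f -` {0<..})"
    by (rule continuous_openin_preimage_gen) simp
  obtain b :: 'a where b: "b \<in> Basis" using nonempty_Basis by blast
  then have ne: "?S \<noteq> {}" by (metis (no_types) empty_iff mem_sphere_0 norm_Basis)
  have "\<exists>V. open V \<and> x \<in> V \<and> V \<subseteq> Collect good" if x: "good x" for x
  proof -
    have "(\<lambda>v. (v, x)) ` ?S \<subseteq> (?S \<times> ?T) \<inter> ?f -` {0<..}"
      using x[unfolded good_iff] by (auto simp flip: D2_expand)
    from tube_lemma[OF compact_sphere ne this oW]
    obtain V where V: "openin (top_of_set ?T) V" "x \<in> V" "?S \<times> V \<subseteq> (?S \<times> ?T) \<inter> ?f -` {0<..}" by blast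
    have "good y" if y: "y \<in> V" for y
      unfolding good_iff
    proof (intro conjI ballI)
      show yne: "y \<noteq> 0" using V(1) y openin_imp_subset by fastforce
      fix v :: 'a assume "v \<in> sphere 0 1"
      then have "(v, y) \<in> ?S \<times> V" using y by blast
      then have "?f (v, y) > 0" using V(3) by blast
      then show "D2 y v v + (y \<bullet> v)\<^sup>2 > 0" by (simp add: D2_expand[OF yne, of v v])
    qed
    moreover have "open V" using V(1) by (metis openin_open_eq open_delete open_UNIV Compl_eq_Diff_UNIV)
    ultimately show ?thesis using V(2) by blast
  qed
  then show ?thesis by (subst open_subopen) blast
qed

text \<open>A minimum of \<open>rho\<close> on the unit sphere is the direction of a point of the
  body farthest from the origin. There the body lies inside a touching ball and is at least as
  curved as it.\<close>

lemma exists_good: "\<exists>x. good x"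
proof -
  have "continuous_on (sphere 0 1) rho"
    by (intro continuous_at_imp_continuous_on) (auto intro: rho_continuous)
  moreover obtain b :: 'a where "b \<in> Basis" using nonempty_Basis by blast
  then have "sphere (0::'a) 1 \<noteq> {}" by (metis (no_types) empty_iff mem_sphere_0 norm_Basis)
  ultimately obtain p where p: "p \<in> sphere 0 1" "\<And>y. y \<in> sphere 0 1 \<Longrightarrow> rho p \<le> rho y"
    using continuous_attains_inf[OF compact_sphere] by metis
  have pne: "p \<noteq> 0" using p(1) by auto
  define m where "m = rho p"
  have m: "m > 0" using rho_pos[OF pne] by (simp add: m_def)
  have ge: "rho y \<ge> m * norm y" for y
  proof (cases "y = 0")
    case False
    have "rho (norm y *\<^sub>R (y /\<^sub>R norm y)) = norm y * rho (y /\<^sub>R norm y)" using False by (intro rho_scale) simp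
    then have "rho y = norm y * rho (y /\<^sub>R norm y)" using False by simp
    moreover have "m \<le> rho (y /\<^sub>R norm y)" unfolding m_def using False by (intro p(2)) simp
    ultimately show ?thesis using False by (simp add: mult.commute mult_left_mono)
  qed (simp add: rho_0)
  have tangent: "D2 p v v > 0" if v: "v \<noteq> 0" "D1 p v = 0" for v
  proof (rule ccontr)
    assume "\<not> ?thesis"
    then have D20: "D2 p v v = 0" using D2_nonneg[OF pne, of v] by simp
    have ne: "p + s *\<^sub>R v \<noteq> 0" for s
    proof
      assume "p + s *\<^sub>R v = 0"
      then have "p = (- s) *\<^sub>R v" by (simp add: eq_neg_iff_add_eq_0)
      then have "D1 p p = (- s) * D1 p v" using linear_cmul[OF linear_D(1)[OF pne], of "- s" v] by simp
      then show False using D1_self[OF pne] rho_pos[OF pne] v by simp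
    qed
    \<comment> \<open>\<open>f\<close> is nonnegative with a zero at 0. If \<open>D2 p v v\<close>
      vanished, its second derivative at 0 would be negative, since \<open>D1 p v\<close> vanishes
      as well.\<close>
    define f where "f s = (rho (p + s *\<^sub>R v))\<^sup>2 - m\<^sup>2 * ((p + s *\<^sub>R v) \<bullet> (p + s *\<^sub>R v))" for s
    define f' where "f' s = 2 * rho (p + s *\<^sub>R v) * D1 (p + s *\<^sub>R v) v - m\<^sup>2 * (2 * ((p + s *\<^sub>R v) \<bullet> v))" for s
    have f': "(f has_real_derivative f' s) (at s)" for s
      unfolding f_def f'_def using line(1)[OF ne[of s]]
      by (auto intro!: derivative_eq_intros simp: inner_simps inner_commute algebra_simps)
    have f_ge: "f s \<ge> 0" for s
    proof -
      have "(m * norm (p + s *\<^sub>R v))\<^sup>2 \<le> (rho (p + s *\<^sub>R v))\<^sup>2" using ge m by (intro power_mono) auto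
      then show ?thesis by (simp add: f_def power_mult_distrib power2_norm_eq_inner)
    qed
    have f0: "f 0 = 0" using p(1) by (simp add: f_def m_def flip: power2_norm_eq_inner)
    have "f' 0 = 0"
      by (rule DERIV_local_min[OF f'[of 0] zero_less_one]) (use f0 f_ge in auto)
    have f'': "(f' has_real_derivative - 2 * m\<^sup>2 * (v \<bullet> v)) (at 0)"
      unfolding f'_def
      using line(1)[OF ne[of 0]] line(2)[OF ne[of 0], of v] v D20
      by (auto intro!: derivative_eq_intros simp: inner_simps)
    have "- 2 * m\<^sup>2 * (v \<bullet> v) < 0" using m v by simp
    from DERIV_neg_dec_right[OF f'' this] obtain d where d: "d > 0" "\<And>s. 0 < s \<Longrightarrow> s < d \<Longrightarrow> f' s < f' 0" by auto
    obtain z where "0 < z" "z < d / 2" "f (d/2) - f 0 = (d / 2 - 0) * f' z"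
      using MVT2[of 0 "d/2" f f'] f' d(1) by auto
    moreover have "f' z < 0" using d(2)[of z] \<open>f' 0 = 0\<close> \<open>0 < z\<close> \<open>z < d / 2\<close> by simp
    moreover have "(d / 2 - 0) * f' z < 0" using \<open>f' z < 0\<close> d(1) by (simp add: mult_pos_neg)
    ultimately have "f (d / 2) < 0" using f0 by linarith
    then show False using f_ge[of "d/2"] by simp
  qed
  have "good p"
    unfolding good_def
  proof (intro conjI allI impI pne)
    fix v assume v: "v \<notin> span {p}"
    define w where "w = v - (D1 p v / rho p) *\<^sub>R p"
    have "w \<noteq> 0" using v by (auto simp: w_def span_singleton)
    moreover have "D1 p w = 0"
      using rho_pos[OF pne] D1_self[OF pne]
      by (simp add: w_def linear_diff[OF linear_D(1)[OF pne]] linear_cmul[OF linear_D(1)[OF pne]])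
    ultimately have "D2 p w w > 0" by (rule tangent)
    then show "D2 p v v > 0" by (simp add: w_def D2_simps[OF pne])
  qed
  then show ?thesis by blast
qed

text \<open>The assumptions say that \<open>(k, ka)\<close> lies in the kernel of the quadratic form
  \<open>B(x,x) - 2 (be \<bullet> x) s - ga s\<^sup>2\<close> in the variables \<open>(x, s)\<close>: the quadric is nondegenerate.\<close>

lemma conic_kernel:
  assumes c: "conic_at B be ga y"
    and k: "\<And>w. B k w = ka * (be \<bullet> w)" "be \<bullet> k + ga * ka = 0"
  shows "k = 0"
proof -
  define H where "H = be \<bullet> y + ga * rho y"
  have y: "y \<noteq> 0" "good y" and H: "H > 0"
    and B: "\<And>v w. B v w = (be \<bullet> v) * D1 y w + (be \<bullet> w) * D1 y v + H * D2 y v w + ga * D1 y v * D1 y w"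
    using c by (auto simp: conic_at_def good_def H_def)
  have eq: "H * D2 y k w + (D1 y k - ka) * (be \<bullet> w + ga * D1 y w) = 0" for w
  proof -
    have "be \<bullet> k = - ga * ka" using k(2) by simp
    then show ?thesis using k(1)[of w] unfolding B by (simp add: algebra_simps)
  qed
  have "D1 y k = ka" using eq[of y] H D2_self[OF y(1)] D1_self[OF y(1)] by (simp add: H_def)
  then have "D2 y k k = 0" using eq[of k] H by simp
  then have "k \<in> span {y}" using y(2) unfolding good_def by fastforce
  then obtain s where s: "k = s *\<^sub>R y" by (auto simp: span_singleton)
  then have "ka = s * rho y"
    using \<open>D1 y k = ka\<close> D1_self[OF y(1)] linear_cmul[OF linear_D(1)[OF y(1)]] by simp
  then have "s * H = 0" using k(2) s by (simp add: H_def algebra_simps)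
  then show ?thesis using H s by simp
qed

text \<open>Degeneracy at \<open>x\<close> would produce a kernel vector of the quadric:
  \<open>x\<close> itself if the factor \<open>H\<close> vanishes, a combination of \<open>x\<close>
  and a null direction \<open>w\<close> otherwise. \<open>conic_kernel\<close> at the nondegenerate
  point \<open>y\<close> excludes both.\<close>

lemma conic_limit:
  assumes x: "x \<noteq> 0" and c: "conic_at B be ga y" and H0: "0 \<le> be \<bullet> x + ga * rho x"
    and B: "\<And>v w. B v w = (be \<bullet> v) * D1 x w + (be \<bullet> w) * D1 x v
      + (be \<bullet> x + ga * rho x) * D2 x v w + ga * D1 x v * D1 x w"
  shows "good x"
proof -
  define H where "H = be \<bullet> x + ga * rho x"
  have Bx: "B x w = H * D1 x w + rho x * (be \<bullet> w)" for w
    unfolding B H_def by (simp add: D1_self[OF x] D2_self[OF x] algebra_simps)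
  have H: "H > 0"
  proof (rule ccontr)
    assume "\<not> H > 0"
    then have "H = 0" using H0 by (simp add: H_def)
    then have "x = 0" using conic_kernel[OF c, of x "rho x"] Bx by (simp add: H_def)
    then show False using x by simp
  qed
  show ?thesis unfolding good_def
  proof (intro conjI allI impI x, rule ccontr)
    fix v assume v: "v \<notin> span {x}" "\<not> D2 x v v > 0"
    define w where "w = v - (D1 x v / rho x) *\<^sub>R x"
    have w: "w \<notin> span {x}"
    proof
      assume "w \<in> span {x}"
      then have "w + (D1 x v / rho x) *\<^sub>R x \<in> span {x}" by (intro span_add span_mul) (auto intro: span_base)
      then show False using v by (simp add: w_def)
    qed
    have D1w: "D1 x w = 0"
      using rho_pos[OF x] D1_self[OF x]
      by (simp add: w_def linear_diff[OF linear_D(1)[OF x]] linear_cmul[OF linear_D(1)[OF x]])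
    have "D2 x w w = 0" using v(2) D2_nonneg[OF x, of v] by (simp add: w_def D2_simps[OF x])
    then have D2w: "D2 x w u = 0" for u using D2_eq_0[OF x] by blast
    have Bw: "B w u = (be \<bullet> w) * D1 x u" for u unfolding B by (simp add: D1w D2w)
    have bil: "B (a *\<^sub>R w - b *\<^sub>R x) u = a * B w u - b * B x u" for a b u
      unfolding B by (simp add: inner_simps linear_diff[OF linear_D(1)[OF x]] linear_cmul[OF linear_D(1)[OF x]]
          D2_simps[OF x] algebra_simps)
    \<comment> \<open>The combination in which the \<open>D1 x\<close> terms of \<open>Bw\<close>
      and \<open>Bx\<close> cancel and only a multiple of \<open>be\<close> remains.\<close>
    define k where "k = H *\<^sub>R w - (be \<bullet> w) *\<^sub>R x"
    have "k = 0"
    proof (rule conic_kernel[OF c])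
      show "B k u = (- (be \<bullet> w) * rho x) * (be \<bullet> u)" for u
        unfolding k_def bil Bw Bx by (simp add: algebra_simps)
      show "be \<bullet> k + ga * (- (be \<bullet> w) * rho x) = 0"
        by (simp add: k_def H_def inner_simps algebra_simps)
    qed
    then have "H *\<^sub>R w = (be \<bullet> w) *\<^sub>R x" by (simp add: k_def)
    then have "H *\<^sub>R w \<in> span {x}" by (simp add: span_mul span_base)
    then show False using in_span_scale_iff[of H w "{x}"] H w by simp
  qed
qed

section \<open>Uniqueness and continuation of the quadric\<close>

lemma conic_at_scale:
  assumes "c > 0" "conic_at (\<lambda>v w. c * B v w) (c *\<^sub>R be) (c * ga) x"
  shows "conic_at B be ga x"
proof -
  define H where "H = be \<bullet> x + ga * rho x"
  have "(c *\<^sub>R be) \<bullet> x + c * ga * rho x = c * H" by (simp add: H_def algebra_simps)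
  note c = assms(2)[unfolded conic_at_def this]
  have "0 < H" using c assms(1) by (simp add: zero_less_mult_iff)
  moreover have "B v w = (be \<bullet> v) * D1 x w + (be \<bullet> w) * D1 x v + H * D2 x v w + ga * D1 x v * D1 x w" for v w
  proof -
    have "c * B v w = c * ((be \<bullet> v) * D1 x w + (be \<bullet> w) * D1 x v + H * D2 x v w + ga * D1 x v * D1 x w)"
      using c by (simp add: algebra_simps)
    then show ?thesis using assms(1) by simp
  qed
  moreover have "H * D3 x v v v = - 3 * (be \<bullet> v + ga * D1 x v) * D2 x v v" for v
  proof -
    have "c * (H * D3 x v v v) = c * (- 3 * (be \<bullet> v + ga * D1 x v) * D2 x v v)"
      using c by (simp add: algebra_simps)
    then show ?thesis using assms(1) by simp
  qed
  ultimately show ?thesis using c unfolding conic_at_def H_def by blast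
qed

text \<open>The cubic equations give \<open>H\<close> and \<open>H'\<close> the same logarithmic
  derivative, so their quotient is constant. If \<open>ga'\<close> were not scaled accordingly,
  \<open>rho\<close> would be linear on the ball, against nondegeneracy.\<close>

lemma conic_unique:
  assumes dim: "DIM('a) \<ge> 2" and d: "d > 0"
    and c: "\<And>y. y \<in> ball z d \<Longrightarrow> conic_at B be ga y" "\<And>y. y \<in> ball z d \<Longrightarrow> conic_at B' be' ga' y"
  shows "\<exists>c>0. B' = (\<lambda>v w. c * B v w) \<and> be' = c *\<^sub>R be \<and> ga' = c * ga"
proof -
  define H where "H y = be \<bullet> y + ga * rho y" for y
  define H' where "H' y = be' \<bullet> y + ga' * rho y" for y
  have z: "z \<in> ball z d" using d by simp
  have ne: "y \<noteq> 0" if "y \<in> ball z d" for y using c(1)[OF that] by (auto simp: conic_at_def good_def)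
  have Hpos: "H y > 0" "H' y > 0" if "y \<in> ball z d" for y
    using c[OF that] by (auto simp: conic_at_def H_def H'_def)
  have cross: "(be' \<bullet> v + ga' * D1 y v) * H y = (be \<bullet> v + ga * D1 y v) * H' y" if y: "y \<in> ball z d" for y v
  proof (cases "v \<in> span {y}")
    case True
    then obtain s where s: "v = s *\<^sub>R y" by (auto simp: span_singleton)
    then have "D1 y v = s * rho y" using D1_self[OF ne[OF y]] linear_cmul[OF linear_D(1)[OF ne[OF y]]] by simp
    then show ?thesis by (simp add: s H_def H'_def algebra_simps)
  next
    case False
    have g: "good y" using c(1)[OF y] by (simp add: conic_at_def)
    then have pos: "D2 y v v > 0" using False by (simp add: good_def)
    have 1: "H y * D3 y v v v = - 3 * (be \<bullet> v + ga * D1 y v) * D2 y v v"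
      and 2: "H' y * D3 y v v v = - 3 * (be' \<bullet> v + ga' * D1 y v) * D2 y v v"
      using c[OF y] by (auto simp: conic_at_def H_def H'_def)
    have "((be' \<bullet> v + ga' * D1 y v) * H y) * (- 3 * D2 y v v) = H y * (H' y * D3 y v v v)" unfolding 2 by (simp only: mult_ac)
    also have "\<dots> = H' y * (H y * D3 y v v v)" by (simp only: mult_ac)
    also have "\<dots> = ((be \<bullet> v + ga * D1 y v) * H' y) * (- 3 * D2 y v v)" unfolding 1 by (simp only: mult_ac)
    finally show ?thesis using pos by simp
  qed
  have "\<exists>k. \<forall>y\<in>ball z d. H' y / H y = k"
  proof (rule has_derivative_zero_constant[OF convex_ball], rule has_derivative_at_withinI)
    fix y assume y: "y \<in> ball z d"
    have h: "(H has_derivative (\<lambda>v. be \<bullet> v + ga * D1 y v)) (at y)"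
      "(H' has_derivative (\<lambda>v. be' \<bullet> v + ga' * D1 y v)) (at y)"
      unfolding H_def H'_def by (auto intro!: derivative_eq_intros D1[OF ne[OF y]])
    have "((\<lambda>y. H' y / H y) has_derivative
       (\<lambda>v. ((be' \<bullet> v + ga' * D1 y v) * H y - H' y * (be \<bullet> v + ga * D1 y v)) / (H y * H y))) (at y)"
      by (rule has_derivative_divide'[OF h(2,1)]) (use Hpos[OF y] in simp)
    then show "((\<lambda>y. H' y / H y) has_derivative (\<lambda>v. 0)) (at y)"
      by (simp only: cross[OF y] mult.commute[of "H' y"] diff_self div_0)
  qed
  then obtain k where k': "\<And>y. y \<in> ball z d \<Longrightarrow> H' y / H y = k" by blast
  have k: "H' y = k * H y" if "y \<in> ball z d" for y using Hpos[OF that] by (simp flip: k'[OF that])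
  have kpos: "k > 0" using Hpos[OF z] k[OF z] by (simp add: zero_less_mult_iff)
  define nu where "nu = be' - k *\<^sub>R be"
  have nu: "nu \<bullet> y = (k * ga - ga') * rho y" if "y \<in> ball z d" for y
    using k[OF that] by (simp add: nu_def H_def H'_def inner_simps algebra_simps)
  have ga: "ga' = k * ga"
  proof (rule ccontr)
    assume "ga' \<noteq> k * ga"
    then have q: "k * ga - ga' \<noteq> 0" by simp
    define mu where "mu = (1 / (k * ga - ga')) *\<^sub>R nu"
    have rho: "mu \<bullet> y = rho y" if "y \<in> ball z d" for y using nu[OF that] q by (simp add: mu_def)
    have D1mu: "D1 y v = mu \<bullet> v" if y: "y \<in> ball z d" for y v
    proof -
      have "(rho has_derivative (\<lambda>v. mu \<bullet> v)) (at y)"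
        by (rule has_derivative_transform_within_open[of "\<lambda>y. mu \<bullet> y" _ _ _ "ball z d"])
          (auto intro!: derivative_eq_intros simp: y[simplified] rho)
      from has_derivative_unique[OF this D1[OF ne[OF y]]] show ?thesis by metis
    qed
    obtain v where v: "v \<notin> span {z}" using not_in_span[OF dim] by blast
    have "((\<lambda>y. D1 y v) has_derivative (\<lambda>_. 0)) (at z)"
      by (rule has_derivative_transform_within_open[of "\<lambda>y. mu \<bullet> v" _ _ _ "ball z d"])
        (auto simp: d D1mu)
    from has_derivative_unique[OF this D2[OF ne[OF z]]] have "D2 z v v = 0" by metis
    then show False using c(1)[OF z] v by (auto simp: conic_at_def good_def)
  qed
  have be: "be' = k *\<^sub>R be"
  proof (rule ccontr)
    assume "be' \<noteq> k *\<^sub>R be"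
    then have nz: "nu \<noteq> 0" by (simp add: nu_def)
    define y where "y = z + (d / 2 / norm nu) *\<^sub>R nu"
    have "y \<in> ball z d" using d nz by (simp add: y_def dist_norm)
    then have "nu \<bullet> y = 0" "nu \<bullet> z = 0" using nu[of y] nu[OF z] ga by auto
    then have "(d / 2 / norm nu) * (nu \<bullet> nu) = 0" by (simp add: y_def inner_simps)
    then show False using nz d by simp
  qed
  have "B' v w = k * B v w" for v w
    using c(1)[OF z] c(2)[OF z] unfolding conic_at_def ga be by (simp add: algebra_simps)
  then have "B' = (\<lambda>v w. k * B v w)" by blast
  then show ?thesis using kpos ga be by blast
qed

lemma local_conic_ball:
  assumes dim: "DIM('a) \<ge> 4"
    and sym: "\<And>x. good x \<Longrightarrow> \<exists>l. \<forall>u v w. D3 x u v w = (l \<bullet> u) * D2 x v w + (l \<bullet> v) * D2 x u w + (l \<bullet> w) * D2 x u v"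
    and x: "good x"
  shows "\<exists>d>0. \<exists>B be ga. \<forall>y\<in>ball x d. conic_at B be ga y"
proof -
  obtain r where r: "r > 0" "ball x r \<subseteq> Collect good"
    using open_good x open_contains_ball by (metis mem_Collect_eq)
  have xne: "x \<noteq> 0" using x by (simp add: good_def)
  obtain v where v: "v \<notin> span {x}" using not_in_span[of x] dim by auto
  have vne: "v \<noteq> 0" using v span_zero by blast
  \<comment> \<open>A base point close to \<open>x\<close> but off its line; then \<open>x\<close>
    is off the line of \<open>p\<close>, and so is a small ball around \<open>x\<close>.\<close>
  define p where "p = x + (r / 2 / norm v) *\<^sub>R v"
  have p: "p \<in> ball x r" using r vne by (simp add: p_def dist_norm)
  have pspan: "p \<notin> span {x}"
    using v r vne by (simp add: p_def span_singleton_shift in_span_scale_iff)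
  have "x \<notin> span {p}"
  proof
    assume "x \<in> span {p}"
    then obtain k where k: "x = k *\<^sub>R p" by (auto simp: span_singleton)
    then have "k \<noteq> 0" using xne by auto
    then have "k *\<^sub>R p \<in> span {x} \<longleftrightarrow> p \<in> span {x}" by (rule in_span_scale_iff)
    then show False using pspan k by (simp add: span_base)
  qed
  moreover have "open (ball x r \<inter> - span {p})" by (intro open_Int open_Compl closed_span open_ball)
  ultimately obtain d where d: "d > 0" "ball x d \<subseteq> ball x r \<inter> - span {p}"
    using r(1) open_contains_ball by (metis Compl_iff IntI centre_in_ball)
  obtain l where l: "\<And>y u v w. good y \<Longrightarrow>
      D3 y u v w = (l y \<bullet> u) * D2 y v w + (l y \<bullet> v) * D2 y u w + (l y \<bullet> w) * D2 y u v"
    using sym by metis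
  interpret pick_berwald rho D1 D2 D3 "ball x r" "ball x d" l p
  proof
    show "DIM('a) \<ge> 4" by fact
    show "good y" if "y \<in> ball x r" for y using that r by blast
    show "D3 y u v w = (l y \<bullet> u) * D2 y v w + (l y \<bullet> v) * D2 y u w + (l y \<bullet> w) * D2 y u v"
      if "y \<in> ball x r" for y u v w using that r by (intro l) blast
  qed (use p d in auto)
  show ?thesis using local_conic[of x] d(1) by auto
qed

text \<open>The interior \<open>Z\<close> of the set where one fixed quadric holds is closed in the
  punctured space: a limit point is nondegenerate by \<open>conic_limit\<close>, has a local quadric
  of its own, and this agrees with the fixed one up to a factor where they overlap. The punctured
  space is connected.\<close>

lemma conic_everywhere:
  assumes dim: "DIM('a) \<ge> 4"
    and sym: "\<And>x. good x \<Longrightarrow> \<exists>l. \<forall>u v w. D3 x u v w = (l \<bullet> u) * D2 x v w + (l \<bullet> v) * D2 x u w + (l \<bullet> w) * D2 x u v"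
  shows "\<exists>B be ga. \<forall>x. x \<noteq> 0 \<longrightarrow> conic_at B be ga x"
proof -
  obtain x0 where x0: "good x0" using exists_good by blast
  obtain d0 B be ga where d0: "d0 > 0" "\<And>y. y \<in> ball x0 d0 \<Longrightarrow> conic_at B be ga y"
    using local_conic_ball[OF dim sym x0] by blast
  define Z where "Z = interior {y. conic_at B be ga y}"
  have Zc: "conic_at B be ga y" if "y \<in> Z" for y using that interior_subset by (auto simp: Z_def)
  have "x0 \<in> Z" unfolding Z_def mem_interior using d0 by blast
  have limit: "x \<in> Z" if x: "x \<noteq> 0" "x \<in> closure Z" for x
  proof -
    obtain s where s: "\<And>n. s n \<in> Z" "s \<longlonglongrightarrow> x" using x(2) unfolding closure_sequential by blast
    note cs = Zc[OF s(1)]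
    have tr: "(\<lambda>n. rho (s n)) \<longlonglongrightarrow> rho x"
      by (rule isCont_tendsto_compose[OF rho_continuous[OF x(1)] s(2)])
    have t1: "(\<lambda>n. D1 (s n) v) \<longlonglongrightarrow> D1 x v" for v
      by (rule isCont_tendsto_compose[OF has_derivative_continuous[OF D2[OF x(1)]] s(2)])
    have t2: "(\<lambda>n. D2 (s n) v w) \<longlonglongrightarrow> D2 x v w" for v w
      by (rule isCont_tendsto_compose[OF has_derivative_continuous[OF D3[OF x(1)]] s(2)])
    have tH: "(\<lambda>n. be \<bullet> s n + ga * rho (s n)) \<longlonglongrightarrow> be \<bullet> x + ga * rho x"
      by (intro tendsto_intros s(2) tr)
    \<comment> \<open>Positivity passes to the limit only as a weak inequality, the form in which
      \<open>conic_limit\<close> takes it.\<close>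
    have H0: "0 \<le> be \<bullet> x + ga * rho x"
      by (rule LIMSEQ_le_const[OF tH]) (use cs in \<open>auto simp: conic_at_def intro!: less_imp_le\<close>)
    have Bx: "B v w = (be \<bullet> v) * D1 x w + (be \<bullet> w) * D1 x v
      + (be \<bullet> x + ga * rho x) * D2 x v w + ga * D1 x v * D1 x w" for v w
    proof -
      have "(\<lambda>n. (be \<bullet> v) * D1 (s n) w + (be \<bullet> w) * D1 (s n) v
          + (be \<bullet> s n + ga * rho (s n)) * D2 (s n) v w + ga * D1 (s n) v * D1 (s n) w)
          \<longlonglongrightarrow> (be \<bullet> v) * D1 x w + (be \<bullet> w) * D1 x v
          + (be \<bullet> x + ga * rho x) * D2 x v w + ga * D1 x v * D1 x w"
        by (intro tendsto_intros t1 t2 tH)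
      moreover have "(be \<bullet> v) * D1 (s n) w + (be \<bullet> w) * D1 (s n) v
          + (be \<bullet> s n + ga * rho (s n)) * D2 (s n) v w + ga * D1 (s n) v * D1 (s n) w = B v w" for n
        using cs[of n] by (simp add: conic_at_def)
      ultimately show ?thesis by (simp add: LIMSEQ_const_iff)
    qed
    have g: "good x" by (rule conic_limit[OF x(1) cs[of 0] H0 Bx])
    obtain d B' be' ga' where d: "d > 0" "\<And>y. y \<in> ball x d \<Longrightarrow> conic_at B' be' ga' y"
      using local_conic_ball[OF dim sym g] by blast
    obtain y where y: "y \<in> Z" "y \<in> ball x d"
      using x(2) d(1) by (metis closure_approachable dist_commute mem_ball)
    have "open (Z \<inter> ball x d)" by (simp add: Z_def open_Int)
    then obtain e where e: "e > 0" "ball y e \<subseteq> Z \<inter> ball x d"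
      using y open_contains_ball by (metis IntI)
    obtain c where c: "c > 0" "B' = (\<lambda>v w. c * B v w)" "be' = c *\<^sub>R be" "ga' = c * ga"
    proof -
      have "conic_at B be ga y'" "conic_at B' be' ga' y'" if "y' \<in> ball y e" for y'
        using that e(2) Zc d(2) by blast+
      from conic_unique[OF _ e(1) this] show ?thesis using dim that by auto
    qed
    have "conic_at B be ga y" if "y \<in> ball x d" for y
      using conic_at_scale[OF c(1)] d(2)[OF that] unfolding c(2-4) by blast
    then show ?thesis unfolding Z_def mem_interior using d(1) by blast
  qed
  have "connected (- {0 :: 'a})" by (rule connected_punctured_universe) (use dim in simp)
  moreover have "- {0} \<subseteq> Z \<union> - closure Z" using limit by blast
  moreover have "Z \<inter> - closure Z \<inter> - {0} = {}" using closure_subset by blast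
  ultimately have "Z \<inter> - {0} = {} \<or> - closure Z \<inter> - {0} = {}"
    by (intro connectedD) (auto simp: Z_def)
  moreover have "x0 \<in> Z \<inter> - {0}" using \<open>x0 \<in> Z\<close> x0 by (simp add: good_def)
  ultimately have "- {0} \<subseteq> closure Z" by blast
  then have "x \<in> Z" if "x \<noteq> 0" for x using limit that by blast
  then show ?thesis using Zc by blast
qed

text \<open>Validity in all directions makes \<open>B\<close> positive definite: \<open>B\<close>
  does not change under a sign of the vector, and for one of the two signs
  \<open>be \<bullet> x\<close> is nonnegative. Completing the square then exhibits the
  ellipsoid.\<close>

lemma conic_everywhere_ellipsoid:
  assumes dim: "DIM('a) \<ge> 2" and c: "\<And>x. x \<noteq> 0 \<Longrightarrow> conic_at B be ga x"
  shows "\<exists>(f :: 'a \<Rightarrow> 'a) c. linear f \<and> bij f \<and> {x. rho x \<le> 1} = (\<lambda>x. c + f x) ` cball 0 1"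
proof -
  have H: "be \<bullet> x + ga * rho x > 0" if "x \<noteq> 0" for x using c[OF that] by (simp add: conic_at_def)
  have Bxx: "B x x = 2 * (be \<bullet> x) * rho x + ga * (rho x)\<^sup>2" if "x \<noteq> 0" for x
    using c[OF that] D1_self[OF that] D2_self[OF that]
    by (simp add: conic_at_def power2_eq_square algebra_simps)
  obtain b :: 'a where b: "b \<in> Basis" using nonempty_Basis by blast
  then have bne: "b \<noteq> 0" using nonzero_Basis by blast
  have bilB: "bilinear B" and symB: "B v w = B w v" for v w
  proof -
    have e: "B v w = (be \<bullet> v) * D1 b w + (be \<bullet> w) * D1 b v
        + (be \<bullet> b + ga * rho b) * D2 b v w + ga * D1 b v * D1 b w" for v w
      using c[OF bne] by (simp add: conic_at_def)
    show "B v w = B w v" for v w unfolding e by (simp add: D2_sym[OF bne, of w v])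
    show "bilinear B" unfolding bilinear_def
      by (intro conjI allI linearI; unfold e)
        (simp_all add: inner_simps D2_simps[OF bne] linear_add[OF linear_D(1)[OF bne]]
          linear_cmul[OF linear_D(1)[OF bne]] algebra_simps)
  qed
  \<comment> \<open>On a nonzero vector orthogonal to \<open>be\<close>, which exists in dimension
    at least two, the positive factor is just \<open>ga * rho\<close>.\<close>
  have ga: "ga > 0"
  proof -
    obtain v where v: "v \<notin> span {be}" using not_in_span[OF dim] by blast
    define w where "w = v - (be \<bullet> v / (be \<bullet> be)) *\<^sub>R be"
    have "w \<noteq> 0" using v by (auto simp: w_def span_singleton)
    moreover have "be \<bullet> w = 0" by (cases "be = 0") (auto simp: w_def inner_simps)
    ultimately have "ga * rho w > 0" using H[of w] by simp
    then show ?thesis using rho_pos[OF \<open>w \<noteq> 0\<close>] by (simp add: zero_less_mult_iff)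
  qed
  have posB: "B x x > 0" if x: "x \<noteq> 0" for x
  proof -
    have half: "B y y > 0" if "y \<noteq> 0" "be \<bullet> y \<ge> 0" for y
      unfolding Bxx[OF that(1)] using ga rho_pos[OF that(1)] that(2) by (intro add_nonneg_pos) auto
    have "B (- x) (- x) = B x x" using bilinear_lneg[OF bilB] bilinear_rneg[OF bilB] by simp
    then show ?thesis using half[of x] half[of "- x"] x by (cases "be \<bullet> x \<ge> 0") auto
  qed
  obtain f :: "'a \<Rightarrow> 'a" where f: "linear f" "bij f" "\<And>x y. B (f x) (f y) = x \<bullet> y"
    using positive_definite_isometry[OF bilB symB posB] by blast
  \<comment> \<open>The centre: the vector representing \<open>be\<close> with respect to
    \<open>B\<close>.\<close>
  define c0 where "c0 = f (\<Sum>b\<in>Basis. (be \<bullet> f b) *\<^sub>R b)"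
  have c0: "B c0 w = be \<bullet> w" for w
  proof -
    obtain y where y: "w = f y" using f(2) by (metis bij_pointE)
    have "linear (\<lambda>z. be \<bullet> f z)" using f(1)
      by (intro linearI) (simp_all add: linear_add linear_cmul inner_simps)
    then have "(\<Sum>b\<in>Basis. (be \<bullet> f b) *\<^sub>R b) \<bullet> y = be \<bullet> f y" by (rule linear_functional_inner)
    then show ?thesis by (simp add: c0_def y f(3))
  qed
  define R where "R = sqrt (ga + B c0 c0)"
  have "B c0 c0 \<ge> 0" using posB[of c0] by (cases "c0 = 0") (auto simp: bilinear_lzero[OF bilB])
  then have R: "R > 0" "R\<^sup>2 = ga + B c0 c0" using ga by (auto simp: R_def)
  have quad: "rho x \<le> 1 \<longleftrightarrow> B (x - c0) (x - c0) \<le> R\<^sup>2" for x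
  proof -
    have "B (x - c0) (x - c0) = B x x - 2 * (be \<bullet> x) + B c0 c0"
      by (simp add: bilinear_lsub[OF bilB] bilinear_rsub[OF bilB] symB[of x c0] c0)
    then have e: "B (x - c0) (x - c0) \<le> R\<^sup>2 \<longleftrightarrow> B x x \<le> ga + 2 * (be \<bullet> x)" using R by auto
    show ?thesis
    proof (cases "x = 0")
      case True
      then show ?thesis using e ga by (simp add: rho_0 bilinear_lzero[OF bilB])
    next
      case False
      define q where "q = be \<bullet> x"
      have Hx: "q + ga * rho x > 0" and rx: "rho x > 0" using H[OF False] rho_pos[OF False] by (auto simp: q_def)
      have "B x x \<le> ga + 2 * q \<longleftrightarrow> 2 * q * rho x + ga * (rho x)\<^sup>2 \<le> ga + 2 * q"
        by (simp add: Bxx[OF False] q_def)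
      \<comment> \<open>The second factor is positive in either case: for
        \<open>rho x \<le> 1\<close> because of \<open>Hx\<close>, for larger values because
        \<open>B x x\<close> is positive. So the first factor decides.\<close>
      also have "\<dots> \<longleftrightarrow> (rho x - 1) * (ga * (rho x + 1) + 2 * q) \<le> 0"
        by (simp add: power2_eq_square algebra_simps)
      also have "\<dots> \<longleftrightarrow> rho x \<le> 1"
      proof
        assume r: "rho x \<le> 1"
        then have "ga * rho x \<le> ga * 1" using ga by (intro mult_left_mono) auto
        then have "ga * (rho x + 1) + 2 * q \<ge> 0" using Hx by (simp add: algebra_simps)
        then show "(rho x - 1) * (ga * (rho x + 1) + 2 * q) \<le> 0" using r by (simp add: mult_nonpos_nonneg)
      next
        assume l: "(rho x - 1) * (ga * (rho x + 1) + 2 * q) \<le> 0"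
        show "rho x \<le> 1"
        proof (rule ccontr)
          assume "\<not> rho x \<le> 1"
          then have "ga * (rho x + 1) + 2 * q \<le> 0" using l by (simp add: mult_le_0_iff)
          moreover have "B x x > 0" by (rule posB[OF False])
          then have "rho x * (2 * q + ga * rho x) > 0"
            unfolding Bxx[OF False] by (simp add: q_def power2_eq_square algebra_simps)
          then have "2 * q + ga * rho x > 0" using rx by (simp add: zero_less_mult_iff)
          ultimately show False using ga by (simp add: algebra_simps)
        qed
      qed
      finally show ?thesis using e by (simp add: q_def)
    qed
  qed
  define g where "g x = R *\<^sub>R f x" for x
  have g: "linear g" unfolding g_def using f(1) by (rule linear_compose_scale_right)
  have "bij g"
  proof -
    have "bij (\<lambda>x::'a. R *\<^sub>R x)" using R(1) by (intro o_bij[of "\<lambda>x. (1/R) *\<^sub>R x"]) auto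
    from bij_comp[OF f(2) this] show ?thesis by (simp add: g_def[abs_def] o_def)
  qed
  have "{x. rho x \<le> 1} = (\<lambda>x. c0 + g x) ` cball 0 1"
  proof -
    have gg: "B (g y) (g y) = R\<^sup>2 * (norm y)\<^sup>2" for y
      by (simp add: g_def bilinear_lmul[OF bilB] bilinear_rmul[OF bilB] f(3) power2_eq_square flip: power2_norm_eq_inner)
    have iff: "rho (c0 + g y) \<le> 1 \<longleftrightarrow> y \<in> cball 0 1" for y
    proof -
      have "rho (c0 + g y) \<le> 1 \<longleftrightarrow> R\<^sup>2 * (norm y)\<^sup>2 \<le> R\<^sup>2 * 1" unfolding quad by (simp add: gg)
      also have "\<dots> \<longleftrightarrow> (norm y)\<^sup>2 \<le> 1\<^sup>2" using R(1) by simp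
      also have "\<dots> \<longleftrightarrow> y \<in> cball 0 1" by (subst power2_le_iff_abs_le) auto
      finally show ?thesis .
    qed
    have "x \<in> (\<lambda>x. c0 + g x) ` cball 0 1" if "rho x \<le> 1" for x
    proof -
      obtain y where "x - c0 = g y" using \<open>bij g\<close> by (metis bij_pointE)
      then have "x = c0 + g y" by (simp add: algebra_simps)
      then show ?thesis using iff that by blast
    qed
    then show ?thesis using iff by auto
  qed
  then show ?thesis using g \<open>bij g\<close> by blast
qed

end

section \<open>Flat shadow boundaries\<close>

lemma second_order_expansion:
  fixes f f' :: "real \<Rightarrow> real"
  assumes d: "d > 0" "\<And>t. \<bar>t\<bar> < d \<Longrightarrow> (f has_real_derivative f' t) (at t)"
    and k: "(f' has_real_derivative k) (at 0)" and "e > 0"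
  shows "\<exists>r>0. \<forall>t. 0 < t \<and> t < r \<longrightarrow> \<bar>f t - f 0 - f' 0 * t - k / 2 * t\<^sup>2\<bar> \<le> e * t\<^sup>2"
proof -
  have "(f' has_derivative (\<lambda>h. k * h)) (at 0)"
    using k by (simp add: has_field_derivative_def)
  then obtain r0 where r0: "r0 > 0" "\<And>s. \<bar>s\<bar> < r0 \<Longrightarrow> \<bar>f' s - f' 0 - k * s\<bar> \<le> e * \<bar>s\<bar>"
    unfolding has_derivative_at_alt using \<open>e > 0\<close> by (metis diff_zero real_norm_def)
  show ?thesis
  proof (intro exI[of _ "min d r0"] conjI allI impI)
    fix t assume t: "0 < t \<and> t < min d r0"
    define g where "g s = f s - f 0 - f' 0 * s - k / 2 * s\<^sup>2" for s
    have "(g has_real_derivative f' s - f' 0 - k * s) (at s)" if "0 \<le> s" "s \<le> t" for s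
      unfolding g_def using that t by (auto intro!: derivative_eq_intros d(2))
    then obtain s where s: "0 < s" "s < t" "g t - g 0 = (t - 0) * (f' s - f' 0 - k * s)"
      using MVT2[of 0 t g "\<lambda>s. f' s - f' 0 - k * s"] t by blast
    then have "\<bar>g t\<bar> = t * \<bar>f' s - f' 0 - k * s\<bar>" using t by (simp add: g_def abs_mult)
    also have "\<dots> \<le> t * (e * t)"
    proof (rule mult_left_mono)
      have "\<bar>f' s - f' 0 - k * s\<bar> \<le> e * \<bar>s\<bar>" using r0(2)[of s] s t by simp
      also have "\<dots> \<le> e * t" using s \<open>e > 0\<close> by simp
      finally show "\<bar>f' s - f' 0 - k * s\<bar> \<le> e * t" .
    qed (use t in simp)
    finally show "\<bar>f t - f 0 - f' 0 * t - k / 2 * t\<^sup>2\<bar> \<le> e * t\<^sup>2"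
      by (simp add: g_def power2_eq_square mult_ac)
  qed (use d r0 in simp)
qed

text \<open>The derivative along the curve is \<open>F' v + 2 t c F' q\<close> at the moving point;
  its derivative at 0 needs the second derivative of \<open>F\<close> only at
  \<open>p\<close>.\<close>

lemma expansion_along_parabola:
  fixes F :: "'a::real_normed_vector \<Rightarrow> real"
  assumes S: "open S" "p \<in> S" and F: "\<And>y. y \<in> S \<Longrightarrow> (F has_derivative F' y) (at y)"
    and v: "((\<lambda>y. F' y v) has_derivative Fv) (at p)" and q: "((\<lambda>y. F' y q) has_derivative Fq) (at p)"
    and "e > 0"
  shows "\<exists>r>0. \<forall>t. 0 < t \<and> t < r \<longrightarrow>
    \<bar>F (p + t *\<^sub>R v + (t\<^sup>2 * c) *\<^sub>R q) - F p - F' p v * t - (Fv v / 2 + c * F' p q) * t\<^sup>2\<bar> \<le> e * t\<^sup>2"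
proof -
  define x where "x t = p + t *\<^sub>R v + (t\<^sup>2 * c) *\<^sub>R q" for t :: real
  have x': "(x has_derivative (\<lambda>h. h *\<^sub>R (v + (2 * t * c) *\<^sub>R q))) (at t)" for t
    unfolding x_def by (auto intro!: derivative_eq_intros simp: algebra_simps)
  have "isCont x 0" using has_derivative_continuous[OF x'] by simp
  then have "\<forall>\<^sub>F t in at 0. x t \<in> S"
    using S by (intro topological_tendstoD[of x p]) (auto simp: isCont_def x_def)
  then obtain d where d: "d > 0" "\<And>t. t \<noteq> 0 \<Longrightarrow> \<bar>t\<bar> < d \<Longrightarrow> x t \<in> S"
    unfolding eventually_at by (auto simp: dist_real_def)
  have xS: "x t \<in> S" if "\<bar>t\<bar> < d" for t using d(2)[of t] that S by (cases "t = 0") (auto simp: x_def)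
  define f' where "f' t = F' (x t) v + 2 * t * c * F' (x t) q" for t
  have "((\<lambda>t. F (x t)) has_real_derivative f' t) (at t)" if t: "\<bar>t\<bar> < d" for t
  proof -
    note FF = F[OF xS[OF t]]
    have lin: "linear (F' (x t))" using FF by (rule has_derivative_linear)
    from diff_chain_at[OF x' FF]
    have "((\<lambda>t. F (x t)) has_derivative (\<lambda>h. F' (x t) (h *\<^sub>R (v + (2 * t * c) *\<^sub>R q)))) (at t)" by (simp add: o_def)
    moreover have "(\<lambda>h. F' (x t) (h *\<^sub>R (v + (2 * t * c) *\<^sub>R q))) = (*) (f' t)"
      by (intro ext) (simp add: linear_cmul[OF lin] linear_add[OF lin] f'_def mult.commute)
    ultimately show ?thesis by (simp add: has_field_derivative_def)
  qed
  moreover have "(f' has_real_derivative Fv v + 2 * c * F' p q) (at 0)"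
  proof -
    have x0: "x 0 = p" by (simp add: x_def)
    have x'0: "(x has_derivative (\<lambda>h. h *\<^sub>R v)) (at 0)" using x'[of 0] by simp
    have *: "((\<lambda>t. g (x t)) has_real_derivative g' v) (at 0)" if "(g has_derivative g') (at p)" for g :: "'a \<Rightarrow> real" and g'
    proof -
      from diff_chain_at[OF x'0] that
      have "((\<lambda>t. g (x t)) has_derivative (\<lambda>h. g' (h *\<^sub>R v))) (at 0)" by (simp add: o_def x0)
      moreover have "(\<lambda>h. g' (h *\<^sub>R v)) = (*) (g' v)"
        using linear_cmul[OF has_derivative_linear[OF that]] by (intro ext) (simp add: mult.commute)
      ultimately show ?thesis by (simp add: has_field_derivative_def)
    qed
    show ?thesis unfolding f'_def
      by (rule DERIV_cong[OF DERIV_add[OF *[OF v] DERIV_mult[OF _ *[OF q]]]])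
        (auto intro!: derivative_eq_intros simp: x0)
  qed
  ultimately have "\<exists>r>0. \<forall>t. 0 < t \<and> t < r \<longrightarrow>
      \<bar>F (x t) - F (x 0) - f' 0 * t - (Fv v + 2 * c * F' p q) / 2 * t\<^sup>2\<bar> \<le> e * t\<^sup>2"
    using second_order_expansion[OF d(1), of "\<lambda>t. F (x t)" f'] \<open>e > 0\<close> by blast
  then show ?thesis by (simp add: x_def f'_def add_divide_distrib)
qed

lemma quadratic_coefficients_vanish:
  fixes a b :: real
  assumes "\<And>e. e > 0 \<Longrightarrow> \<exists>r>0. \<forall>t. 0 < t \<and> t < r \<longrightarrow> \<bar>a * t + b * t\<^sup>2\<bar> \<le> e * t\<^sup>2"
  shows "a = 0" "b = 0"
proof -
  show a: "a = 0"
  proof (rule ccontr)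
    assume a: "a \<noteq> 0"
    obtain r where r: "r > 0" "\<And>t. 0 < t \<Longrightarrow> t < r \<Longrightarrow> \<bar>a * t + b * t\<^sup>2\<bar> \<le> 1 * t\<^sup>2"
      using assms[of 1] by auto
    define t where "t = min (r / 2) (\<bar>a\<bar> / (2 * (1 + \<bar>b\<bar>)))"
    have t: "0 < t" "t < r" "t * (2 * (1 + \<bar>b\<bar>)) \<le> \<bar>a\<bar>"
      using r(1) a by (auto simp: t_def min_def field_simps add_pos_nonneg)
    have "\<bar>a\<bar> * t \<le> \<bar>a * t + b * t\<^sup>2\<bar> + \<bar>b\<bar> * t\<^sup>2"
    proof -
      have "\<bar>a * t\<bar> \<le> \<bar>a * t + b * t\<^sup>2\<bar> + \<bar>b * t\<^sup>2\<bar>" by linarith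
      then show ?thesis using t(1) by (simp add: abs_mult)
    qed
    also have "\<dots> \<le> t * (t * (1 + \<bar>b\<bar>))" using r(2)[OF t(1,2)] by (simp add: power2_eq_square algebra_simps)
    finally have "\<bar>a\<bar> \<le> t * (1 + \<bar>b\<bar>)" using t(1) by (simp add: mult.commute)
    moreover have "2 * (t * (1 + \<bar>b\<bar>)) \<le> \<bar>a\<bar>" using t(3) by (simp only: mult.left_commute)
    moreover have "\<bar>a\<bar> > 0" using a by simp
    ultimately show False by linarith
  qed
  show "b = 0"
  proof (rule ccontr)
    assume b: "b \<noteq> 0"
    obtain r where r: "r > 0" "\<And>t. 0 < t \<Longrightarrow> t < r \<Longrightarrow> \<bar>a * t + b * t\<^sup>2\<bar> \<le> \<bar>b\<bar> / 2 * t\<^sup>2"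
      using assms[of "\<bar>b\<bar> / 2"] b by auto
    have "\<bar>b\<bar> * (r/2)\<^sup>2 \<le> \<bar>b\<bar> / 2 * (r/2)\<^sup>2" using r(2)[of "r/2"] r(1) a by (simp add: abs_mult)
    then show False using b r(1) by simp
  qed
qed

context gauge3
begin

text \<open>No parametrisation of the shadow boundary is needed: a parabola from \<open>p\<close> in
  direction \<open>v\<close>, corrected along \<open>q\<close>, stays within o(t^2) of its cone. The
  flatness equation therefore holds along the parabola up to o(t^2), and its coefficients of order
  one and two vanish.\<close>

lemma flat_shadow_cubic:
  assumes dim: "DIM('a) \<ge> 3" and p: "rho p = 1" "good p"
    and q: "D1 p q = 1" "q \<notin> span {p}"
    and a: "a \<noteq> 0" and flat: "\<And>x. rho x = 1 \<Longrightarrow> D1 x q = 1 \<Longrightarrow> a \<bullet> x = b"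
  shows "\<exists>m. \<forall>v. D2 p q v = 0 \<longrightarrow> D3 p q v v = m * D2 p v v"
proof -
  have pne: "p \<noteq> 0" using p(2) by (simp add: good_def)
  \<comment> \<open>The homogeneous extension of the flatness equation: it vanishes on the whole
    cone over the shadow boundary, since \<open>D1\<close> has degree zero.\<close>
  define L where "L x = a \<bullet> x - b * rho x" for x
  define L' where "L' x w = a \<bullet> w - b * D1 x w" for x w
  have L0: "L x = 0" if x: "x \<noteq> 0" "D1 x q = 1" for x
  proof -
    have r: "rho x > 0" using rho_pos[OF x(1)] .
    have "a \<bullet> ((1 / rho x) *\<^sub>R x) = b"
      by (rule flat) (use r x rho_scale[of "1 / rho x" x] D1_scale[OF x(1), of "1 / rho x" q] in auto)
    then show ?thesis using r by (simp add: L_def field_simps)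
  qed
  define N where "N = D2 p q q"
  have N: "N > 0" using p(2) q(2) by (simp add: N_def good_def)
  have main: "L' p v = 0 \<and> - b * D2 p v v * N = L' p q * D3 p q v v" if v: "D2 p q v = 0" for v
  proof -
    \<comment> \<open>Chosen to cancel the \<open>t^2\<close> term of \<open>D1 _ q\<close> along
      the curve.\<close>
    define c where "c = - D3 p q v v / (2 * N)"
    define P where "P s t = p + t *\<^sub>R v + (t\<^sup>2 * s) *\<^sub>R q" for s t
    define M where "M = \<bar>a \<bullet> q\<bar> + \<bar>b\<bar> * (rho q + rho (- q)) + 1"
    have rho_nonneg: "rho z \<ge> 0" for z using rho_pos[of z] rho_0 by (cases "z = 0") auto
    have M: "M > 0" unfolding M_def using rho_nonneg by (intro add_nonneg_pos add_nonneg_nonneg mult_nonneg_nonneg) auto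
    have rho_lip: "\<bar>rho (y + h *\<^sub>R q) - rho y\<bar> \<le> \<bar>h\<bar> * (rho q + rho (- q))" for y h
    proof -
      have hq: "rho (h *\<^sub>R q) \<le> \<bar>h\<bar> * (rho q + rho (- q))" for h
      proof (cases h "0::real" rule: linorder_cases)
        case less
        then have "rho (h *\<^sub>R q) = \<bar>h\<bar> * rho (- q)" using rho_scale[of "- h" "- q"] by simp
        then show ?thesis using rho_nonneg by (simp add: mult_left_mono)
      next
        case greater
        then show ?thesis using rho_scale[of h q] rho_nonneg by (simp add: mult_left_mono)
      qed (simp add: rho_0)
      have "rho (y + h *\<^sub>R q) \<le> rho y + rho (h *\<^sub>R q)" by (rule rho_add)
      moreover have "rho y \<le> rho (y + h *\<^sub>R q) + rho ((- h) *\<^sub>R q)"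
        using rho_add[of "y + h *\<^sub>R q" "(- h) *\<^sub>R q"] by simp
      moreover have "rho ((- h) *\<^sub>R q) \<le> \<bar>h\<bar> * (rho q + rho (- q))"
        using hq[of "- h"] by (simp only: abs_minus_cancel)
      ultimately show ?thesis using hq[of h] by linarith
    qed
    have L_lip: "\<bar>L (y + h *\<^sub>R q) - L y\<bar> \<le> \<bar>h\<bar> * M" for y h
    proof -
      have "L (y + h *\<^sub>R q) - L y = h * (a \<bullet> q) - b * (rho (y + h *\<^sub>R q) - rho y)"
        by (simp add: L_def inner_simps algebra_simps)
      then have "\<bar>L (y + h *\<^sub>R q) - L y\<bar> \<le> \<bar>h\<bar> * \<bar>a \<bullet> q\<bar> + \<bar>b\<bar> * \<bar>rho (y + h *\<^sub>R q) - rho y\<bar>"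
        by (metis abs_mult abs_triangle_ineq4)
      also have "\<dots> \<le> \<bar>h\<bar> * \<bar>a \<bullet> q\<bar> + \<bar>b\<bar> * (\<bar>h\<bar> * (rho q + rho (- q)))"
        using rho_lip by (intro add_left_mono mult_left_mono) auto
      also have "\<dots> \<le> \<bar>h\<bar> * M" by (simp add: M_def algebra_simps)
      finally show ?thesis .
    qed
    have G_exp: "\<exists>r>0. \<forall>t. 0 < t \<and> t < r \<longrightarrow>
        \<bar>D1 (P s t) q - 1 - (D3 p q v v / 2 + s * N) * t\<^sup>2\<bar> \<le> e * t\<^sup>2" if "e > 0" for s e
    proof -
      have "\<exists>r>0. \<forall>t. 0 < t \<and> t < r \<longrightarrow>
        \<bar>D1 (p + t *\<^sub>R v + (t\<^sup>2 * s) *\<^sub>R q) q - D1 p q - D2 p q v * t - (D3 p q v v / 2 + s * D2 p q q) * t\<^sup>2\<bar> \<le> e * t\<^sup>2"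
        by (rule expansion_along_parabola[of "- {0}"]) (use pne D2 D3 that in auto)
      then show ?thesis by (simp add: P_def N_def v q(1))
    qed
    have L_exp: "\<exists>r>0. \<forall>t. 0 < t \<and> t < r \<longrightarrow>
        \<bar>L (P c t) - L p - L' p v * t - (- b * D2 p v v / 2 + c * L' p q) * t\<^sup>2\<bar> \<le> e * t\<^sup>2" if "e > 0" for e
      unfolding P_def
    proof (rule expansion_along_parabola[where S = "- {0}" and F' = L'
          and Fv = "\<lambda>w. - b * D2 p v w" and Fq = "\<lambda>w. - b * D2 p q w"])
      show "(L has_derivative L' y) (at y)" if "y \<in> - {0}" for y
        unfolding L_def L'_def using that by (auto intro!: derivative_eq_intros D1)
      show "((\<lambda>y. L' y v) has_derivative (\<lambda>w. - b * D2 p v w)) (at p)"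
        "((\<lambda>y. L' y q) has_derivative (\<lambda>w. - b * D2 p q w)) (at p)"
        unfolding L'_def by (auto intro!: derivative_eq_intros D2 pne)
    qed (use pne that in auto)
    have Lp: "L p = 0" by (rule L0[OF pne q(1)])
    have L_small: "\<exists>r>0. \<forall>t. 0 < t \<and> t < r \<longrightarrow> \<bar>L (P c t)\<bar> \<le> e * t\<^sup>2" if "e > 0" for e
    proof -
      \<comment> \<open>Moving the parameter from \<open>c\<close> to \<open>c - d\<close> or
        \<open>c + d\<close> shifts the \<open>t^2\<close> coefficient of \<open>D1 _ q\<close> by
        \<open>d * N\<close>, twice the permitted error. The intermediate value theorem gives a
        point of the cone in between; division by the Lipschitz bound \<open>M\<close> turns the
        shift into an error \<open>e\<close> for \<open>L\<close>.\<close>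
      define d where "d = e / M"
      have d: "d > 0" using that M by (simp add: d_def)
      have dN: "d * N / 2 > 0" using d N by simp
      have val: "D3 p q v v / 2 + (c - d) * N = - d * N" "D3 p q v v / 2 + (c + d) * N = d * N"
        using N by (simp_all add: c_def field_simps)
      obtain r1 where r1: "r1 > 0" "\<And>t. 0 < t \<Longrightarrow> t < r1 \<Longrightarrow>
          \<bar>D1 (P (c - d) t) q - 1 - (- d * N) * t\<^sup>2\<bar> \<le> d * N / 2 * t\<^sup>2"
        using G_exp[OF dN, of "c - d"] unfolding val by blast
      obtain r2 where r2: "r2 > 0" "\<And>t. 0 < t \<Longrightarrow> t < r2 \<Longrightarrow>
          \<bar>D1 (P (c + d) t) q - 1 - (d * N) * t\<^sup>2\<bar> \<le> d * N / 2 * t\<^sup>2"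
        using G_exp[OF dN, of "c + d"] unfolding val by blast
      \<comment> \<open>For \<open>t\<close> below \<open>r3\<close> the value of
        \<open>D1 p\<close> on the curve stays positive, so the curve misses the origin.\<close>
      define r3 where "r3 = 1 / (1 + \<bar>D1 p v\<bar> + \<bar>c\<bar> + d)"
      have r3: "r3 > 0" "r3 \<le> 1" using d by (auto simp: r3_def add_pos_nonneg)
      show ?thesis
      proof (intro exI[of _ "min (min r1 r2) r3"] conjI allI impI)
        fix t assume "0 < t \<and> t < min (min r1 r2) r3"
        then have t: "0 < t" "t < r1" "t < r2" "t < r3" by auto
        have ne: "P s t \<noteq> 0" if s: "c - d \<le> s" "s \<le> c + d" for s
        proof
          assume "P s t = 0"
          then have "D1 p (P s t) = 0" using linear_0[OF linear_D(1)[OF pne]] by simp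
          then have z: "1 + t * D1 p v + t\<^sup>2 * s = 0"
            using D1_self[OF pne] p(1) q(1) linear_add[OF linear_D(1)[OF pne]] linear_cmul[OF linear_D(1)[OF pne]]
            by (simp add: P_def)
          have "t * (1 + \<bar>D1 p v\<bar> + \<bar>c\<bar> + d) < 1"
            using t(4) d unfolding r3_def by (simp add: pos_less_divide_eq add_pos_nonneg)
          moreover have "t * D1 p v \<ge> - (t * \<bar>D1 p v\<bar>)" using t(1) abs_ge_minus_self[of "t * D1 p v"] by (simp add: abs_mult)
          moreover have "t\<^sup>2 * s \<ge> - (t * (\<bar>c\<bar> + d))"
          proof -
            have "\<bar>s\<bar> \<le> \<bar>c\<bar> + d" using s by linarith
            then have "t\<^sup>2 * \<bar>s\<bar> \<le> t * (\<bar>c\<bar> + d)"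
              using t r3(2) by (intro mult_mono) (auto simp: power2_eq_square mult_left_le)
            then show ?thesis using abs_ge_minus_self[of "t\<^sup>2 * s"] by (simp add: abs_mult)
          qed
          ultimately show False using z t(1) by (simp add: distrib_left)
        qed
        have pos: "d * N * t\<^sup>2 > 0" using d N t(1) by simp
        have lo: "D1 (P (c - d) t) q \<le> 1" and hi: "1 \<le> D1 (P (c + d) t) q"
        proof -
          have "\<bar>D1 (P (c - d) t) q - 1 + d * N * t\<^sup>2\<bar> \<le> d * N * t\<^sup>2 / 2"
            "\<bar>D1 (P (c + d) t) q - 1 - d * N * t\<^sup>2\<bar> \<le> d * N * t\<^sup>2 / 2"
            using r1(2)[OF t(1,2)] r2(2)[OF t(1,3)] by simp_all
          then show "D1 (P (c - d) t) q \<le> 1" "1 \<le> D1 (P (c + d) t) q" using pos by linarith+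
        qed
        have cont: "isCont (\<lambda>s. D1 (P s t) q) s" if s: "c - d \<le> s" "s \<le> c + d" for s
        proof -
          have "isCont (\<lambda>s. P s t) s" unfolding P_def by (intro continuous_intros)
          then show ?thesis by (rule isCont_o2) (rule has_derivative_continuous[OF D2[OF ne[OF s]]])
        qed
        obtain s where s: "c - d \<le> s" "s \<le> c + d" "D1 (P s t) q = 1"
          using IVT[of "\<lambda>s. D1 (P s t) q" "c - d" 1 "c + d"] lo hi cont d by auto
        have "L (P s t) = 0" by (rule L0[OF ne[OF s(1,2)] s(3)])
        moreover have "P s t = P c t + (t\<^sup>2 * (s - c)) *\<^sub>R q" by (simp add: P_def algebra_simps)
        ultimately have "\<bar>L (P c t)\<bar> \<le> \<bar>t\<^sup>2 * (s - c)\<bar> * M" using L_lip[of "P c t" "t\<^sup>2 * (s - c)"] by simp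
        also have "\<dots> \<le> t\<^sup>2 * d * M" using s M by (auto simp: abs_mult abs_le_iff intro!: mult_right_mono mult_left_mono)
        also have "\<dots> = e * t\<^sup>2" using M by (simp add: d_def)
        finally show "\<bar>L (P c t)\<bar> \<le> e * t\<^sup>2" .
      qed (use r1 r2 r3 in auto)
    qed
    have comb: "\<exists>r>0. \<forall>t. 0 < t \<and> t < r \<longrightarrow> \<bar>L' p v * t + (- b * D2 p v v / 2 + c * L' p q) * t\<^sup>2\<bar> \<le> e * t\<^sup>2"
      if "e > 0" for e
    proof -
      obtain r1 where r1: "r1 > 0" "\<And>t. 0 < t \<Longrightarrow> t < r1 \<Longrightarrow>
          \<bar>L (P c t) - L p - L' p v * t - (- b * D2 p v v / 2 + c * L' p q) * t\<^sup>2\<bar> \<le> e / 2 * t\<^sup>2"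
        using L_exp[of "e / 2"] \<open>e > 0\<close> by auto
      obtain r2 where r2: "r2 > 0" "\<And>t. 0 < t \<Longrightarrow> t < r2 \<Longrightarrow> \<bar>L (P c t)\<bar> \<le> e / 2 * t\<^sup>2"
        using L_small[of "e / 2"] \<open>e > 0\<close> by auto
      show ?thesis
      proof (intro exI[of _ "min r1 r2"] conjI allI impI)
        fix t assume t: "0 < t \<and> t < min r1 r2"
        define k where "k = (- b * D2 p v v / 2 + c * L' p q) * t\<^sup>2"
        have "\<bar>L (P c t) - L' p v * t - k\<bar> \<le> e / 2 * t\<^sup>2" "\<bar>L (P c t)\<bar> \<le> e / 2 * t\<^sup>2"
          using r1(2)[of t] r2(2)[of t] Lp t unfolding k_def by auto
        then have "\<bar>L' p v * t + k\<bar> \<le> e / 2 * t\<^sup>2 + e / 2 * t\<^sup>2" by linarith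
        then show "\<bar>L' p v * t + (- b * D2 p v v / 2 + c * L' p q) * t\<^sup>2\<bar> \<le> e * t\<^sup>2"
          by (simp add: k_def)
      qed (use r1 r2 in auto)
    qed
    have 1: "L' p v = 0" and 2: "- b * D2 p v v / 2 + c * L' p q = 0"
      using quadratic_coefficients_vanish[OF comb] by auto
    from 2 have e: "b * D2 p v v = 2 * c * L' p q" by simp
    have "- b * D2 p v v * N = - (b * D2 p v v) * N" by simp
    also have "\<dots> = L' p q * (- 2 * N * c)" unfolding e by simp
    also have "- 2 * N * c = D3 p q v v" using N by (simp add: c_def)
    finally show ?thesis using 1 by simp
  qed
  show ?thesis
  proof (cases "L' p q = 0")
    case False
    have "D3 p q v v = (- b * N / L' p q) * D2 p v v" if "D2 p q v = 0" for v
      using main[OF that] False by (simp add: field_simps)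
    then show ?thesis by blast
  next
    \<comment> \<open>Then \<open>L' p\<close> vanishes on \<open>q\<close> and on its complement,
      hence everywhere; a nonradial \<open>v\<close> in the complement forces \<open>b = 0\<close>,
      and so \<open>a = 0\<close>.\<close>
    case True
    have perp: "D2 p q (w - (D2 p q w / N) *\<^sub>R q) = 0" for w using N by (simp add: D2_simps[OF pne] N_def)
    have linL: "linear (L' p)" unfolding L'_def using linear_D(1)[OF pne]
      by (intro linearI) (simp_all add: inner_simps linear_add linear_cmul algebra_simps)
    have L'0: "L' p w = 0" for w
      using main[OF perp[of w]] True by (simp add: linear_diff[OF linL] linear_cmul[OF linL])
    have "dim {p, q} \<le> 2" using dim_le_card'[of "{p,q}"] by (simp add: card_insert_if split: if_splits)
    then have "dim (span {p, q}) \<noteq> dim (UNIV :: 'a set)" using dim by (simp add: dim_UNIV)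
    then have "span {p, q} \<noteq> UNIV" by metis
    then obtain u where u: "u \<notin> span {p, q}" by blast
    define v where "v = u - (D2 p q u / N) *\<^sub>R q"
    have "v \<notin> span {p}"
    proof
      assume "v \<in> span {p}"
      then have "v \<in> span {p, q}" using span_mono[of "{p}" "{p,q}"] by blast
      then have "v + (D2 p q u / N) *\<^sub>R q \<in> span {p, q}" by (intro span_add span_mul) (auto intro: span_base)
      then show False using u by (simp add: v_def)
    qed
    then have "D2 p v v > 0" using p(2) by (simp add: good_def)
    moreover have "- b * D2 p v v * N = 0" using main[OF perp[of u]] True by (simp add: v_def)
    ultimately have "b = 0" using N by simp
    then have "a \<bullet> a = 0" using L'0[of a] by (simp add: L'_def)
    then show ?thesis using a by simp
  qed
qed

end

section \<open>The gauge of a convex body\<close>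

text \<open>As \<open>Ck_on\<close>, but without continuity of the last derivatives, which the argument does not use.\<close>

primrec kdiff :: "nat \<Rightarrow> 'a::euclidean_space set \<Rightarrow> ('a \<Rightarrow> real) \<Rightarrow> bool" where
  "kdiff 0 U f \<longleftrightarrow> True"
| "kdiff (Suc k) U f \<longleftrightarrow> (\<forall>x\<in>U. f differentiable (at x)) \<and> (\<forall>v. kdiff k U (\<lambda>x. frechet_derivative f (at x) v))"

section \<open>Closure properties of k-fold differentiability\<close>

lemma Ck_on_imp_kdiff: "Ck_on k U f \<Longrightarrow> kdiff k U f"
  by (induction k arbitrary: f) auto

lemma kdiff_cong:
  assumes "open U" "\<And>x. x \<in> U \<Longrightarrow> f x = g x" "kdiff k U f"
  shows "kdiff k U g"
  using assms(2,3)
proof (induction k arbitrary: f g)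
  case (Suc k)
  have der: "(g has_derivative frechet_derivative f (at x)) (at x)" if "x \<in> U" for x
    by (rule has_derivative_transform_within_open[OF frechet_derivative_works[THEN iffD1] assms(1) that])
      (use Suc.prems that in auto)
  have "frechet_derivative f (at x) = frechet_derivative g (at x)" if "x \<in> U" for x
    by (rule frechet_derivative_at[OF der[OF that]])
  then have "kdiff k U (\<lambda>x. frechet_derivative g (at x) v)" for v
    using Suc.IH[of "\<lambda>x. frechet_derivative f (at x) v" "\<lambda>x. frechet_derivative g (at x) v"] Suc.prems by auto
  then show ?case using der by (auto simp: differentiable_def)
qed simp

lemma kdiff_SucI:
  assumes "open U" "\<And>x. x \<in> U \<Longrightarrow> (f has_derivative f' x) (at x)" "\<And>v. kdiff k U (\<lambda>x. f' x v)"
  shows "kdiff (Suc k) U f"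
proof -
  have "kdiff k U (\<lambda>x. frechet_derivative f (at x) v)" for v
    by (rule kdiff_cong[OF assms(1) _ assms(3)[of v]])
      (use frechet_derivative_at[OF assms(2)] in \<open>auto dest: fun_cong\<close>)
  then show ?thesis using assms(2) by (auto simp: differentiable_def)
qed

lemma kdiff_derivative:
  assumes "kdiff (Suc k) U f" "x \<in> U"
  shows "(f has_derivative frechet_derivative f (at x)) (at x)"
  using assms by (auto simp: frechet_derivative_works)

lemma kdiff_subset: "kdiff k U f \<Longrightarrow> V \<subseteq> U \<Longrightarrow> kdiff k V f"
proof (induction k arbitrary: f)
  case (Suc k)
  then show ?case by (metis kdiff.simps(2) subsetD)
qed simp

lemma kdiff_mono: "kdiff (Suc k) U f \<Longrightarrow> kdiff k U f"
  by (induction k arbitrary: f) auto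

lemma kdiff_local:
  assumes "\<And>x. x \<in> U \<Longrightarrow> \<exists>V. x \<in> V \<and> kdiff k V f"
  shows "kdiff k U f"
  using assms
proof (induction k arbitrary: f)
  case (Suc k)
  have "kdiff k U (\<lambda>x. frechet_derivative f (at x) v)" for v
    by (rule Suc.IH) (use Suc.prems in auto, metis)
  moreover have "f differentiable at x" if "x \<in> U" for x using Suc.prems[OF that] by auto
  ultimately show ?case by simp
qed simp

lemma kdiff_const: "open U \<Longrightarrow> kdiff k U (\<lambda>x. c)"
proof (induction k arbitrary: c)
  case (Suc k)
  show ?case by (rule kdiff_SucI[of _ _ "\<lambda>x v. 0"]) (use Suc in auto)
qed simp

lemma kdiff_inner: "open U \<Longrightarrow> kdiff k U (\<lambda>x. x \<bullet> b)"
proof (cases k)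
  case (Suc k)
  assume "open U"
  then show ?thesis unfolding Suc
    by (intro kdiff_SucI[of _ _ "\<lambda>x v. v \<bullet> b"] kdiff_const) (auto intro!: derivative_eq_intros)
qed simp

lemma kdiff_add: "open U \<Longrightarrow> kdiff k U f \<Longrightarrow> kdiff k U g \<Longrightarrow> kdiff k U (\<lambda>x. f x + g x)"
proof (induction k arbitrary: f g)
  case (Suc k)
  show ?case
    by (rule kdiff_SucI[OF Suc.prems(1) has_derivative_add[OF kdiff_derivative[OF Suc.prems(2)] kdiff_derivative[OF Suc.prems(3)]]])
      (use Suc in auto)
qed simp

lemma kdiff_mult: "open U \<Longrightarrow> kdiff k U f \<Longrightarrow> kdiff k U g \<Longrightarrow> kdiff k U (\<lambda>x. f x * g x)"
proof (induction k arbitrary: f g)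
  case (Suc k)
  note m = kdiff_mono[OF Suc.prems(2)] kdiff_mono[OF Suc.prems(3)]
  show ?case
    by (rule kdiff_SucI[OF Suc.prems(1) has_derivative_mult[OF kdiff_derivative[OF Suc.prems(2)] kdiff_derivative[OF Suc.prems(3)]]])
      (use Suc m in \<open>auto intro!: kdiff_add\<close>)
qed simp

lemma kdiff_sum: "open U \<Longrightarrow> (\<And>i. i \<in> I \<Longrightarrow> kdiff k U (f i)) \<Longrightarrow> kdiff k U (\<lambda>x. \<Sum>i\<in>I. f i x)"
  by (induction I rule: infinite_finite_induct) (auto intro: kdiff_const kdiff_add)

lemma kdiff_inverse:
  "open U \<Longrightarrow> kdiff k U f \<Longrightarrow> (\<And>x. x \<in> U \<Longrightarrow> f x \<noteq> 0) \<Longrightarrow> kdiff k U (\<lambda>x. inverse (f x))"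
proof (induction k arbitrary: f)
  case (Suc k)
  let ?f' = "\<lambda>x v. (- 1) * (inverse (f x) * frechet_derivative f (at x) v * inverse (f x))"
  show ?case
  proof (rule kdiff_SucI[OF Suc.prems(1), of _ ?f'])
    fix x assume x: "x \<in> U"
    from Deriv.has_derivative_inverse[OF Suc.prems(3)[OF x] kdiff_derivative[OF Suc.prems(2) x]]
    show "((\<lambda>x. inverse (f x)) has_derivative ?f' x) (at x)" by simp
  next
    fix v
    have "kdiff k U (\<lambda>x. inverse (f x))" using Suc kdiff_mono by blast
    then show "kdiff k U (\<lambda>x. ?f' x v)"
      using Suc.prems by (intro kdiff_mult kdiff_const) auto
  qed
qed simp

text \<open>The inner map enters through its coordinates because \<open>kdiff\<close> speaks of real
  functions; the induction applies to the partial derivatives of \<open>f\<close> along the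
  basis.\<close>

lemma kdiff_compose:
  fixes y :: "'a::euclidean_space \<Rightarrow> 'b::euclidean_space"
  assumes "open U" "y ` U \<subseteq> V"
    and "kdiff k V f" "\<And>b. b \<in> Basis \<Longrightarrow> kdiff k U (\<lambda>x. y x \<bullet> b)"
  shows "kdiff k U (\<lambda>x. f (y x))"
  using assms(3,4)
proof (induction k arbitrary: f)
  case (Suc k)
  define y' where "y' x v = (\<Sum>b\<in>Basis. frechet_derivative (\<lambda>x. y x \<bullet> b) (at x) v *\<^sub>R b)" for x v
  have y': "(y has_derivative y' x) (at x)" if x: "x \<in> U" for x
  proof (rule has_derivative_componentwise_within[THEN iffD2], intro ballI)
    fix b :: 'b assume b: "b \<in> Basis"
    have "y' x v \<bullet> b = frechet_derivative (\<lambda>x. y x \<bullet> b) (at x) v" for v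
      unfolding y'_def using b by simp
    then show "((\<lambda>x. y x \<bullet> b) has_derivative (\<lambda>v. y' x v \<bullet> b)) (at x)"
      using kdiff_derivative[OF Suc.prems(2)[OF b] x] by simp
  qed
  let ?F = "\<lambda>x v. \<Sum>b\<in>Basis. frechet_derivative (\<lambda>x. y x \<bullet> b) (at x) v * frechet_derivative f (at (y x)) b"
  show ?case
  proof (rule kdiff_SucI[OF assms(1), of _ ?F])
    fix x assume x: "x \<in> U"
    then have "y x \<in> V" using assms(2) by blast
    note f' = kdiff_derivative[OF Suc.prems(1) this]
    have lin: "linear (frechet_derivative f (at (y x)))" by (rule has_derivative_linear[OF f'])
    have "frechet_derivative f (at (y x)) (y' x v) = ?F x v" for v
      by (simp add: y'_def linear_sum[OF lin] linear_cmul[OF lin])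
    then show "((\<lambda>x. f (y x)) has_derivative ?F x) (at x)"
      using diff_chain_at[OF y'[OF x] f'] by (simp add: o_def)
  next
    fix v
    show "kdiff k U (\<lambda>x. ?F x v)"
    proof (intro kdiff_sum[OF assms(1)] kdiff_mult[OF assms(1)])
      fix b :: 'b assume b: "b \<in> Basis"
      show "kdiff k U (\<lambda>x. frechet_derivative (\<lambda>x. y x \<bullet> b) (at x) v)" using Suc.prems(2)[OF b] by simp
      show "kdiff k U (\<lambda>x. frechet_derivative f (at (y x)) b)"
        by (rule Suc.IH[of "\<lambda>z. frechet_derivative f (at z) b", OF _ kdiff_mono[OF Suc.prems(2)]])
          (use Suc.prems(1) in auto)
    qed
  qed
qed simp

section \<open>The Minkowski functional about an interior point\<close>

locale centred_body =
  fixes K :: "'a::euclidean_space set" and c :: 'a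
  assumes compact: "compact K" and convex: "convex K" and centre: "c \<in> interior K"
begin

definition scales :: "'a \<Rightarrow> real set" where
  "scales x = {t. t > 0 \<and> c + (1 / t) *\<^sub>R x \<in> K}"

definition rho :: "'a \<Rightarrow> real" where "rho x = Inf (scales x)"

lemma c_in_K: "c \<in> K" using centre interior_subset by blast

lemma scales_up: assumes "t \<in> scales x" "t \<le> s" shows "s \<in> scales x"
proof -
  have t: "t > 0" "c + (1 / t) *\<^sub>R x \<in> K" using assms by (auto simp: scales_def)
  have "(1 - t / s) *\<^sub>R c + (t / s) *\<^sub>R (c + (1 / t) *\<^sub>R x) \<in> K"
    using convexD_alt[OF convex c_in_K t(2), of "t / s"] t assms(2) by simp
  also have "(1 - t / s) *\<^sub>R c + (t / s) *\<^sub>R (c + (1 / t) *\<^sub>R x) = c + (1 / s) *\<^sub>R x"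
    using t(1) by (simp add: algebra_simps)
  finally show ?thesis using t assms(2) by (simp add: scales_def)
qed

lemma radii:
  obtains r R where "r > 0" "R > 0" "\<And>x t. t > 0 \<Longrightarrow> norm x \<le> r * t \<Longrightarrow> t \<in> scales x"
    "\<And>x t. t \<in> scales x \<Longrightarrow> norm x \<le> R * t"
proof -
  obtain r where r: "r > 0" "cball c r \<subseteq> K" using centre unfolding mem_interior_cball by blast
  obtain R where R: "R > 0" "\<And>x. x \<in> K \<Longrightarrow> norm x \<le> R"
    using compact_imp_bounded[OF compact] unfolding bounded_pos by blast
  have 1: "t \<in> scales x" if "t > 0" "norm x \<le> r * t" for x t
  proof -
    have "dist c (c + (1 / t) *\<^sub>R x) \<le> r" using that by (simp add: dist_norm divide_le_eq)
    then show ?thesis using r(2) that(1) by (auto simp: scales_def)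
  qed
  have 2: "norm x \<le> (2 * R) * t" if "t \<in> scales x" for x t
  proof -
    have t: "t > 0" "c + (1 / t) *\<^sub>R x \<in> K" using that by (auto simp: scales_def)
    have "norm ((c + (1 / t) *\<^sub>R x) - c) \<le> R + R"
      using norm_triangle_ineq4[of "c + (1 / t) *\<^sub>R x" c] R(2)[OF t(2)] R(2)[OF c_in_K] by linarith
    then show ?thesis using t(1) by (simp add: divide_le_eq)
  qed
  show ?thesis by (rule that[OF r(1) _ 1 2]) (use R in auto)
qed

lemma scales_ne: "scales x \<noteq> {}" and scales_bdd: "bdd_below (scales x)"
proof -
  obtain r R where r: "r > 0" "\<And>x t. t > 0 \<Longrightarrow> norm x \<le> r * t \<Longrightarrow> t \<in> scales x"
    using radii by metis
  have "norm x / r + 1 \<in> scales x" using r(1) by (intro r(2)) (auto simp: add_nonneg_pos add_pos_nonneg algebra_simps)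
  then show "scales x \<noteq> {}" by blast
  show "bdd_below (scales x)" by (rule bdd_belowI[of _ 0]) (auto simp: scales_def)
qed

lemma rho_le: "t \<in> scales x \<Longrightarrow> rho x \<le> t"
  unfolding rho_def by (rule cInf_lower[OF _ scales_bdd])

lemma scales_above: assumes "rho x < t" shows "t \<in> scales x"
proof -
  obtain s where "s \<in> scales x" "s < t"
    using cInf_lessD[OF scales_ne assms[unfolded rho_def]] by blast
  then show ?thesis using scales_up by simp
qed

lemma rho_bounds:
  obtains L where "L > 0" "\<And>x. rho x \<le> L * norm x" "\<And>x. norm x \<le> L * rho x"
proof -
  obtain r R where r: "r > 0" "R > 0" "\<And>x t. t > 0 \<Longrightarrow> norm x \<le> r * t \<Longrightarrow> t \<in> scales x"
    "\<And>x t. t \<in> scales x \<Longrightarrow> norm x \<le> R * t"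
    using radii by metis
  have 1: "rho x \<le> (1 / r) * norm x" for x
  proof (rule field_le_epsilon)
    fix e :: real assume "e > 0"
    then show "rho x \<le> (1 / r) * norm x + e"
      using r(1) by (intro rho_le r(3)) (auto simp: add_nonneg_pos add_pos_nonneg algebra_simps)
  qed
  have 2: "norm x \<le> R * rho x" for x
  proof -
    have "norm x / R \<le> rho x"
      unfolding rho_def by (rule cInf_greatest[OF scales_ne]) (use r in \<open>simp add: divide_le_eq mult.commute\<close>)
    then show ?thesis using r(2) by (simp add: divide_le_eq mult.commute)
  qed
  show ?thesis
  proof (rule that[of "max (1 / r) R"])
    fix x :: 'a
    have "(1 / r) * norm x \<le> max (1 / r) R * norm x" by (intro mult_right_mono) auto
    then show "rho x \<le> max (1 / r) R * norm x" using 1[of x] by linarith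
    have "rho x \<ge> 0" unfolding rho_def by (rule cInf_greatest[OF scales_ne]) (auto simp: scales_def)
    then have "R * rho x \<le> max (1 / r) R * rho x" by (intro mult_right_mono) auto
    then show "norm x \<le> max (1 / r) R * rho x" using 2[of x] by linarith
  qed (use r in auto)
qed

lemma rho_zero: "rho 0 = 0"
proof -
  obtain L where L: "L > 0" "\<And>x. rho x \<le> L * norm x" "\<And>x. norm x \<le> L * rho x" using rho_bounds by metis
  from L(2)[of 0] L(3)[of 0] L(1) show ?thesis by (simp add: zero_le_mult_iff)
qed

lemma rho_positive: fixes x :: "'a" assumes "x \<noteq> 0" shows "rho x > 0"
proof -
  obtain L where L: "L > 0" "\<And>x. norm x \<le> L * rho x" using rho_bounds by metis
  have "0 < norm x" using assms by simp
  also have "\<dots> \<le> L * rho x" by (rule L(2))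
  finally show ?thesis using L(1) by (simp add: zero_less_mult_iff)
qed

text \<open>\<open>K\<close> is closed and the infimum is positive, so the infimum is
  attained.\<close>

lemma rho_in_scales: fixes x :: "'a" assumes "x \<noteq> 0" shows "rho x \<in> scales x"
proof -
  note p = rho_positive[OF assms]
  let ?t = "\<lambda>n. rho x + inverse (real (Suc n))"
  define f where "f n = c + (1 / ?t n) *\<^sub>R x" for n
  have lim: "f \<longlonglongrightarrow> c + (1 / (rho x + 0)) *\<^sub>R x"
    unfolding f_def by (intro tendsto_intros LIMSEQ_inverse_real_of_nat) (use p in simp)
  have mem: "f n \<in> K" for n
    using scales_above[of x "?t n"] by (simp add: scales_def f_def)
  have "c + (1 / (rho x + 0)) *\<^sub>R x \<in> K"
    by (rule closed_sequentially[OF compact_imp_closed[OF compact] mem lim])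
  then show ?thesis using p by (simp add: scales_def)
qed

lemma rho_le_1_iff: "rho x \<le> 1 \<longleftrightarrow> c + x \<in> K"
proof (cases "x = 0")
  case False
  have "rho x \<le> 1 \<longleftrightarrow> 1 \<in> scales x" using scales_up[OF rho_in_scales[OF False]] rho_le by blast
  then show ?thesis by (simp add: scales_def)
qed (simp add: rho_zero c_in_K)

lemma rho_homogeneous: assumes "k > 0" shows "rho (k *\<^sub>R x) = k * rho x"
proof -
  have le: "rho (k *\<^sub>R x) \<le> k * rho x" if "k > 0" for k x
  proof (cases "x = 0")
    case False
    have "k * rho x \<in> scales (k *\<^sub>R x)" using rho_in_scales[OF False] that by (simp add: scales_def)
    then show ?thesis by (rule rho_le)
  qed (simp add: rho_zero)
  have "rho ((1 / k) *\<^sub>R (k *\<^sub>R x)) \<le> (1 / k) * rho (k *\<^sub>R x)" using assms by (intro le) simp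
  then have "k * rho x \<le> rho (k *\<^sub>R x)" using assms by (simp add: field_simps)
  then show ?thesis using le[OF assms] by (simp add: antisym)
qed

lemma rho_subadditive: "rho (x + y) \<le> rho x + rho y"
proof (cases "x = 0 \<or> y = 0")
  case False
  define s t where "s = rho x" and "t = rho y"
  have st: "s > 0" "t > 0" "c + (1 / s) *\<^sub>R x \<in> K" "c + (1 / t) *\<^sub>R y \<in> K"
    using False rho_positive rho_in_scales by (auto simp: s_def t_def scales_def)
  have "(s / (s + t)) *\<^sub>R (c + (1 / s) *\<^sub>R x) + (t / (s + t)) *\<^sub>R (c + (1 / t) *\<^sub>R y) \<in> K"
    using st by (intro convexD[OF convex]) (auto simp flip: add_divide_distrib)
  also have "(s / (s + t)) *\<^sub>R (c + (1 / s) *\<^sub>R x) + (t / (s + t)) *\<^sub>R (c + (1 / t) *\<^sub>R y)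
      = (s / (s + t) + t / (s + t)) *\<^sub>R c + (1 / (s + t)) *\<^sub>R (x + y)"
    using st(1,2) by (simp add: algebra_simps)
  also have "s / (s + t) + t / (s + t) = 1" using st(1,2) by (simp flip: add_divide_distrib)
  finally have "s + t \<in> scales (x + y)" using st by (simp add: scales_def)
  then show ?thesis unfolding s_def t_def by (rule rho_le)
qed (auto simp: rho_zero)

lemma rho_lipschitz: obtains L where "L > 0" "\<And>x y. \<bar>rho x - rho y\<bar> \<le> L * norm (x - y)"
proof -
  obtain L where L: "L > 0" "\<And>x. rho x \<le> L * norm x" using rho_bounds by metis
  have "rho x - rho y \<le> L * norm (x - y)" for x y
    using rho_subadditive[of "x - y" y] L(2)[of "x - y"] by simp
  then have "\<bar>rho x - rho y\<bar> \<le> L * norm (x - y)" for x y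
    by (simp add: abs_le_iff) (metis norm_minus_commute)
  then show ?thesis using that L(1) by blast
qed

lemma continuous_rho: "isCont rho x"
proof -
  obtain L where L: "L > 0" "\<And>x y. \<bar>rho x - rho y\<bar> \<le> L * norm (x - y)" using rho_lipschitz by metis
  have "((\<lambda>y. rho y - rho x) \<longlongrightarrow> 0) (at x)"
  proof (rule tendsto_0_le[of "\<lambda>y. norm (y - x)" _ _ L])
    have "((\<lambda>y. norm (y - x)) \<longlongrightarrow> norm (x - x)) (at x)" by (intro tendsto_intros)
    then show "((\<lambda>y. norm (y - x)) \<longlongrightarrow> 0) (at x)" by simp
  qed (use L(2) in \<open>auto simp: mult.commute\<close>)
  then show ?thesis unfolding isCont_def by (rule LIM_zero_cancel)
qed

lemma rho_less_1: assumes "rho x < 1" shows "c + x \<in> interior K"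
proof (rule interiorI)
  have "open (rho -` {..<1})" by (intro open_vimage) (auto intro: continuous_at_imp_continuous_on continuous_rho)
  then show "open ((+) c ` (rho -` {..<1}))" by (rule open_translation)
  show "c + x \<in> (+) c ` (rho -` {..<1})" using assms by auto
  show "(+) c ` (rho -` {..<1}) \<subseteq> K" using rho_le_1_iff by force
qed

lemma rho_interior: assumes "c + x \<in> interior K" shows "rho x < 1"
proof (cases "x = 0")
  case False
  obtain e where e: "e > 0" "cball (c + x) e \<subseteq> K" using assms unfolding mem_interior_cball by blast
  define k where "k = 1 + e / norm x"
  have "c + k *\<^sub>R x \<in> cball (c + x) e" using e(1) False by (simp add: k_def dist_norm algebra_simps)
  then have "rho (k *\<^sub>R x) \<le> 1" using e(2) rho_le_1_iff by blast
  moreover have "k > 1" using e(1) False by (simp add: k_def)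
  ultimately have "k * rho x \<le> 1" by (simp add: rho_homogeneous)
  moreover have "1 * rho x < k * rho x" using rho_positive[OF False] \<open>k > 1\<close> by (intro mult_strict_right_mono) auto
  ultimately show ?thesis by simp
qed (simp add: rho_zero)

lemma frontier_iff: "c + x \<in> frontier K \<longleftrightarrow> rho x = 1"
proof -
  have "rho x = 1 \<longleftrightarrow> rho x \<le> 1 \<and> \<not> rho x < 1" by auto
  then show ?thesis
    using rho_less_1[of x] rho_interior[of x] rho_le_1_iff[of x] compact_imp_closed[OF compact]
    by (auto simp: frontier_def)
qed

text \<open>Otherwise \<open>f\<close> changes sign between two interior points near \<open>p\<close>, on segments from \<open>p\<close> to points
  close to \<open>c\<close>, and so vanishes in the interior.\<close>

lemma transversal:
  fixes f :: "'a \<Rightarrow> real"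
  assumes U: "open U" "p \<in> U" and p: "p \<in> frontier K"
    and zero: "frontier K \<inter> U = {x \<in> U. f x = 0}"
    and f: "\<And>x. x \<in> U \<Longrightarrow> f differentiable (at x)"
    and F: "(f has_derivative F) (at p)" "F \<noteq> (\<lambda>v. 0)"
  shows "F (p - c) \<noteq> 0"
proof
  assume Fp: "F (p - c) = 0"
  have lin: "linear F" by (rule has_derivative_linear[OF F(1)])
  obtain v where "F v \<noteq> 0" using F(2) by auto
  then have "F (F v *\<^sub>R v) > 0"
    by (cases "F v > 0") (auto simp: linear_cmul[OF lin] zero_less_mult_iff not_less order.order_iff_strict)
  then obtain u where u: "F u > 0" by blast
  have une: "u \<noteq> 0" using u linear_0[OF lin] by auto
  obtain r where r: "r > 0" "cball c r \<subseteq> interior K"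
    using centre open_interior open_contains_cball by metis
  define h where "h = r / norm u"
  have h: "h > 0" using r une by (simp add: h_def)
  define w where "w s = (c - p) + (s * h) *\<^sub>R u" for s
  have Fw: "F (w s) = s * h * F u" for s
  proof -
    have "F (c - p) = 0" using Fp linear_neg[OF lin, of "p - c"] by simp
    then show ?thesis by (simp add: w_def linear_add[OF lin] linear_cmul[OF lin])
  qed
  have pc: "p \<in> closure K" using p by (simp add: frontier_def)
  have inK: "p + t *\<^sub>R w s \<in> interior K" if "\<bar>s\<bar> = 1" "0 < t" "t \<le> 1" for s t
  proof -
    have "c + (s * h) *\<^sub>R u \<in> interior K"
      using r(2) that(1) une r(1) by (auto simp: h_def dist_norm abs_mult)
    from mem_interior_closure_convex_shrink[OF convex this pc that(2,3)]
    show ?thesis by (simp add: w_def algebra_simps)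
  qed
  have fp: "f p = 0" using zero U(2) p by blast
  have der: "((\<lambda>t. f (p + t *\<^sub>R w s)) has_real_derivative s * h * F u) (at 0)" for s
    using has_derivative_along_line[of f F p 0 "w s"] F(1) by (simp add: Fw)
  obtain d1 where d1: "d1 > 0" "\<And>t. 0 < t \<Longrightarrow> t < d1 \<Longrightarrow> f (p + t *\<^sub>R w 1) > 0"
    using DERIV_pos_inc_right[OF der[of 1]] h u fp by auto
  obtain d2 where d2: "d2 > 0" "\<And>t. 0 < t \<Longrightarrow> t < d2 \<Longrightarrow> f (p + t *\<^sub>R w (- 1)) < 0"
    using DERIV_neg_dec_right[OF der[of "- 1"]] h u fp by auto
  obtain e where e: "e > 0" "ball p e \<subseteq> U" using U open_contains_ball by blast
  define N where "N = norm (w 1) + norm (w (- 1)) + 1"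
  have N: "N > 0" by (simp add: N_def add_nonneg_pos)
  define t where "t = min (min (d1 / 2) (d2 / 2)) (min 1 (e / (2 * N)))"
  have t: "0 < t" "t < d1" "t < d2" "t \<le> 1" "t * N < e"
  proof -
    have "t \<le> e / (2 * N)" by (simp add: t_def)
    then have "t * (2 * N) \<le> e" using N by (simp add: pos_le_divide_eq)
    then show "t * N < e" using e(1) by simp
    show "t \<le> 1" by (simp add: t_def min_le_iff_disj)
  qed (use d1(1) d2(1) e(1) N in \<open>auto simp: t_def min_def\<close>)
  define a b where "a = p + t *\<^sub>R w (- 1)" and "b = p + t *\<^sub>R w 1"
  have ab: "a \<in> interior K \<inter> ball p e" "b \<in> interior K \<inter> ball p e"
  proof -
    have "norm (t *\<^sub>R w s) < e" if "s = 1 \<or> s = - 1" for s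
    proof -
      have "t * norm (w s) \<le> t * N" using that t(1) by (intro mult_left_mono) (auto simp: N_def)
      also have "\<dots> < e" by (rule t(5))
      finally show ?thesis using t(1) by simp
    qed
    then show "a \<in> interior K \<inter> ball p e" "b \<in> interior K \<inter> ball p e"
      using inK t by (auto simp: a_def b_def dist_norm)
  qed
  have seg: "a + s *\<^sub>R (b - a) \<in> interior K \<inter> ball p e" if "0 \<le> s" "s \<le> 1" for s
  proof -
    have "convex (interior K \<inter> ball p e)" by (intro convex_Int convex_interior convex convex_ball)
    from convexD_alt[OF this ab that] show ?thesis by (simp add: algebra_simps)
  qed
  have "isCont (\<lambda>s. f (a + s *\<^sub>R (b - a))) s" if "0 \<le> s" "s \<le> 1" for s
  proof -
    have "isCont f (a + s *\<^sub>R (b - a))"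
      using f[of "a + s *\<^sub>R (b - a)"] seg[OF that] e(2) by (intro differentiable_imp_continuous_within) auto
    moreover have "isCont (\<lambda>s. a + s *\<^sub>R (b - a)) s" by (intro continuous_intros)
    ultimately show ?thesis by (rule isCont_o2[rotated])
  qed
  moreover have "f (a + 0 *\<^sub>R (b - a)) \<le> 0" "0 \<le> f (a + 1 *\<^sub>R (b - a))"
    using d1(2)[of t] d2(2)[of t] t by (auto simp: a_def b_def)
  ultimately obtain s where s: "0 \<le> s" "s \<le> 1" "f (a + s *\<^sub>R (b - a)) = 0"
    using IVT[of "\<lambda>s. f (a + s *\<^sub>R (b - a))" 0 0 1] by auto
  then have "a + s *\<^sub>R (b - a) \<in> frontier K" using zero seg[OF s(1,2)] e(2) by blast
  then show False using seg[OF s(1,2)] by (simp add: frontier_def)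
qed

section \<open>Smoothness of the gauge\<close>

definition radial :: "'a \<Rightarrow> 'a" where "radial x = c + (1 / rho x) *\<^sub>R x"

lemma radial_frontier: assumes "x \<noteq> 0" shows "radial x \<in> frontier K"
  unfolding radial_def frontier_iff using rho_positive[OF assms] by (simp add: rho_homogeneous)

lemma continuous_radial: assumes "x \<noteq> 0" shows "isCont radial x"
  unfolding radial_def using rho_positive[OF assms] by (intro continuous_intros continuous_rho) auto

text \<open>An implicit function argument by hand. Both \<open>radial z\<close> and
  \<open>radial x\<close> are zeros of \<open>f\<close>, so \<open>F\<close> of their difference is
  of lower order; as \<open>rho\<close> is already Lipschitz, that difference is O(|z - x|), and
  solving for \<open>rho z - rho x\<close> gives the formula.\<close>

lemma rho_has_derivative:
  fixes f :: "'a \<Rightarrow> real"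
  assumes x: "x \<noteq> 0" and U: "open U" "radial x \<in> U" "\<And>z. z \<in> frontier K \<inter> U \<Longrightarrow> f z = 0"
    and F: "(f has_derivative F) (at (radial x))" "F (radial x - c) \<noteq> 0"
  shows "(rho has_derivative (\<lambda>v. F v / F (radial x - c))) (at x)"
  unfolding has_derivative_at_alt
proof (intro conjI allI impI)
  define A where "A = F (radial x - c)"
  define y where "y = radial x"
  have lin: "linear F" by (rule has_derivative_linear[OF F(1)])
  have A: "A \<noteq> 0" using F(2) by (simp add: A_def)
  show "bounded_linear (\<lambda>v. F v / F (radial x - c))"
    by (rule bounded_linear_compose[OF bounded_linear_divide has_derivative_bounded_linear[OF F(1)]])
  define r0 where "r0 = rho x"
  have r0: "r0 > 0" using rho_positive[OF x] by (simp add: r0_def)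
  have Fx: "F x = r0 * A" using r0 by (simp add: A_def radial_def r0_def linear_cmul[OF lin])
  obtain L where L: "L > 0" "\<And>x y. \<bar>rho x - rho y\<bar> \<le> L * norm (x - y)" using rho_lipschitz by metis
  \<comment> \<open>For \<open>z\<close> near \<open>x\<close>, \<open>C\<close> times the distance
    of \<open>z\<close> and \<open>x\<close> bounds the distance of their radial
    projections.\<close>
  define C where "C = 2 / r0 + norm x * (2 * L / r0\<^sup>2)"
  have C: "C > 0" using r0 L(1) by (simp add: C_def add_pos_nonneg)
  fix e :: real assume e: "e > 0"
  define e' where "e' = e * \<bar>A\<bar> / (2 * r0 * C)"
  have e': "e' > 0" using e A r0 C by (simp add: e'_def)
  obtain d1 where d1: "d1 > 0" "\<And>w. norm (w - y) < d1 \<Longrightarrow> \<bar>f w - f y - F (w - y)\<bar> \<le> e' * norm (w - y)"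
    using F(1) e' unfolding has_derivative_at_alt y_def[symmetric] by (metis real_norm_def)
  obtain d2 where d2: "d2 > 0" "ball y d2 \<subseteq> U" using U(1,2) open_contains_ball y_def by blast
  obtain d3 where d3: "d3 > 0" "\<And>z. dist z x < d3 \<Longrightarrow> dist (radial z) y < min d1 d2"
    using continuous_radial[OF x] d1(1) d2(1) unfolding continuous_at_eps_delta y_def by (metis min_less_iff_conj)
  obtain d4 where d4: "d4 > 0" "\<And>z. dist z x < d4 \<Longrightarrow> dist (rho z) r0 < r0 / 2"
    using continuous_rho[of x] r0 unfolding continuous_at_eps_delta r0_def by (metis half_gt_zero)
  show "\<exists>d>0. \<forall>z. norm (z - x) < d \<longrightarrow>
      norm (rho z - rho x - F (z - x) / F (radial x - c)) \<le> e * norm (z - x)"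
  proof (intro exI[of _ "min d3 d4"] conjI allI impI)
    fix z assume z: "norm (z - x) < min d3 d4"
    have rz: "r0 / 2 < rho z" "rho z < 2 * r0"
      using d4(2)[of z] z r0 by (auto simp: dist_norm abs_if split: if_splits)
    then have rz0: "rho z > 0" using r0 by simp
    then have zne: "z \<noteq> 0" using rho_zero by auto
    have near: "norm (radial z - y) < d1" "radial z \<in> U"
      using d3(2)[of z] z d2(2) by (auto simp: dist_norm norm_minus_commute)
    have "f (radial z) = 0" "f y = 0"
      using U(2,3) radial_frontier[OF zne] radial_frontier[OF x] near(2) by (auto simp: y_def)
    then have F1: "\<bar>F (radial z - y)\<bar> \<le> e' * norm (radial z - y)" using d1(2)[OF near(1)] by simp
    have diff: "radial z - y = (1 / rho z) *\<^sub>R (z - x) + (1 / rho z - 1 / r0) *\<^sub>R x"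
      by (simp add: radial_def y_def r0_def algebra_simps)
    have "norm (radial z - y) \<le> (1 / rho z) * norm (z - x) + \<bar>1 / rho z - 1 / r0\<bar> * norm x"
      unfolding diff using norm_triangle_ineq[of "(1 / rho z) *\<^sub>R (z - x)" "(1 / rho z - 1 / r0) *\<^sub>R x"] rz0 by simp
    also have "\<dots> \<le> 2 / r0 * norm (z - x) + (2 * L / r0\<^sup>2 * norm (z - x)) * norm x"
    proof (intro add_mono mult_right_mono)
      show "1 / rho z \<le> 2 / r0" using rz r0 rz0 by (simp add: field_simps)
      have "1 / rho z - 1 / r0 = (r0 - rho z) / (rho z * r0)" using rz0 r0 by (simp add: field_simps)
      then have "\<bar>1 / rho z - 1 / r0\<bar> = \<bar>rho x - rho z\<bar> / (rho z * r0)"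
        using rz0 r0 by (simp add: abs_divide r0_def)
      also have "\<dots> \<le> (L * norm (z - x)) / (r0 / 2 * r0)"
        using L rz r0 L(2)[of x z]
        by (intro frac_le) (auto simp: norm_minus_commute)
      also have "\<dots> = 2 * L / r0\<^sup>2 * norm (z - x)" by (simp add: power2_eq_square)
      finally show "\<bar>1 / rho z - 1 / r0\<bar> \<le> 2 * L / r0\<^sup>2 * norm (z - x)" .
    qed auto
    also have "\<dots> = C * norm (z - x)" by (simp add: C_def algebra_simps)
    finally have Y: "norm (radial z - y) \<le> C * norm (z - x)" .
    have "rho z * F (radial z - y) = F (z - x) - A * (rho z - r0)"
    proof -
      have "F (radial z - y) = F (z - x) / rho z + (1 / rho z - 1 / r0) * (r0 * A)"
        unfolding diff by (simp add: linear_add[OF lin] linear_cmul[OF lin] Fx)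
      moreover have "rho z * ((1 / rho z - 1 / r0) * (r0 * A)) = - A * (rho z - r0)"
        using rz0 r0 by (simp add: field_simps)
      moreover have "rho z * (F (z - x) / rho z) = F (z - x)" using rz0 by simp
      ultimately show ?thesis by (simp only: distrib_left)
    qed
    then have "\<bar>F (z - x) - A * (rho z - r0)\<bar> = rho z * \<bar>F (radial z - y)\<bar>"
      using rz0 abs_mult[of "rho z" "F (radial z - y)"] by simp
    also have "\<dots> \<le> (2 * r0) * (e' * (C * norm (z - x)))"
      using rz rz0 F1 Y e' by (intro mult_mono order_trans[OF F1] mult_left_mono) auto
    also have "\<dots> = \<bar>A\<bar> * (e * norm (z - x))" using r0 C by (simp add: e'_def)
    finally have "\<bar>A\<bar> * \<bar>rho z - r0 - F (z - x) / A\<bar> \<le> \<bar>A\<bar> * (e * norm (z - x))"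
      using A by (simp add: right_diff_distrib abs_minus_commute flip: abs_mult)
    then show "norm (rho z - rho x - F (z - x) / F (radial x - c)) \<le> e * norm (z - x)"
      using A by (simp add: r0_def A_def)
  qed (use d3 d4 in auto)
qed

text \<open>A bootstrap: the derivative of \<open>rho\<close> is a twice differentiable function
  \<open>G v\<close> of \<open>radial x\<close>, and \<open>radial\<close> is built from
  \<open>rho\<close>; so each order known for \<open>rho\<close> yields the next, up to
  three.\<close>

lemma kdiff_rho:
  assumes "Ck_hypersurface 3 (frontier K)"
  shows "kdiff 3 (- {0}) rho"
proof (rule kdiff_local)
  fix x0 :: 'a assume "x0 \<in> - {0}"
  then have x0: "x0 \<noteq> 0" by simp
  obtain U f where U: "open U" "radial x0 \<in> U" and Ck: "Ck_on 3 U f"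
    and zero: "frontier K \<inter> U = {x \<in> U. f x = 0}"
    and reg: "\<And>x. x \<in> frontier K \<inter> U \<Longrightarrow> frechet_derivative f (at x) \<noteq> (\<lambda>v. 0)"
    using assms[unfolded Ck_hypersurface_def, rule_format, OF radial_frontier[OF x0]]
    by (elim exE conjE) (rule that, auto)
  have f3: "kdiff (Suc 2) U f" using Ck_on_imp_kdiff[OF Ck] by (simp add: eval_nat_numeral)
  define F where "F z = frechet_derivative f (at z)" for z
  have F: "(f has_derivative F z) (at z)" if "z \<in> U" for z
    unfolding F_def by (rule kdiff_derivative[OF f3 that])
  have F2: "kdiff 2 U (\<lambda>z. F z v)" for v using f3 unfolding F_def kdiff.simps(2) by blast
  \<comment> \<open>The derivative of \<open>f\<close> in the direction from the centre, the
    denominator in \<open>rho_has_derivative\<close>; \<open>transversal\<close> makes it nonzero on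
    the frontier.\<close>
  define g where "g z = F z (z - c)" for z
  have g_eq: "(\<Sum>b\<in>Basis. (z \<bullet> b + - (c \<bullet> b)) * F z b) = g z" if "z \<in> U" for z
  proof -
    have lin: "linear (F z)" by (rule has_derivative_linear[OF F[OF that]])
    have "g z = F z (\<Sum>b\<in>Basis. ((z - c) \<bullet> b) *\<^sub>R b)" by (simp only: g_def euclidean_representation)
    then show ?thesis by (simp add: linear_sum[OF lin] linear_cmul[OF lin] inner_simps)
  qed
  have g2: "kdiff 2 U g"
    by (rule kdiff_cong[OF U(1) g_eq], assumption)
      (intro kdiff_sum kdiff_mult kdiff_add kdiff_inner kdiff_const F2 U(1))
  define U' where "U' = U \<inter> g -` (- {0})"
  have "continuous_on U g"
    using g2 by (auto simp: numeral_2_eq_2 intro!: continuous_at_imp_continuous_on differentiable_imp_continuous_within)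
  then have U': "open U'" unfolding U'_def using U(1) by (intro continuous_open_preimage) auto
  have gne: "g z \<noteq> 0" if "z \<in> frontier K \<inter> U" for z
    unfolding g_def using that F reg[OF that]
    by (intro transversal[OF U(1) _ _ zero]) (auto simp: F_def differentiable_def)
  define V where "V = (- {0}) \<inter> radial -` U"
  have V: "open V"
    unfolding V_def using U(1)
    by (intro continuous_open_preimage continuous_at_imp_continuous_on) (auto intro: continuous_radial)
  have VU': "radial ` V \<subseteq> U'" using gne radial_frontier by (auto simp: V_def U'_def)
  define G where "G v z = F z v * inverse (g z)" for v z
  have G2: "kdiff 2 U' (G v)" for v
  proof -
    have "kdiff 2 U' (\<lambda>z. F z v)" "kdiff 2 U' g" by (rule kdiff_subset[OF F2] kdiff_subset[OF g2], simp add: U'_def)+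
    then show ?thesis unfolding G_def by (intro kdiff_mult kdiff_inverse U') (auto simp: U'_def)
  qed
  have der: "(rho has_derivative (\<lambda>v. G v (radial x))) (at x)" if x: "x \<in> V" for x
  proof -
    have xU: "x \<noteq> 0" "radial x \<in> U" using x by (auto simp: V_def)
    have "(rho has_derivative (\<lambda>v. F (radial x) v / F (radial x) (radial x - c))) (at x)"
      by (rule rho_has_derivative[OF xU(1) U(1) xU(2) _ F[OF xU(2)]])
        (use zero gne[of "radial x"] radial_frontier xU in \<open>auto simp: g_def\<close>)
    then show ?thesis by (simp add: G_def g_def divide_inverse)
  qed
  have step: "kdiff (Suc k) V rho" if k: "kdiff k V rho" "\<And>v. kdiff k U' (G v)" for k
  proof (rule kdiff_SucI[OF V der])
    fix v
    have "radial x \<bullet> b = c \<bullet> b + inverse (rho x) * (x \<bullet> b)" for x b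
      by (simp add: radial_def inner_simps divide_inverse)
    moreover have "kdiff k V (\<lambda>x. c \<bullet> b + inverse (rho x) * (x \<bullet> b))" for b
      by (intro kdiff_add kdiff_mult kdiff_const kdiff_inverse kdiff_inner V k)
        (use rho_positive in \<open>force simp: V_def\<close>)
    ultimately show "kdiff k V (\<lambda>x. G v (radial x))"
      by (intro kdiff_compose[OF V VU' k(2)]) simp
  qed
  have "kdiff 1 U' (G v)" for v using G2[of v] kdiff_mono[of 1 U' "G v"] by (simp add: numeral_2_eq_2)
  then have "kdiff 1 V rho" "kdiff (Suc 1) V rho" using step[of 0] step[of 1] by auto
  then have "kdiff 3 V rho" using step[of 2] G2 by (simp add: eval_nat_numeral)
  moreover have "x0 \<in> V" using x0 U(2) by (simp add: V_def)
  ultimately show "\<exists>V. x0 \<in> V \<and> kdiff 3 V rho" by blast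
qed

abbreviation "D1 x \<equiv> frechet_derivative rho (at x)"
abbreviation "D2 x v \<equiv> frechet_derivative (\<lambda>y. D1 y v) (at x)"
abbreviation "D3 x v w \<equiv> frechet_derivative (\<lambda>y. D2 y v w) (at x)"

lemma gauge3_rho:
  assumes "Ck_hypersurface 3 (frontier K)"
  shows "gauge3 rho (\<lambda>x. D1 x) (\<lambda>x v. D2 x v) (\<lambda>x v w. D3 x v w)"
proof -
  have k3: "kdiff (Suc (Suc (Suc 0))) (- {0}) rho" using kdiff_rho[OF assms] by (simp add: eval_nat_numeral)
  have k2: "kdiff (Suc (Suc 0)) (- {0}) (\<lambda>x. D1 x v)" for v using k3 by simp
  have k1: "kdiff (Suc 0) (- {0}) (\<lambda>x. D2 x v w)" for v w using k2[of v] by simp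
  show ?thesis
    by unfold_locales
      (use rho_homogeneous rho_positive rho_subadditive kdiff_derivative[OF k3] kdiff_derivative[OF k2]
         kdiff_derivative[OF k1] in auto)
qed

end

section \<open>Assembling the hypotheses\<close>

context gauge3
begin

lemma D3_scale: assumes "x \<noteq> 0" "c > 0" shows "c\<^sup>2 * D3 (c *\<^sub>R x) u v w = D3 x u v w"
proof -
  have "((\<lambda>y. c *\<^sub>R y) has_derivative (\<lambda>y. c *\<^sub>R y)) (at x)" by (auto intro!: derivative_eq_intros)
  from diff_chain_at[OF this D3] assms
  have "((\<lambda>y. D2 (c *\<^sub>R y) u v) has_derivative (\<lambda>w. D3 (c *\<^sub>R x) u v (c *\<^sub>R w))) (at x)" by (simp add: o_def)
  from has_derivative_mult_right[OF this, of c]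
  have 1: "((\<lambda>y. c * D2 (c *\<^sub>R y) u v) has_derivative (\<lambda>w. c * D3 (c *\<^sub>R x) u v (c *\<^sub>R w))) (at x)" .
  have 2: "((\<lambda>y. c * D2 (c *\<^sub>R y) u v) has_derivative D3 x u v) (at x)"
    by (rule has_derivative_transform_within_open[OF D3[OF assms(1)], of "- {0}"])
      (use assms D2_scale in auto)
  from has_derivative_unique[OF 1 2] have "c * D3 (c *\<^sub>R x) u v (c *\<^sub>R w) = D3 x u v w" by metis
  then show ?thesis
    using linear_cmul[OF linear_D(3)[of "c *\<^sub>R x"]] assms by (simp add: power2_eq_square)
qed

lemma semidefinite_D2: "good x \<Longrightarrow> semidefinite_form (D2 x) x"
proof
  assume x: "good x"
  then have xne: "x \<noteq> 0" by (simp add: good_def)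
  show "bilinear (D2 x)" by (rule D2_bilinear[OF xne])
  show "D2 x u v = D2 x v u" for u v by (rule D2_sym[OF xne])
  show "D2 x x v = 0" for v by (rule D2_self(2)[OF xne])
  show "v \<notin> span {x} \<Longrightarrow> D2 x v v > 0" for v using x by (simp add: good_def)
  show "x \<noteq> 0" by (rule xne)
qed

text \<open>The lights are given on the boundary only. As \<open>D2\<close> has degree -1 and
  \<open>D3\<close> degree -2, the identity extends along rays with \<open>l\<close> of degree
  -1.\<close>

lemma divisible_unit_suffices:
  assumes unit: "\<And>x. good x \<Longrightarrow> rho x = 1 \<Longrightarrow>
      \<exists>l. \<forall>u v w. D3 x u v w = (l \<bullet> u) * D2 x v w + (l \<bullet> v) * D2 x u w + (l \<bullet> w) * D2 x u v"
    and x: "good x"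
  shows "\<exists>l. \<forall>u v w. D3 x u v w = (l \<bullet> u) * D2 x v w + (l \<bullet> v) * D2 x u w + (l \<bullet> w) * D2 x u v"
proof -
  have xne: "x \<noteq> 0" using x by (simp add: good_def)
  define k where "k = 1 / rho x"
  have k: "k > 0" using rho_pos[OF xne] by (simp add: k_def)
  define p where "p = k *\<^sub>R x"
  have pne: "p \<noteq> 0" using k xne by (simp add: p_def)
  have D2p: "D2 p v w = D2 x v w / k" for v w
    using D2_scale[OF xne k, of v w] k by (simp add: p_def field_simps)
  have "good p"
    unfolding good_def
  proof (intro conjI allI impI pne)
    fix v assume "v \<notin> span {p}"
    moreover have "span {p} = span {x}"
      unfolding p_def by (rule span_image_scale[of "{x}" "\<lambda>_. k", simplified]) (use k in simp)
    ultimately have "v \<notin> span {x}" by simp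
    then show "D2 p v v > 0" using x k by (simp add: D2p good_def)
  qed
  moreover have "rho p = 1" using rho_scale[OF k, of x] rho_pos[OF xne] by (simp add: p_def k_def)
  ultimately obtain l where l: "\<And>u v w. D3 p u v w = (l \<bullet> u) * D2 p v w + (l \<bullet> v) * D2 p u w + (l \<bullet> w) * D2 p u v"
    using unit by blast
  have "D3 x u v w = ((k *\<^sub>R l) \<bullet> u) * D2 x v w + ((k *\<^sub>R l) \<bullet> v) * D2 x u w + ((k *\<^sub>R l) \<bullet> w) * D2 x u v" for u v w
  proof -
    have "D3 x u v w = k\<^sup>2 * D3 p u v w" using D3_scale[OF xne k] by (simp add: p_def)
    moreover have "D2 x v w = k * D2 p v w" for v w using D2_scale[OF xne k] by (simp add: p_def)
    ultimately show ?thesis by (simp add: l power2_eq_square algebra_simps)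
  qed
  then show ?thesis by blast
qed

end

lemma general_linear_position_translation:
  fixes X :: "'a::euclidean_space set"
  assumes "general_linear_position T p X"
  shows "general_linear_position ((+) a ` T) (a + p) ((+) a ` X)"
  unfolding general_linear_position_def
proof (intro conjI allI impI notI)
  show "(+) a ` X \<subseteq> (+) a ` T" using assms by (auto simp: general_linear_position_def)
next
  fix Y assume Y: "Y \<subseteq> (+) a ` X \<and> finite Y \<and> int (card Y) = aff_dim ((+) a ` T)"
    and "\<exists>H. affine H \<and> H \<subseteq> (+) a ` T \<and> aff_dim H = aff_dim ((+) a ` T) - 1 \<and> a + p \<in> H \<and> Y \<subseteq> H"
  then obtain H where H: "affine H" "H \<subseteq> (+) a ` T" "aff_dim H = aff_dim T - 1" "a + p \<in> H" "Y \<subseteq> H"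
    by (auto simp: aff_dim_translation_eq)
  let ?Y = "(+) (- a) ` Y" and ?H = "(+) (- a) ` H"
  have "?Y \<subseteq> X" "finite ?Y" using Y by auto
  moreover have "int (card ?Y) = aff_dim T" using Y by (simp add: card_image aff_dim_translation_eq)
  moreover have "affine ?H" using H(1) by (subst affine_translation[symmetric])
  moreover have "?H \<subseteq> T" using H(2) by auto
  moreover have "aff_dim ?H = aff_dim T - 1" using H(3) by (simp only: aff_dim_translation_eq)
  moreover have "p \<in> ?H" using H(4) by (auto intro!: image_eqI[of _ _ "a + p"])
  moreover have "?Y \<subseteq> ?H" using H(5) by blast
  ultimately show False using assms unfolding general_linear_position_def by blast
qed

context semidefinite_form
begin

text \<open>A nontrivial relation between the \<open>M q\<close> makes the differences
  \<open>q - p\<close> dependent; n - 1 lights containing them then lie in a hyperplane of the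
  tangent hyperplane through \<open>p\<close>.\<close>

lemma general_position_independent:
  fixes g :: 'a
  assumes X: "finite X" "card X \<ge> DIM('a) - 1" "\<And>q. q \<in> X \<Longrightarrow> g \<bullet> q = 1" and gp: "g \<bullet> p = 1"
    and general: "general_linear_position {z. g \<bullet> z = 1} p X"
    and Y: "Y \<subseteq> X" "card Y \<le> DIM('a) - 1" and rel: "(\<Sum>q\<in>Y. l q *\<^sub>R M q) = 0" and q0: "q0 \<in> Y"
  shows "l q0 = 0"
proof (rule ccontr)
  assume l0: "l q0 \<noteq> 0"
  have gne: "g \<noteq> 0" using gp by auto
  have finY: "finite Y" using X(1) Y(1) finite_subset by blast
  have "M (\<Sum>q\<in>Y. l q *\<^sub>R q) = 0" using rel by (simp add: linear_sum[OF linear_M] linear_cmul[OF linear_M])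
  then obtain k where k: "(\<Sum>q\<in>Y. l q *\<^sub>R q) = k *\<^sub>R p" unfolding M_eq_0_iff by (auto simp: span_singleton)
  have "g \<bullet> (\<Sum>q\<in>Y. l q *\<^sub>R q) = (\<Sum>q\<in>Y. l q)"
    using X(3) Y(1) by (simp add: inner_sum_right) (intro sum.cong, auto)
  then have "(\<Sum>q\<in>Y. l q) = k" using gp by (simp add: k)
  \<comment> \<open>\<open>g\<close> is 1 on all lights and at \<open>p\<close>, so the multiple of
    \<open>p\<close> equals the coefficient sum and is absorbed by the differences.\<close>
  then have sum0: "(\<Sum>q\<in>Y. l q *\<^sub>R (q - p)) = 0"
    by (simp add: scaleR_diff_right sum_subtractf k flip: scaleR_left.sum)
  \<comment> \<open>General position speaks of exactly n - 1 points, so \<open>Y\<close> is padded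
    to that size.\<close>
  obtain Z where Z: "Y \<subseteq> Z" "Z \<subseteq> X" "card Z = DIM('a) - 1"
    using exists_subset_between[OF Y(2) X(2) Y(1) X(1)] by blast
  have finZ: "finite Z" using X(1) Z finite_subset by blast
  have q0Z: "q0 \<in> Z" using Z q0 by blast
  let ?S = "(\<lambda>q. q - p) ` (Z - {q0})"
  have "l q0 *\<^sub>R (q0 - p) = - (\<Sum>q\<in>Y - {q0}. l q *\<^sub>R (q - p))"
    using sum0 sum.remove[OF finY q0, of "\<lambda>q. l q *\<^sub>R (q - p)"] by (simp add: eq_neg_iff_add_eq_0)
  also have "\<dots> \<in> span ?S"
    by (intro span_neg span_sum span_mul span_base) (use Z in auto)
  finally have q0S: "q0 - p \<in> span ?S" using l0 by (simp add: in_span_scale_iff)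
  have S: "(\<lambda>q. q - p) ` Z \<subseteq> span ?S"
  proof
    fix v assume "v \<in> (\<lambda>q. q - p) ` Z"
    then obtain q where "q \<in> Z" "v = q - p" by blast
    then show "v \<in> span ?S" using q0S by (cases "q = q0") (auto intro: span_base)
  qed
  let ?T = "{v. g \<bullet> v = 0}"
  have subT: "subspace ?T" by (rule subspace_hyperplane)
  have "card ?S \<le> card (Z - {q0})" by (rule card_image_le) (use finZ in simp)
  also have "\<dots> < DIM('a) - 1" using Z(3) q0Z finZ by (metis card_Diff1_less)
  finally have "dim ?S < dim ?T" using dim_le_card'[of ?S] finZ dim_hyperplane[OF gne] by simp
  moreover have ST: "?S \<subseteq> ?T" using Z(2) X(3) gp by (auto simp: inner_diff_right)
  then have "span ?S \<subseteq> ?T" by (rule span_minimal[OF _ subT])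
  ultimately have "span ?S \<subset> span ?T" using span_eq_iff[THEN iffD2, OF subT] by (metis dim_span psubsetI less_irrefl)
  \<comment> \<open>A direction inside the tangent space orthogonal to all differences; its level
    through \<open>p\<close> cuts out the forbidden hyperplane.\<close>
  then obtain a where a: "a \<noteq> 0" "a \<in> span ?T" "\<And>y. y \<in> span ?S \<Longrightarrow> orthogonal a y"
    using orthogonal_to_subspace_exists_gen by metis
  have ga: "g \<bullet> a = 0" using a(2) span_eq_iff[THEN iffD2, OF subT] by blast
  let ?A = "{z. g \<bullet> z = 1}"
  define H where "H = ?A \<inter> {z. a \<bullet> z = a \<bullet> p}"
  have affA: "affine ?A" by (rule affine_hyperplane)
  have "p \<in> H" using gp by (simp add: H_def)
  moreover have "p + a \<in> ?A - {z. a \<bullet> z = a \<bullet> p}" using gp ga a(1) by (simp add: inner_add_right)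
  ultimately have "aff_dim H = aff_dim ?A - 1"
    using aff_dim_affine_Int_hyperplane[OF affA, of a "a \<bullet> p"] by (auto simp: H_def)
  moreover have "affine H" unfolding H_def by (intro affine_Int affA affine_hyperplane)
  moreover have "Z \<subseteq> H"
  proof
    fix q assume q: "q \<in> Z"
    then have "q - p \<in> span ?S" using S by blast
    then have "a \<bullet> (q - p) = 0" using a(3) by (simp add: orthogonal_def)
    then show "q \<in> H" using q Z(2) X(3) by (auto simp: H_def inner_diff_right)
  qed
  moreover have "int (card Z) = aff_dim ?A" using Z(3) aff_dim_hyperplane[OF gne, of 1] by simp
  ultimately show False
    using general Z(2) finZ \<open>p \<in> H\<close> unfolding general_linear_position_def H_def by blast
qed

end

section \<open>Tangent hyperplanes and shadow boundaries in terms of the gauge\<close>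

context centred_body
begin

text \<open>Differentiating \<open>rho = 1\<close> along a curve gives one inclusion; the radial
  projection of the line \<open>x + t v\<close> is a curve for the other.\<close>

lemma tangent_hyperplane_frontier:
  assumes C3: "Ck_hypersurface 3 (frontier K)" and x: "rho x = 1"
  shows "tangent_hyperplane (frontier K) (c + x) = {z. D1 x (z - c) = 1}"
proof -
  interpret gauge3 rho "\<lambda>x. D1 x" "\<lambda>x v. D2 x v" "\<lambda>x v w. D3 x v w" by (rule gauge3_rho[OF C3])
  have xne: "x \<noteq> 0" using x rho_zero by auto
  note lin = linear_D(1)[OF xne]
  have "D1 x v = 0"
    if e: "e > 0" and g: "\<gamma> 0 = c + x" "\<And>t. t \<in> {-e<..<e} \<Longrightarrow> \<gamma> t \<in> frontier K"
      and v: "(\<gamma> has_vector_derivative v) (at 0)" for \<gamma> :: "real \<Rightarrow> 'a" and e v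
  proof -
    have "((\<lambda>t. \<gamma> t - c) has_derivative (\<lambda>h. h *\<^sub>R v)) (at 0)"
      using v unfolding has_vector_derivative_def by (auto intro!: derivative_eq_intros)
    moreover have "(rho has_derivative D1 x) (at (\<gamma> 0 - c))" using D1[OF xne] g(1) by simp
    ultimately have 1: "((\<lambda>t. rho (\<gamma> t - c)) has_derivative (\<lambda>h. D1 x (h *\<^sub>R v))) (at 0)"
      using diff_chain_at[of "\<lambda>t. \<gamma> t - c"] by (simp add: o_def)
    have 2: "((\<lambda>t. rho (\<gamma> t - c)) has_derivative (\<lambda>h. 0)) (at 0)"
    proof (rule has_derivative_transform_within_open[of "\<lambda>t. 1" _ _ _ "{-e<..<e}"])
      fix t assume "t \<in> {-e<..<e}"
      then show "1 = rho (\<gamma> t - c)" using g(2) frontier_iff[of "\<gamma> t - c"] by simp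
    qed (use e in auto)
    from has_derivative_unique[OF 1 2] have "D1 x (1 *\<^sub>R v) = 0" by metis
    then show ?thesis by simp
  qed
  then have sub: "D1 x (z - c) = 1" if "z \<in> tangent_hyperplane (frontier K) (c + x)" for z
    using that D1_self[OF xne] x linear_add[OF lin]
    by (fastforce simp: tangent_hyperplane_def algebra_simps)
  have sup: "z \<in> tangent_hyperplane (frontier K) (c + x)" if z: "D1 x (z - c) = 1" for z
  proof -
    define v where "v = z - c - x"
    have D1v: "D1 x v = 0" using z D1_self[OF xne] x by (simp add: v_def linear_diff[OF lin])
    \<comment> \<open>The projection factor \<open>1 / rho\<close> has derivative zero at
      \<open>t = 0\<close> because \<open>D1 x v = 0\<close>, so the velocity remains
      \<open>v\<close>.\<close>
    define \<gamma> where "\<gamma> t = radial (x + t *\<^sub>R v)" for t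
    have "isCont (\<lambda>t. x + t *\<^sub>R v) 0" by (intro continuous_intros)
    then have "\<forall>\<^sub>F t in at 0. x + t *\<^sub>R v \<noteq> 0" using xne by (intro tendsto_imp_eventually_ne[of _ x]) (auto simp: isCont_def)
    then obtain e where e: "e > 0" "\<And>t. t \<noteq> 0 \<Longrightarrow> \<bar>t\<bar> < e \<Longrightarrow> x + t *\<^sub>R v \<noteq> 0"
      unfolding eventually_at by (auto simp: dist_real_def)
    have g: "\<gamma> t \<in> frontier K" if "t \<in> {-e<..<e}" for t
      unfolding \<gamma>_def by (rule radial_frontier) (use e(2)[of t] that xne in \<open>cases "t = 0"; auto simp: abs_less_iff\<close>)
    have rd: "((\<lambda>t. rho (x + t *\<^sub>R v)) has_real_derivative 0) (at 0)" using line(1)[of x 0 v] xne D1v by simp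
    have "((\<lambda>t. 1 / rho (x + t *\<^sub>R v)) has_real_derivative 0) (at 0)"
      by (rule DERIV_cong[OF DERIV_divide[OF DERIV_const rd]]) (use x in auto)
    then have "((\<lambda>t. (1 / rho (x + t *\<^sub>R v)) *\<^sub>R (x + t *\<^sub>R v)) has_vector_derivative
        (1 / rho (x + 0 *\<^sub>R v)) *\<^sub>R v + 0 *\<^sub>R (x + 0 *\<^sub>R v)) (at 0)"
      by (intro has_vector_derivative_scaleR) (auto intro!: derivative_eq_intros)
    then have "(\<gamma> has_vector_derivative v) (at 0)"
      unfolding \<gamma>_def radial_def using x has_vector_derivative_add[OF has_vector_derivative_const[of c]] by fastforce
    moreover have "\<gamma> 0 = c + x" using x by (simp add: \<gamma>_def radial_def)
    moreover have "z = (c + x) + v" by (simp add: v_def)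
    ultimately show ?thesis unfolding tangent_hyperplane_def using e(1) g by blast
  qed
  show ?thesis using sub sup by blast
qed

text \<open>On the line through \<open>q\<close> and \<open>c + y\<close> the function
  \<open>D1 y (z - c)\<close> of \<open>z\<close> is constantly 1, whereas \<open>D1_le\<close>
  keeps it below 1 in the interior.\<close>

lemma shadow_boundary_mem:
  assumes C3: "Ck_hypersurface 3 (frontier K)" and y: "rho y = 1" "D1 y (q - c) = 1"
  shows "c + y \<in> shadow_boundary K q"
proof -
  interpret gauge3 rho "\<lambda>x. D1 x" "\<lambda>x v. D2 x v" "\<lambda>x v w. D3 x v w" by (rule gauge3_rho[OF C3])
  have yne: "y \<noteq> 0" using y rho_zero by auto
  note lin = linear_D(1)[OF yne]
  have "z \<notin> interior K" if z: "z \<in> affine hull {q, c + y}" for z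
  proof
    assume "z \<in> interior K"
    then have "rho (z - c) < 1" using rho_interior[of "z - c"] by simp
    then have less: "D1 y (z - c) < 1" using D1_le[OF yne, of "z - c"] by simp
    obtain u v where uv: "z = u *\<^sub>R q + v *\<^sub>R (c + y)" "u + v = 1"
      using z unfolding affine_hull_2 by auto
    have "z - c = u *\<^sub>R (q - c) + v *\<^sub>R y + (u + v - 1) *\<^sub>R c" by (simp add: uv(1) algebra_simps)
    then have "D1 y (z - c) = u + v" using y D1_self[OF yne] uv(2) by (simp add: linear_add[OF lin] linear_cmul[OF lin])
    then show False using less uv(2) by simp
  qed
  then show ?thesis using y(1) frontier_iff[of y] by (auto simp: shadow_boundary_def)
qed

lemma cubic_divisible_at:
  assumes C3: "Ck_hypersurface 3 (frontier K)" and dim: "DIM('a) \<ge> 4"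
    and x: "gauge3.good D2 x" "rho x = 1"
    and X: "finite X" "card X \<ge> num_lights DIM('a)"
      "X \<subseteq> tangent_hyperplane (frontier K) (c + x) - K"
      "general_linear_position (tangent_hyperplane (frontier K) (c + x)) (c + x) X"
      "\<And>q. q \<in> X \<Longrightarrow> flat (shadow_boundary K q)"
  shows "\<exists>l. \<forall>u v w. D3 x u v w = (l \<bullet> u) * D2 x v w + (l \<bullet> v) * D2 x u w + (l \<bullet> w) * D2 x u v"
proof -
  interpret gauge3 rho "\<lambda>x. D1 x" "\<lambda>x v. D2 x v" "\<lambda>x v w. D3 x v w" by (rule gauge3_rho[OF C3])
  have xne: "x \<noteq> 0" using x(2) rho_zero by auto
  interpret semidefinite_form "D2 x" x by (rule semidefinite_D2[OF x(1)])
  note lin = linear_D(1)[OF xne]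
  define g where "g = (\<Sum>b\<in>Basis. D1 x b *\<^sub>R b)"
  have g: "g \<bullet> v = D1 x v" for v unfolding g_def by (rule linear_functional_inner[OF lin])
  define X' where "X' = (\<lambda>q. q - c) ` X"
  have inj: "inj_on (\<lambda>q. q - c) X" by (rule inj_onI) simp
  have tang: "tangent_hyperplane (frontier K) (c + x) = {z. g \<bullet> (z - c) = 1}"
    unfolding g by (rule tangent_hyperplane_frontier[OF C3 x(2)])
  have cX': "card X' = card X" "finite X'" using inj X(1) by (auto simp: X'_def card_image)
  have gX: "g \<bullet> q = 1" if "q \<in> X'" for q using that X(3) tang by (auto simp: X'_def)
  have gx: "g \<bullet> x = 1" using D1_self[OF xne] x(2) by (simp add: g)
  have gen: "general_linear_position {z. g \<bullet> z = 1} x X'"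
  proof -
    have "(+) (- c) ` X = X'" "(+) (- c) ` {z. g \<bullet> (z - c) = 1} = {z. g \<bullet> z = 1}"
      by (auto simp: X'_def image_iff) (metis add_diff_cancel_left' add_uminus_conv_diff add.commute)
    then show ?thesis using general_linear_position_translation[OF X(4), of "- c"] by (simp add: tang)
  qed
  \<comment> \<open>Exactly (n - 1) + 1 + r lights are kept: 3 + 1 + 3 = 7 for n = 4, and (n - 1) +
    1 + 2 = n + 2 otherwise.\<close>
  define r where "r = (if DIM('a) = 4 then 3 else 2 :: nat)"
  have "card X' \<ge> (DIM('a) - 1) + 1 + r" using X(2) cX' dim by (auto simp: num_lights_def r_def split: if_splits)
  then obtain Y where Y: "Y \<subseteq> X'" "card Y = (DIM('a) - 1) + 1 + r" using obtain_subset_with_card_n by metis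
  have cub: "\<exists>m. \<forall>v. D2 x q v = 0 \<longrightarrow> D3 x q v v = m * D2 x v v" if q: "q \<in> X'" for q
  proof -
    obtain q' where q': "q' \<in> X" "q = q' - c" using q by (auto simp: X'_def)
    obtain a b where ab: "a \<noteq> 0" "shadow_boundary K q' \<subseteq> {z. a \<bullet> z = b}"
      using X(5)[OF q'(1)] unfolding flat_def by blast
    have Dq: "D1 x q = 1" using gX[OF q] by (simp add: g)
    \<comment> \<open>The only multiple of \<open>x\<close> in the tangent hyperplane is
      \<open>x\<close> itself, and \<open>c + x\<close> belongs to \<open>K\<close>, which contains
      no light.\<close>
    have "q \<notin> span {x}"
    proof
      assume "q \<in> span {x}"
      then obtain k where k: "q = k *\<^sub>R x" by (auto simp: span_singleton)
      then have "k = 1" using Dq D1_self[OF xne] x(2) by (simp add: linear_cmul[OF lin])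
      then have "q' = c + x" using k q' by (simp add: algebra_simps)
      then show False using q'(1) X(3) rho_le_1_iff[of x] x(2) by auto
    qed
    moreover have "a \<bullet> y = b - a \<bullet> c" if y: "rho y = 1" "D1 y q = 1" for y
      using shadow_boundary_mem[OF C3 y(1), of q'] y(2) q'(2) ab(2) by (auto simp: inner_add_right)
    ultimately show ?thesis
      using flat_shadow_cubic[OF _ x(2,1) Dq _ ab(1)] dim by auto
  qed
  interpret lights "D2 x" x "\<lambda>u v w. D3 x u v w" Y "DIM('a) - 1" r
  proof
    show "bilinear (D3 x u)" for u by (rule D3_bilinear[OF xne])
    show "D3 x u v w = D3 x v u w" "D3 x u v w = D3 x u w v" for u v w
      by (rule D3_sym[OF xne])+
    show "D3 x x v w = - D2 x v w" for v w
      using D3_self[OF xne, of v w] D3_sym[OF xne] by metis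
    show "(\<Sum>q\<in>Z. l q *\<^sub>R M q) = 0 \<Longrightarrow> q \<in> Z \<Longrightarrow> l q = 0"
      if "Z \<subseteq> Y" "card Z \<le> DIM('a) - 1" for Z l q
      by (rule general_position_independent[OF cX'(2) _ gX gx gen])
        (use that Y card_mono[OF cX'(2) Y(1)] in auto)
    show "\<exists>m. \<forall>v. D2 x q v = 0 \<longrightarrow> D3 x q v v = m * D2 x v v" if "q \<in> Y" for q
      using cub Y(1) that by blast
  qed (use dim Y cX' finite_subset in \<open>auto simp: r_def\<close>)
  show ?thesis by (rule cubic_form_divisible)
qed

end

theorem theorem1p3:
  fixes K :: "(real ^ 'n) set"
  assumes "CARD('n) \<ge> 4"
    and "convex_body K"
    and "Ck_hypersurface 3 (frontier K)"
    and "\<And>p. p \<in> frontier K \<Longrightarrow>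
      \<exists>X. finite X \<and> card X \<ge> num_lights CARD('n) \<and>
        X \<subseteq> tangent_hyperplane (frontier K) p - K \<and>
        general_linear_position (tangent_hyperplane (frontier K) p) p X \<and>
        (\<forall>q\<in>X. flat (shadow_boundary K q))"
  shows "ellipsoid K"
proof -
  obtain c where c: "c \<in> interior K" using assms(2) by (auto simp: convex_body_def)
  interpret centred_body K c using assms(2) c by unfold_locales (auto simp: convex_body_def)
  interpret gauge3 rho "\<lambda>x. D1 x" "\<lambda>x v. D2 x v" "\<lambda>x v w. D3 x v w" by (rule gauge3_rho[OF assms(3)])
  have dim: "DIM(real ^ 'n) \<ge> 4" using assms(1) by simp
  have "\<exists>l. \<forall>u v w. D3 x u v w = (l \<bullet> u) * D2 x v w + (l \<bullet> v) * D2 x u w + (l \<bullet> w) * D2 x u v"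
    if "good x" for x
  proof (rule divisible_unit_suffices[OF _ that])
    fix x assume x: "good x" "rho x = 1"
    then have "c + x \<in> frontier K" by (simp add: frontier_iff)
    then obtain X where "finite X" "card X \<ge> num_lights CARD('n)"
        "X \<subseteq> tangent_hyperplane (frontier K) (c + x) - K"
        "general_linear_position (tangent_hyperplane (frontier K) (c + x)) (c + x) X"
        "\<forall>q\<in>X. flat (shadow_boundary K q)"
      using assms(4) by blast
    then show "\<exists>l. \<forall>u v w. D3 x u v w = (l \<bullet> u) * D2 x v w + (l \<bullet> v) * D2 x u w + (l \<bullet> w) * D2 x u v"
      by (intro cubic_divisible_at[OF assms(3) dim x, of X]) auto
  qed
  then obtain B be ga where "\<And>x. x \<noteq> 0 \<Longrightarrow> conic_at B be ga x" using conic_everywhere[OF dim] by blast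
  then obtain f :: "real ^ 'n \<Rightarrow> real ^ 'n" and c0 where f: "linear f" "bij f"
    and eq: "{x. rho x \<le> 1} = (\<lambda>x. c0 + f x) ` cball 0 1"
    using conic_everywhere_ellipsoid[of B be ga] dim by auto
  have "K = (+) c ` {x. rho x \<le> 1}"
    unfolding rho_le_1_iff by (auto simp: image_iff) (metis add.commute diff_add_cancel)
  then have "K = (\<lambda>x. (c + c0) + f x) ` cball 0 1" unfolding eq by (simp add: image_image add.assoc)
  then show ?thesis unfolding ellipsoid_def using f by blast
qed

end
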